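(* Let $G=(U,V,E)$ be a connected bipartite graph and let $(P_x)_{x\in U\cup V}$ be a $G$-projection family in generic position on a Hilbert space $\mathcal{H}$. Then there are operators $(C_{uv})_{u\in U,v\in V}$ on a Hilbert space $\mathcal{K}$ such that, up to unitary equivalence (one unitary $\mathcal{H}\to\mathcal{K}^V$ for all $P_x$ simultaneously), one has \begin{align*} P_u &= (C_{uv_1}^\ast C_{uv_2})_{v_1,v_2\in V}\in M_V(\mathcal{B}(\mathcal{K})),\\ P_v &= (\delta_{v_1v}\delta_{v_2v})_{v_1,v_2\in V}\in M_V(\mathcal{B}(\mathcal{K})) \end{align*} for all $u\in U$ and $v\in V$. The operator $C_{uv}$ vanishes if $\{u,v\}\notin E$, and is injective with dense range otherwise. Moreover, the operators $(C_{uv})_{u\in U,v\in V}$ satisfy \begin{align*} \sum_{u\in U} C_{uv_1}^\ast C_{uv_2} &= \delta_{v_1v_2}\quad\text{for all } v_1,v_2\in V,\\ \sum_{v\in V} C_{u_1v}C_{u_2v}^\ast &= \delta_{u_1u_2}\quad\text{for all } u_1,u_2\in U. \end{align*} Conversely, every family of operators $(C_{uv})_{u\in U,v\in V}$ on a Hilbert space $\mathcal{K}$ such that $C_{uv}=0$ for $\{u,v\}\notin E$, $C_{uv}$ is injective with dense range for $\{u,v\}\in E$, $\sum_{u\in U} C_{uv_1}^\ast C_{uv_2}=\delta_{v_1v_2}$ for all $v_1,v_2\in V$, and $\sum_{v\in V} C_{u_1v}C_{u_2v}^\ast=\delta_{u_1u_2}$ for all $u_1,u_2\in U$, gives rise to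 a $G$-projection family $(P_x)_{x\in U\cup V}$ on $\mathcal{K}^V$ via the formulas $P_u=(C_{uv_1}^\ast C_{uv_2})_{v_1,v_2\in V}$ for $u\in U$ and $P_v=(\delta_{v_1v}\delta_{v_2v})_{v_1,v_2\in V}$ for $v\in V$.
   Context: A bipartite graph $G=(U,V,E)$ consists of two finite disjoint vertex sets $U,V$ and an edge set $E\subset\{\{u,v\}: u\in U, v\in V\}$. A $G$-projection family on a Hilbert space $\mathcal{H}$ is a family of (orthogonal) projections $(P_x)_{x\in U\cup V}\subset \mathcal{B}(\mathcal{H})$ with $\sum_{u\in U}P_u=1=\sum_{v\in V}P_v$ and $P_uP_v=0$ for all $u\in U,v\in V$ with $\{u,v\}\notin E$. Put $L_x:=\mathrm{im}(P_x)$. The family is in generic position if $L_u\cap L_v^\perp=\{0\}=L_u^\perp\cap L_v$ for all edges $\{u,v\}\in E$ (with $u\in U$, $v\in V$). $M_V(\mathcal{B}(\mathcal{K}))$ is the algebra of square matrices indexed by $V$ with entries in the bounded operators $\mathcal{B}(\mathcal{K})$, acting on $\mathcal{K}^V$. For vertices $x,y$, $\delta_{xy}=I\in\mathcal{B}(\mathcal{K})$ if $x=y$ and $\delta_{xy}=0$ otherwise. *)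

theory Defs
  imports "HOL-Analysis.Analysis" "HOL-Algebra.Module"
begin

section \<open>Complex Hilbert spaces with explicit carriers\<close>

text \<open>
  Hilbert spaces are records rather than types, since the space \<open>K\<close> of the theorem is existentially
  quantified. The vector space structure is that of a module over the field of complex
  numbers; the fields \<^const>\<open>mult\<close> and \<^const>\<open>one\<close>, which such records inherit from rings,
  are not constrained by \<open>module\<close> and carry no meaning.
\<close>

definition complex_ring :: "complex ring" where
  "complex_ring = \<lparr>carrier = UNIV, mult = (*), one = 1, zero = 0, add = (+)\<rparr>"

lemma cring_complex_ring: "cring complex_ring"
proof (rule cringI)
  show "abelian_group complex_ring"
    by (rule abelian_groupI) (auto simp: complex_ring_def algebra_simps intro: exI[of _ "- x" for x])
  show "Group.comm_monoid complex_ring"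
    by (rule Group.comm_monoidI) (auto simp: complex_ring_def algebra_simps)
qed (auto simp: complex_ring_def algebra_simps)

record 'a cspace = "(complex, 'a) module" +
  cinner :: "'a \<Rightarrow> 'a \<Rightarrow> complex"

definition hnorm :: "'a cspace \<Rightarrow> 'a \<Rightarrow> real" where
  "hnorm H x = sqrt (Re (cinner H x x))"

text \<open>The locale \<^locale>\<open>Metric_space\<close> asks for symmetry and nonnegativity on the whole type,
  hence the value 0 outside the carrier.\<close>

definition hdist :: "'a cspace \<Rightarrow> 'a \<Rightarrow> 'a \<Rightarrow> real" where
  "hdist H x y = (if x \<in> carrier H \<and> y \<in> carrier H then hnorm H (x \<ominus>\<^bsub>H\<^esub> y) else 0)"

text \<open>The inner product is linear in its first argument.\<close>

locale complex_inner_space = Module.module complex_ring H for H :: "'a cspace" (structure) +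
  assumes cinner_add_left: "\<lbrakk>x \<in> carrier H; y \<in> carrier H; z \<in> carrier H\<rbrakk> \<Longrightarrow>
      cinner H (x \<oplus> y) z = cinner H x z + cinner H y z"
    and cinner_smult_left: "\<lbrakk>x \<in> carrier H; y \<in> carrier H\<rbrakk> \<Longrightarrow>
      cinner H (a \<odot> x) y = a * cinner H x y"
    and cinner_commute: "\<lbrakk>x \<in> carrier H; y \<in> carrier H\<rbrakk> \<Longrightarrow> cinner H x y = cnj (cinner H y x)"
    and cinner_pos: "\<lbrakk>x \<in> carrier H; x \<noteq> \<zero>\<rbrakk> \<Longrightarrow> Re (cinner H x x) > 0"

context complex_inner_space begin

lemma complex_ring_simps [simp]:
  "carrier complex_ring = UNIV" "add complex_ring = (+)" "mult complex_ring = (*)"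
  "\<one>\<^bsub>complex_ring\<^esub> = 1" "\<zero>\<^bsub>complex_ring\<^esub> = 0"
  by (auto simp: complex_ring_def)

lemma minus_eq_smult: assumes "x \<in> carrier H" shows "\<ominus> x = (-1) \<odot> x"
proof -
  have "(-1) \<odot> x \<oplus> x = ((-1) + 1) \<odot> x"
    using assms smult_l_distr[of "-1" 1 x] smult_one[of x] by simp
  also have "\<dots> = \<zero>" using smult_l_null[OF assms] by simp
  finally show ?thesis using assms smult_closed[of "-1" x] by (simp add: M.minus_equality)
qed

lemma cinner_add_right: "\<lbrakk>x \<in> carrier H; y \<in> carrier H; z \<in> carrier H\<rbrakk> \<Longrightarrow>
      cinner H z (x \<oplus> y) = cinner H z x + cinner H z y"
  by (metis cinner_commute cinner_add_left M.a_closed complex_cnj_add)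

lemma cinner_smult_right: "\<lbrakk>x \<in> carrier H; y \<in> carrier H\<rbrakk> \<Longrightarrow>
      cinner H x (a \<odot> y) = cnj a * cinner H x y"
  using cinner_commute[of x "a \<odot> y"] cinner_commute[of x y] cinner_smult_left[of y x a]
    smult_closed[of a y] by simp

lemma cinner_zero_left: "x \<in> carrier H \<Longrightarrow> cinner H \<zero> x = 0"
  using cinner_smult_left[of x x 0] smult_l_null[of x] by simp

lemma cinner_nonneg: "x \<in> carrier H \<Longrightarrow> Re (cinner H x x) \<ge> 0"
  using cinner_pos[of x] cinner_zero_left[of x] by (cases "x = \<zero>") auto

lemma cauchy_schwarz: assumes x: "x \<in> carrier H" and y: "y \<in> carrier H"
  shows "Re (cinner H x y) \<le> hnorm H x * hnorm H y"
proof -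
  have q: "0 \<le> s^2 * Re (cinner H x x) - 2 * s * t * Re (cinner H x y) + t^2 * Re (cinner H y y)" for s t :: real
  proof -
    have sx: "of_real s \<odot> x \<in> carrier H" and ty: "of_real (-t) \<odot> y \<in> carrier H"
      using x y smult_closed by auto
    have "cinner H y x = cnj (cinner H x y)" by (rule cinner_commute[OF y x])
    then show ?thesis
      using cinner_nonneg[OF M.a_closed[OF sx ty]] sx ty x y
      by (simp add: cinner_add_left cinner_add_right cinner_smult_left cinner_smult_right power2_eq_square algebra_simps)
  qed
  define a where "a = hnorm H x"
  define b where "b = hnorm H y"
  have ab: "a \<ge> 0" "b \<ge> 0" "Re (cinner H x x) = a^2" "Re (cinner H y y) = b^2"
    using cinner_nonneg x y by (auto simp: a_def b_def hnorm_def)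
  have *: "0 \<le> 2*a*b*(a*b - Re (cinner H x y))"
    using q[of b a] ab by (simp add: power2_eq_square algebra_simps)
  show ?thesis
  proof (cases "a = 0 \<or> b = 0")
    case True
    then have "x = \<zero> \<or> y = \<zero>" using cinner_pos x y ab by fastforce
    then have "cinner H x y = 0" using cinner_zero_left x y cinner_commute[of x y] by auto
    then show ?thesis using True by (auto simp: a_def b_def)
  next
    case False
    then have "0 < 2*a*b" using ab by simp
    with * have "0 \<le> a*b - Re (cinner H x y)" by (metis zero_le_mult_iff not_less)
    then show ?thesis by (simp add: a_def b_def)
  qed
qed

lemma hnorm_triangle: assumes x: "x \<in> carrier H" and y: "y \<in> carrier H"
  shows "hnorm H (x \<oplus> y) \<le> hnorm H x + hnorm H y"
proof -
  have "Re (cinner H (x \<oplus> y) (x \<oplus> y)) = (hnorm H x)^2 + 2 * Re (cinner H x y) + (hnorm H y)^2"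
    using x y cinner_nonneg cinner_commute[of y x] by (simp add: cinner_add_left cinner_add_right hnorm_def)
  also have "\<dots> \<le> (hnorm H x + hnorm H y)^2" using cauchy_schwarz[OF x y] by (simp add: power2_eq_square algebra_simps)
  finally show ?thesis using cinner_nonneg x y by (simp add: hnorm_def real_le_lsqrt)
qed

lemma Metric_space_hdist: "Metric_space (carrier H) (hdist H)"
proof
  fix x y show "0 \<le> hdist H x y"
    using cinner_nonneg by (auto simp: hdist_def hnorm_def)
  show "hdist H x y = hdist H y x"
  proof (cases "x \<in> carrier H \<and> y \<in> carrier H")
    case True
    then have "y \<ominus> x = (-1) \<odot> (x \<ominus> y)"
      by (metis M.minus_add M.minus_closed M.minus_eq M.minus_minus M.a_comm M.a_inv_closed minus_eq_smult)
    then show ?thesis using True by (auto simp: hdist_def hnorm_def cinner_smult_left cinner_smult_right)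
  qed (auto simp: hdist_def)
next
  fix x y assume xy: "x \<in> carrier H" "y \<in> carrier H"
  have "x \<ominus> y = \<zero> \<longleftrightarrow> x = y"
    using xy by (metis M.minus_eq M.r_neg M.minus_equality M.a_inv_closed M.minus_minus)
  then show "hdist H x y = 0 \<longleftrightarrow> x = y"
    using xy cinner_pos[of "x \<ominus> y"] cinner_zero_left[of \<zero>]
    by (auto simp: hdist_def hnorm_def)
next
  fix x y z assume "x \<in> carrier H" "y \<in> carrier H" "z \<in> carrier H"
  then show "hdist H x z \<le> hdist H x y + hdist H y z"
    using hnorm_triangle[of "x \<ominus> y" "y \<ominus> z"]
    by (simp add: hdist_def M.minus_eq M.a_assoc M.r_neg1)
qed
end

locale complex_hilbert_space = complex_inner_space +
  assumes complete: "Metric_space.mcomplete (carrier H) (hdist H)"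

definition power_space :: "'v set \<Rightarrow> 'a cspace \<Rightarrow> ('v \<Rightarrow> 'a) cspace" where
  "power_space V K = \<lparr>carrier = V \<rightarrow>\<^sub>E carrier K, mult = undefined, one = undefined,
     zero = (\<lambda>v\<in>V. \<zero>\<^bsub>K\<^esub>), add = (\<lambda>f g. \<lambda>v\<in>V. f v \<oplus>\<^bsub>K\<^esub> g v),
     smult = (\<lambda>a f. \<lambda>v\<in>V. a \<odot>\<^bsub>K\<^esub> f v),
     cinner = (\<lambda>f g. \<Sum>v\<in>V. cinner K (f v) (g v))\<rparr>"


section \<open>Bounded operators\<close>

text \<open>Operators are extensional functions on the carrier, so that equality of operators is
  equality of functions.\<close>

definition linear_maps :: "'a cspace \<Rightarrow> 'b cspace \<Rightarrow> ('a \<Rightarrow> 'b) set" where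
  "linear_maps H K = {T \<in> carrier H \<rightarrow>\<^sub>E carrier K.
     (\<forall>x\<in>carrier H. \<forall>y\<in>carrier H. T (x \<oplus>\<^bsub>H\<^esub> y) = T x \<oplus>\<^bsub>K\<^esub> T y) \<and>
     (\<forall>a. \<forall>x\<in>carrier H. T (a \<odot>\<^bsub>H\<^esub> x) = a \<odot>\<^bsub>K\<^esub> T x)}"

definition bounded_operators :: "'a cspace \<Rightarrow> ('a \<Rightarrow> 'a) ring" where
  "bounded_operators H =
    \<lparr>carrier = {T \<in> linear_maps H H. \<exists>B. \<forall>x\<in>carrier H. hnorm H (T x) \<le> B * hnorm H x},
     mult = compose (carrier H), one = (\<lambda>x\<in>carrier H. x), zero = (\<lambda>x\<in>carrier H. \<zero>\<^bsub>H\<^esub>),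
     add = (\<lambda>S T. \<lambda>x\<in>carrier H. S x \<oplus>\<^bsub>H\<^esub> T x)\<rparr>"

definition adjoint :: "'a cspace \<Rightarrow> ('a \<Rightarrow> 'a) \<Rightarrow> ('a \<Rightarrow> 'a)" where
  "adjoint H T = (THE S. S \<in> carrier (bounded_operators H) \<and>
     (\<forall>x\<in>carrier H. \<forall>y\<in>carrier H. cinner H (T x) y = cinner H x (S y)))"

definition projection :: "'a cspace \<Rightarrow> ('a \<Rightarrow> 'a) \<Rightarrow> bool" where
  "projection H P \<longleftrightarrow> P \<in> carrier (bounded_operators H) \<and>
     P \<otimes>\<^bsub>bounded_operators H\<^esub> P = P \<and> adjoint H P = P"

definition unitary :: "'a cspace \<Rightarrow> 'b cspace \<Rightarrow> ('a \<Rightarrow> 'b) \<Rightarrow> bool" where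
  "unitary H K W \<longleftrightarrow> W \<in> linear_maps H K \<and> bij_betw W (carrier H) (carrier K) \<and>
     (\<forall>x\<in>carrier H. \<forall>y\<in>carrier H. cinner K (W x) (W y) = cinner H x y)"

definition orth_complement :: "'a cspace \<Rightarrow> 'a set \<Rightarrow> 'a set" where
  "orth_complement H L = {y \<in> carrier H. \<forall>x\<in>L. cinner H x y = 0}"

definition dense_range :: "'a cspace \<Rightarrow> ('a \<Rightarrow> 'a) \<Rightarrow> bool" where
  "dense_range H T \<longleftrightarrow>
     Metric_space.mtopology (carrier H) (hdist H) closure_of (T ` carrier H) = carrier H"

definition kronecker :: "'a cspace \<Rightarrow> 'v \<Rightarrow> 'v \<Rightarrow> ('a \<Rightarrow> 'a)" where
  "kronecker K x y = (if x = y then \<one>\<^bsub>bounded_operators K\<^esub> else \<zero>\<^bsub>bounded_operators K\<^esub>)"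

text \<open>The operator on \<open>K\<^sup>V\<close> given by a \<open>V \<times> V\<close> matrix of operators on \<open>K\<close>.\<close>

definition matrix_operator ::
    "'v set \<Rightarrow> 'a cspace \<Rightarrow> ('v \<Rightarrow> 'v \<Rightarrow> 'a \<Rightarrow> 'a) \<Rightarrow> ('v \<Rightarrow> 'a) \<Rightarrow> ('v \<Rightarrow> 'a)" where
  "matrix_operator V K A =
     (\<lambda>\<xi>\<in>carrier (power_space V K). \<lambda>v\<^sub>1\<in>V. \<Oplus>\<^bsub>K\<^esub>v\<^sub>2\<in>V. A v\<^sub>1 v\<^sub>2 (\<xi> v\<^sub>2))"


section \<open>Bipartite graphs and projection families\<close>

locale bipartite_graph =
  fixes U V :: "'v set" and E :: "'v set set"
  assumes finite_U: "finite U" and finite_V: "finite V"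
    and disjoint: "U \<inter> V = {}"
    and edges: "E \<subseteq> {{u, v} | u v. u \<in> U \<and> v \<in> V}"

locale connected_bipartite_graph = bipartite_graph +
  assumes connected: "\<lbrakk>x \<in> U \<union> V; y \<in> U \<union> V\<rbrakk> \<Longrightarrow> (x, y) \<in> {(a, b). {a, b} \<in> E}\<^sup>*"

definition projection_family ::
    "'v set \<Rightarrow> 'v set \<Rightarrow> 'v set set \<Rightarrow> 'a cspace \<Rightarrow> ('v \<Rightarrow> 'a \<Rightarrow> 'a) \<Rightarrow> bool" where
  "projection_family U V E H P \<longleftrightarrow>
     (\<forall>x\<in>U \<union> V. projection H (P x)) \<and>
     (\<Oplus>\<^bsub>bounded_operators H\<^esub>u\<in>U. P u) = \<one>\<^bsub>bounded_operators H\<^esub> \<and>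
     (\<Oplus>\<^bsub>bounded_operators H\<^esub>v\<in>V. P v) = \<one>\<^bsub>bounded_operators H\<^esub> \<and>
     (\<forall>u\<in>U. \<forall>v\<in>V. {u, v} \<notin> E \<longrightarrow>
        P u \<otimes>\<^bsub>bounded_operators H\<^esub> P v = \<zero>\<^bsub>bounded_operators H\<^esub>)"

definition generic_position ::
    "'v set \<Rightarrow> 'v set \<Rightarrow> 'v set set \<Rightarrow> 'a cspace \<Rightarrow> ('v \<Rightarrow> 'a \<Rightarrow> 'a) \<Rightarrow> bool" where
  "generic_position U V E H P \<longleftrightarrow>
     (\<forall>u\<in>U. \<forall>v\<in>V. {u, v} \<in> E \<longrightarrow>
        P u ` carrier H \<inter> orth_complement H (P v ` carrier H) = {\<zero>\<^bsub>H\<^esub>} \<and>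
        orth_complement H (P u ` carrier H) \<inter> P v ` carrier H = {\<zero>\<^bsub>H\<^esub>})"

definition operator_family ::
    "'v set \<Rightarrow> 'v set \<Rightarrow> 'v set set \<Rightarrow> 'a cspace \<Rightarrow> ('v \<Rightarrow> 'v \<Rightarrow> 'a \<Rightarrow> 'a) \<Rightarrow> bool" where
  "operator_family U V E K C \<longleftrightarrow>
     (\<forall>u\<in>U. \<forall>v\<in>V. C u v \<in> carrier (bounded_operators K)) \<and>
     (\<forall>u\<in>U. \<forall>v\<in>V. {u, v} \<notin> E \<longrightarrow> C u v = \<zero>\<^bsub>bounded_operators K\<^esub>) \<and>
     (\<forall>u\<in>U. \<forall>v\<in>V. {u, v} \<in> E \<longrightarrow> inj_on (C u v) (carrier K) \<and> dense_range K (C u v)) \<and>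
     (\<forall>v\<^sub>1\<in>V. \<forall>v\<^sub>2\<in>V.
        (\<Oplus>\<^bsub>bounded_operators K\<^esub>u\<in>U. adjoint K (C u v\<^sub>1) \<otimes>\<^bsub>bounded_operators K\<^esub> C u v\<^sub>2)
          = kronecker K v\<^sub>1 v\<^sub>2) \<and>
     (\<forall>u\<^sub>1\<in>U. \<forall>u\<^sub>2\<in>U.
        (\<Oplus>\<^bsub>bounded_operators K\<^esub>v\<in>V. C u\<^sub>1 v \<otimes>\<^bsub>bounded_operators K\<^esub> adjoint K (C u\<^sub>2 v))
          = kronecker K u\<^sub>1 u\<^sub>2)"

definition matrix_family ::
    "'v set \<Rightarrow> 'v set \<Rightarrow> 'a cspace \<Rightarrow> ('v \<Rightarrow> 'v \<Rightarrow> 'a \<Rightarrow> 'a) \<Rightarrow> 'v \<Rightarrow> ('v \<Rightarrow> 'a) \<Rightarrow> ('v \<Rightarrow> 'a)" where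
  "matrix_family U V K C x = matrix_operator V K
     (\<lambda>v\<^sub>1 v\<^sub>2.
     if x \<in> U then adjoint K (C x v\<^sub>1) \<otimes>\<^bsub>bounded_operators K\<^esub> C x v\<^sub>2
     else kronecker K v\<^sub>1 x \<otimes>\<^bsub>bounded_operators K\<^esub> kronecker K v\<^sub>2 x)"

end

theory Submission
  imports Defs
begin

text \<open>
  For an edge \<open>{u, v}\<close>, genericity makes \<open>A = P\<^sub>u + P\<^sub>v - 1\<close> injective; its sign is a
  unitary which intertwines \<open>P\<^sub>u\<close> and \<open>P\<^sub>v\<close>. Composing along paths of the connected graph gives
  unitaries \<open>J\<^sub>x\<close> with \<open>J\<^sub>x P\<^sub>x = R J\<^sub>x\<close> for one projection \<open>R\<close>, and then \<open>K = im R\<close>,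
  \<open>C\<^sub>u\<^sub>v = J\<^sub>u P\<^sub>u J\<^sub>v\<^sup>*\<close> and \<open>W x = (J\<^sub>v P\<^sub>v x)\<^sub>v\<close> do the job. Conversely, the row
  \<open>\<Gamma>\<^sub>u = (C\<^sub>u\<^sub>v)\<^sub>v\<close> satisfies \<open>\<Gamma>\<^sub>u \<Gamma>\<^sub>u\<^sup>* = 1\<close>, so that \<open>P\<^sub>u = \<Gamma>\<^sub>u\<^sup>* \<Gamma>\<^sub>u\<close> is a projection.
\<close>

section \<open>Inner products and bounded operators\<close>

text \<open>Genericity makes \<open>A\<close> injective but not invertible: \<open>0\<close> may lie
  in its spectrum, so polynomials in \<open>A\<close> need not approach the sign in norm. The sign
  is therefore a strong limit, obtained from a polynomial iteration whose squares increase and stay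
  below 1; positivity of polynomials with nonnegative coefficients takes the place of spectral
  calculus, and injectivity returns at the end to show that the limit squares to 1. The sign
  intertwines because \<open>A P = Q A\<close> and \<open>A Q = P A\<close>: even powers of
  \<open>A\<close> commute with \<open>P\<close> and \<open>Q\<close>, and the sign is odd in
  \<open>A\<close>. On \<open>im R\<close> the map \<open>J\<^sub>v\<^sup>*\<close> takes values in
  \<open>im P\<^sub>v\<close>, so that the operator at \<open>u\<close>, \<open>v\<close> is also
  \<open>J\<^sub>u P\<^sub>u P\<^sub>v J\<^sub>v\<^sup>*\<close>. In this form taking adjoints just
  exchanges the indices, and both sum relations become one statement about a partition of unity. The
  kernel of this operator corresponds to the part of \<open>im P\<^sub>v\<close> orthogonal to
  \<open>im P\<^sub>u\<close>, and the complement of its range to the part of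
  \<open>im P\<^sub>u\<close> orthogonal to \<open>im P\<^sub>v\<close>; the two halves of
  genericity thus give injectivity and dense range.\<close>

context complex_inner_space begin

lemma cinner_zero_right: "x \<in> carrier H \<Longrightarrow> cinner H x \<zero> = 0"
  using cinner_commute[of x \<zero>] cinner_zero_left[of x] by simp

lemma cinner_uminus_left: "\<lbrakk>x \<in> carrier H; y \<in> carrier H\<rbrakk> \<Longrightarrow> cinner H (\<ominus> x) y = - cinner H x y"
  by (simp add: minus_eq_smult cinner_smult_left)

lemma cinner_uminus_right: "\<lbrakk>x \<in> carrier H; y \<in> carrier H\<rbrakk> \<Longrightarrow> cinner H y (\<ominus> x) = - cinner H y x"
  by (simp add: minus_eq_smult cinner_smult_right)

lemma cinner_minus_left: "\<lbrakk>x \<in> carrier H; y \<in> carrier H; z \<in> carrier H\<rbrakk> \<Longrightarrow>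
    cinner H (x \<ominus> y) z = cinner H x z - cinner H y z"
  by (simp add: M.minus_eq cinner_add_left cinner_uminus_left)

lemma cinner_minus_right: "\<lbrakk>x \<in> carrier H; y \<in> carrier H; z \<in> carrier H\<rbrakk> \<Longrightarrow>
    cinner H z (x \<ominus> y) = cinner H z x - cinner H z y"
  by (simp add: M.minus_eq cinner_add_right cinner_uminus_right)

lemma smult_zero_left [simp]: "x \<in> carrier H \<Longrightarrow> 0 \<odot> x = \<zero>"
  using smult_l_null[of x] by simp

lemma smult_one_left [simp]: "x \<in> carrier H \<Longrightarrow> 1 \<odot> x = x"
  using smult_one[of x] by simp

lemma smult_in: "x \<in> carrier H \<Longrightarrow> a \<odot> x \<in> carrier H"
  by simp

lemmas cinner_simps = cinner_add_left cinner_add_right cinner_smult_left cinner_smult_right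
  cinner_zero_left cinner_zero_right cinner_minus_left cinner_minus_right
  cinner_uminus_left cinner_uminus_right

lemma cinner_finsum_left:
  assumes "\<And>i. i \<in> I \<Longrightarrow> f i \<in> carrier H" and "z \<in> carrier H"
  shows "cinner H (\<Oplus>i\<in>I. f i) z = (\<Sum>i\<in>I. cinner H (f i) z)"
  using assms
proof (induction I rule: infinite_finite_induct)
  case (insert i I)
  then have "f \<in> I \<rightarrow> carrier H" "f i \<in> carrier H" by auto
  then show ?case using insert by (simp add: M.finsum_insert M.finsum_closed cinner_add_left)
qed (auto simp: M.finsum_infinite M.finsum_empty cinner_zero_left)

lemma cinner_finsum_right:
  assumes "\<And>i. i \<in> I \<Longrightarrow> f i \<in> carrier H" and "z \<in> carrier H"
  shows "cinner H z (\<Oplus>i\<in>I. f i) = (\<Sum>i\<in>I. cinner H z (f i))"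
proof -
  have "f \<in> I \<rightarrow> carrier H" using assms by auto
  then have "cinner H z (\<Oplus>i\<in>I. f i) = cnj (cinner H (\<Oplus>i\<in>I. f i) z)"
    using assms by (intro cinner_commute) (auto intro: M.finsum_closed)
  also have "\<dots> = (\<Sum>i\<in>I. cinner H z (f i))"
    using assms by (auto simp: cinner_finsum_left cnj_sum intro!: sum.cong cinner_commute[symmetric])
  finally show ?thesis .
qed

lemma cinner_self_eq_0: "x \<in> carrier H \<Longrightarrow> Re (cinner H x x) = 0 \<longleftrightarrow> x = \<zero>"
  using cinner_pos[of x] cinner_zero_left[of \<zero>] by fastforce

lemma minus_eq_zero: "\<lbrakk>x \<in> carrier H; y \<in> carrier H\<rbrakk> \<Longrightarrow> x \<ominus> y = \<zero> \<longleftrightarrow> x = y"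
  by (metis M.minus_eq M.r_neg M.minus_equality M.a_inv_closed M.minus_minus)

text \<open>Nondegeneracy, applied to \<open>x \<ominus> y\<close>. Vector identities are proved
  below by testing against all \<open>z\<close>, since \<open>cinner_simps\<close> then turns them
  into complex arithmetic.\<close>

lemma cinner_ext:
  assumes "x \<in> carrier H" "y \<in> carrier H" and "\<And>z. z \<in> carrier H \<Longrightarrow> cinner H x z = cinner H y z"
  shows "x = y"
proof -
  have "cinner H (x \<ominus> y) (x \<ominus> y) = 0"
    using assms by (simp add: cinner_minus_left)
  then show ?thesis
    using assms cinner_self_eq_0[of "x \<ominus> y"] minus_eq_zero by simp
qed

lemma Im_cinner_self: "x \<in> carrier H \<Longrightarrow> Im (cinner H x x) = 0"
  using cinner_commute[of x x] by (metis complex_cnj_cancel_iff cnj.simps(2) equation_minus_iff equal_neg_zero)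

lemma Re_cinner_self: "x \<in> carrier H \<Longrightarrow> Re (cinner H x x) = (hnorm H x)\<^sup>2"
  by (simp add: hnorm_def cinner_nonneg)

lemma cinner_self: "x \<in> carrier H \<Longrightarrow> cinner H x x = of_real ((hnorm H x)\<^sup>2)"
  by (simp add: complex_eq_iff Re_cinner_self Im_cinner_self)

lemma hnorm_nonneg: "x \<in> carrier H \<Longrightarrow> hnorm H x \<ge> 0"
  by (simp add: hnorm_def cinner_nonneg)

lemma hnorm_eq_0: "x \<in> carrier H \<Longrightarrow> hnorm H x = 0 \<longleftrightarrow> x = \<zero>"
  using cinner_self_eq_0[of x] Re_cinner_self[of x] by simp

lemma hnorm_zero [simp]: "hnorm H \<zero> = 0"
  by (simp add: hnorm_eq_0)

lemma hnorm_smult: "x \<in> carrier H \<Longrightarrow> hnorm H (a \<odot> x) = cmod a * hnorm H x"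
proof -
  assume x: "x \<in> carrier H"
  have "cinner H (a \<odot> x) (a \<odot> x) = (a * cnj a) * cinner H x x"
    using x by (simp add: cinner_smult_left cinner_smult_right)
  also have "\<dots> = of_real ((cmod a * hnorm H x)\<^sup>2)"
    by (simp add: cinner_self[OF x] power_mult_distrib flip: complex_norm_square)
  finally have "hnorm H (a \<odot> x) = sqrt ((cmod a * hnorm H x)\<^sup>2)"
    by (simp add: hnorm_def[of H "a \<odot> x"])
  then show ?thesis using hnorm_nonneg[OF x] by simp
qed

lemma hnorm_uminus: "x \<in> carrier H \<Longrightarrow> hnorm H (\<ominus> x) = hnorm H x"
  by (simp add: minus_eq_smult hnorm_smult)

lemma hnorm_minus_commute: "\<lbrakk>x \<in> carrier H; y \<in> carrier H\<rbrakk> \<Longrightarrow> hnorm H (x \<ominus> y) = hnorm H (y \<ominus> x)"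
  by (simp add: hnorm_def cinner_simps algebra_simps)

lemma cmod_cinner_le:
  assumes "x \<in> carrier H" "y \<in> carrier H"
  shows "cmod (cinner H x y) \<le> hnorm H x * hnorm H y"
proof (cases "cinner H x y = 0")
  case False
  \<comment> \<open>The phase \<open>c\<close> rotates the inner product onto the nonnegative real
    axis, where the bound on the real part applies.\<close>
  define c where "c = cnj (sgn (cinner H x y))"
  have c: "cmod c = 1" using False by (simp add: c_def norm_sgn)
  have "c * cinner H x y = of_real ((cmod (cinner H x y))\<^sup>2) / of_real (cmod (cinner H x y))"
    unfolding c_def sgn_eq complex_norm_square by simp
  also have "\<dots> = of_real (cmod (cinner H x y))"
    by (simp add: power2_eq_square)
  finally have "c * cinner H x y = of_real (cmod (cinner H x y))" .
  then have "cmod (cinner H x y) = Re (cinner H (c \<odot> x) y)"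
    using assms by (simp add: cinner_smult_left)
  also have "\<dots> \<le> hnorm H (c \<odot> x) * hnorm H y" using assms by (intro cauchy_schwarz) auto
  finally show ?thesis using assms c by (simp add: hnorm_smult)
qed (use assms hnorm_nonneg in auto)

lemma hnorm_diff_le:
  assumes "x \<in> carrier H" "y \<in> carrier H" "z \<in> carrier H"
  shows "hnorm H (x \<ominus> z) \<le> hnorm H (x \<ominus> y) + hnorm H (y \<ominus> z)"
proof -
  have "x \<ominus> z = (x \<ominus> y) \<oplus> (y \<ominus> z)"
    by (rule cinner_ext) (use assms in \<open>auto simp: cinner_simps\<close>)
  then show ?thesis using hnorm_triangle[of "x \<ominus> y" "y \<ominus> z"] assms by simp
qed

end

section \<open>Linear maps between spaces with carriers\<close>

lemma linear_maps_closed: "\<lbrakk>T \<in> linear_maps H K; x \<in> carrier H\<rbrakk> \<Longrightarrow> T x \<in> carrier K"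
  by (auto simp: linear_maps_def)

lemma linear_maps_add: "\<lbrakk>T \<in> linear_maps H K; x \<in> carrier H; y \<in> carrier H\<rbrakk> \<Longrightarrow>
    T (x \<oplus>\<^bsub>H\<^esub> y) = T x \<oplus>\<^bsub>K\<^esub> T y"
  by (auto simp: linear_maps_def)

lemma linear_maps_smult: "\<lbrakk>T \<in> linear_maps H K; x \<in> carrier H\<rbrakk> \<Longrightarrow>
    T (a \<odot>\<^bsub>H\<^esub> x) = a \<odot>\<^bsub>K\<^esub> T x"
  by (auto simp: linear_maps_def)

lemma linear_mapsI:
  assumes "T \<in> extensional (carrier H)" "\<And>x. x \<in> carrier H \<Longrightarrow> T x \<in> carrier K"
    "\<And>x y. x \<in> carrier H \<Longrightarrow> y \<in> carrier H \<Longrightarrow> T (x \<oplus>\<^bsub>H\<^esub> y) = T x \<oplus>\<^bsub>K\<^esub> T y"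
    "\<And>a x. x \<in> carrier H \<Longrightarrow> T (a \<odot>\<^bsub>H\<^esub> x) = a \<odot>\<^bsub>K\<^esub> T x"
  shows "T \<in> linear_maps H K"
  using assms by (auto simp: linear_maps_def PiE_def)

lemma linear_maps_ext:
  assumes "S \<in> linear_maps H K" "T \<in> linear_maps H K" "\<And>x. x \<in> carrier H \<Longrightarrow> S x = T x"
  shows "S = T"
  proof (rule extensionalityI[where A = "carrier H"])
  show "S \<in> extensional (carrier H)" "T \<in> extensional (carrier H)"
    using assms(1,2) by (auto simp: linear_maps_def PiE_def)
qed (rule assms(3))

lemma linear_maps_zero:
  assumes "complex_inner_space H" "complex_inner_space K" "T \<in> linear_maps H K"
  shows "T \<zero>\<^bsub>H\<^esub> = \<zero>\<^bsub>K\<^esub>"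
proof -
  interpret H: complex_inner_space H by fact
  interpret K: complex_inner_space K by fact
  have "T (0 \<odot>\<^bsub>H\<^esub> \<zero>\<^bsub>H\<^esub>) = 0 \<odot>\<^bsub>K\<^esub> T \<zero>\<^bsub>H\<^esub>"
    by (rule linear_maps_smult[OF assms(3) H.M.zero_closed])
  then show ?thesis using linear_maps_closed[OF assms(3) H.M.zero_closed]
      H.smult_l_null[OF H.M.zero_closed] K.smult_l_null[of "T \<zero>\<^bsub>H\<^esub>"] by simp
qed

lemma linear_maps_minus:
  assumes "complex_inner_space H" "complex_inner_space K" "T \<in> linear_maps H K"
    "x \<in> carrier H" "y \<in> carrier H"
  shows "T (x \<ominus>\<^bsub>H\<^esub> y) = T x \<ominus>\<^bsub>K\<^esub> T y"
proof -
  interpret H: complex_inner_space H by fact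
  interpret K: complex_inner_space K by fact
  show ?thesis
    using assms(3-5) linear_maps_closed[OF assms(3)]
    by (simp add: H.M.minus_eq K.M.minus_eq H.minus_eq_smult K.minus_eq_smult linear_maps_add linear_maps_smult)
qed

lemma linear_maps_finsum:
  assumes "complex_inner_space H" "complex_inner_space K" "T \<in> linear_maps H K"
    "\<And>i. i \<in> I \<Longrightarrow> f i \<in> carrier H"
  shows "T (\<Oplus>\<^bsub>H\<^esub>i\<in>I. f i) = (\<Oplus>\<^bsub>K\<^esub>i\<in>I. T (f i))"
proof -
  interpret H: complex_inner_space H by fact
  interpret K: complex_inner_space K by fact
  show ?thesis using assms(4)
  proof (induction I rule: infinite_finite_induct)
    case (insert i I)
    then have "f \<in> I \<rightarrow> carrier H" "f i \<in> carrier H" "(\<lambda>i. T (f i)) \<in> I \<rightarrow> carrier K" "T (f i) \<in> carrier K"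
      using linear_maps_closed[OF assms(3)] by auto
    then show ?case using insert assms(3)
      by (simp add: H.M.finsum_insert K.M.finsum_insert H.M.finsum_closed linear_maps_add)
  qed (use linear_maps_zero[OF assms(1-3)] in \<open>auto simp: H.M.finsum_infinite K.M.finsum_infinite H.M.finsum_empty K.M.finsum_empty\<close>)
qed

context complex_inner_space begin

lemma bounded_operators_linear: "T \<in> carrier (bounded_operators H) \<Longrightarrow> T \<in> linear_maps H H"
  by (auto simp: bounded_operators_def)

lemma bounded_operators_bound:
  assumes "T \<in> carrier (bounded_operators H)"
  obtains B where "B > 0" "\<And>x. x \<in> carrier H \<Longrightarrow> hnorm H (T x) \<le> B * hnorm H x"
proof -
  obtain B where B: "\<forall>x\<in>carrier H. hnorm H (T x) \<le> B * hnorm H x"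
    using assms by (auto simp: bounded_operators_def)
  have "hnorm H (T x) \<le> (\<bar>B\<bar> + 1) * hnorm H x" if "x \<in> carrier H" for x
    using B that hnorm_nonneg[OF that] mult_right_mono[of B "\<bar>B\<bar> + 1" "hnorm H x"] by fastforce
  then show ?thesis using that[of "\<bar>B\<bar> + 1"] by auto
qed

lemma bounded_operatorsI:
  assumes "T \<in> linear_maps H H" "\<And>x. x \<in> carrier H \<Longrightarrow> hnorm H (T x) \<le> B * hnorm H x"
  shows "T \<in> carrier (bounded_operators H)"
  using assms by (auto simp: bounded_operators_def)

lemma bounded_operators_mult [simp]: "S \<otimes>\<^bsub>bounded_operators H\<^esub> T = compose (carrier H) S T"
  by (simp add: bounded_operators_def)

lemma bounded_operators_one [simp]: "\<one>\<^bsub>bounded_operators H\<^esub> = (\<lambda>x\<in>carrier H. x)"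
  by (simp add: bounded_operators_def)

lemma bounded_operators_zero [simp]: "\<zero>\<^bsub>bounded_operators H\<^esub> = (\<lambda>x\<in>carrier H. \<zero>)"
  by (simp add: bounded_operators_def)

lemma bounded_operators_add [simp]:
  "S \<oplus>\<^bsub>bounded_operators H\<^esub> T = (\<lambda>x\<in>carrier H. S x \<oplus> T x)"
  by (simp add: bounded_operators_def)

lemma linear_maps_compose:
  assumes "S \<in> linear_maps H H" "T \<in> linear_maps H H"
  shows "compose (carrier H) S T \<in> linear_maps H H"
  by (rule linear_mapsI)
    (auto simp: compose_def linear_maps_closed[OF assms(1)] linear_maps_closed[OF assms(2)]
      linear_maps_add[OF assms(1)] linear_maps_add[OF assms(2)]
      linear_maps_smult[OF assms(1)] linear_maps_smult[OF assms(2)])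

lemma compose_bounded_operators:
  assumes "S \<in> carrier (bounded_operators H)" "T \<in> carrier (bounded_operators H)"
  shows "compose (carrier H) S T \<in> carrier (bounded_operators H)"
proof -
  obtain B C where B: "B > 0" "\<And>x. x \<in> carrier H \<Longrightarrow> hnorm H (S x) \<le> B * hnorm H x"
    and C: "C > 0" "\<And>x. x \<in> carrier H \<Longrightarrow> hnorm H (T x) \<le> C * hnorm H x"
    using bounded_operators_bound assms by metis
  note lin = assms[THEN bounded_operators_linear]
  show ?thesis
  proof (rule bounded_operatorsI)
    show "compose (carrier H) S T \<in> linear_maps H H"
      using lin by (rule linear_maps_compose)
    show "hnorm H (compose (carrier H) S T x) \<le> (B * C) * hnorm H x" if "x \<in> carrier H" for x
      using B(2)[of "T x"] C(2)[OF that] linear_maps_closed[OF lin(2) that] that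
        mult_left_mono[OF C(2)[OF that] less_imp_le[OF B(1)]]
      by (simp add: compose_def mult.assoc)
  qed
qed

lemma add_bounded_operators:
  assumes "S \<in> carrier (bounded_operators H)" "T \<in> carrier (bounded_operators H)"
  shows "(\<lambda>x\<in>carrier H. S x \<oplus> T x) \<in> carrier (bounded_operators H)"
proof -
  obtain B C where B: "\<And>x. x \<in> carrier H \<Longrightarrow> hnorm H (S x) \<le> B * hnorm H x"
    and C: "\<And>x. x \<in> carrier H \<Longrightarrow> hnorm H (T x) \<le> C * hnorm H x"
    using bounded_operators_bound assms by metis
  note lin = assms[THEN bounded_operators_linear]
  note cl = linear_maps_closed[OF lin(1)] linear_maps_closed[OF lin(2)]
  show ?thesis
  proof (rule bounded_operatorsI)
    show "(\<lambda>x\<in>carrier H. S x \<oplus> T x) \<in> linear_maps H H"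
      by (rule linear_mapsI) (auto simp: cl linear_maps_add[OF lin(1)] linear_maps_add[OF lin(2)]
        linear_maps_smult[OF lin(1)] linear_maps_smult[OF lin(2)] M.a_ac smult_r_distr)
    show "hnorm H ((\<lambda>x\<in>carrier H. S x \<oplus> T x) x) \<le> (B + C) * hnorm H x" if "x \<in> carrier H" for x
      using B[OF that] C[OF that] hnorm_triangle[of "S x" "T x"] cl that
      by (simp add: distrib_right)
  qed
qed

lemma zero_bounded_operators: "(\<lambda>x\<in>carrier H. \<zero>) \<in> carrier (bounded_operators H)"
  by (rule bounded_operatorsI[where B = 0], rule linear_mapsI) (auto simp: hnorm_zero)

lemma one_bounded_operators: "(\<lambda>x\<in>carrier H. x) \<in> carrier (bounded_operators H)"
  by (rule bounded_operatorsI[where B = 1], rule linear_mapsI) auto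

text \<open>Gives meaning to the finite sums of operators in \<open>projection_family\<close> and
  \<open>operator_family\<close>.\<close>

lemma abelian_monoid_bounded_operators: "abelian_monoid (bounded_operators H)"
proof (rule abelian_monoidI)
  fix S T R assume STR: "S \<in> carrier (bounded_operators H)" "T \<in> carrier (bounded_operators H)"
    "R \<in> carrier (bounded_operators H)"
  note cl = linear_maps_closed[OF bounded_operators_linear[OF STR(1)]]
     linear_maps_closed[OF bounded_operators_linear[OF STR(2)]]
     linear_maps_closed[OF bounded_operators_linear[OF STR(3)]]
  show "S \<oplus>\<^bsub>bounded_operators H\<^esub> T \<oplus>\<^bsub>bounded_operators H\<^esub> R
      = S \<oplus>\<^bsub>bounded_operators H\<^esub> (T \<oplus>\<^bsub>bounded_operators H\<^esub> R)"
    unfolding bounded_operators_add by (rule restrict_ext) (simp add: cl M.a_assoc)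
next
  fix S T assume STR: "S \<in> carrier (bounded_operators H)" "T \<in> carrier (bounded_operators H)"
  note cl = linear_maps_closed[OF bounded_operators_linear[OF STR(1)]]
     linear_maps_closed[OF bounded_operators_linear[OF STR(2)]]
  show "S \<oplus>\<^bsub>bounded_operators H\<^esub> T = T \<oplus>\<^bsub>bounded_operators H\<^esub> S"
    unfolding bounded_operators_add by (rule restrict_ext) (simp add: cl M.a_comm)
next
  fix S assume S: "S \<in> carrier (bounded_operators H)"
  show "\<zero>\<^bsub>bounded_operators H\<^esub> \<oplus>\<^bsub>bounded_operators H\<^esub> S = S"
  proof (rule linear_maps_ext[OF bounded_operators_linear bounded_operators_linear[OF S]])
    show "\<zero>\<^bsub>bounded_operators H\<^esub> \<oplus>\<^bsub>bounded_operators H\<^esub> S \<in> carrier (bounded_operators H)"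
      using add_bounded_operators[OF zero_bounded_operators S] by simp
  qed (use linear_maps_closed[OF bounded_operators_linear[OF S]] in auto)
qed (use zero_bounded_operators add_bounded_operators in auto)

lemma finsum_bounded_operators:
  assumes "finite I" "\<And>i. i \<in> I \<Longrightarrow> T i \<in> carrier (bounded_operators H)"
  shows "(\<Oplus>\<^bsub>bounded_operators H\<^esub>i\<in>I. T i) = (\<lambda>x\<in>carrier H. \<Oplus>i\<in>I. T i x)"
  using assms
proof (induction I)
  case empty
  interpret B: abelian_monoid "bounded_operators H" by (rule abelian_monoid_bounded_operators)
  show ?case by (simp add: B.finsum_empty M.finsum_empty)
next
  case (insert i I)
  interpret B: abelian_monoid "bounded_operators H" by (rule abelian_monoid_bounded_operators)
  have "T \<in> I \<rightarrow> carrier (bounded_operators H)" "T i \<in> carrier (bounded_operators H)"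
    using insert by auto
  moreover have "(\<lambda>i. T i x) \<in> I \<rightarrow> carrier H" "T i x \<in> carrier H" if "x \<in> carrier H" for x
    using that linear_maps_closed[OF bounded_operators_linear] insert by fastforce+
  ultimately show ?case
    using insert by (auto simp: B.finsum_insert M.finsum_insert intro!: restrict_ext)
qed

text \<open>Pythagoras: \<open>x \<ominus> T x\<close> is orthogonal to \<open>T x\<close>, so its
  squared norm is the difference of those of \<open>x\<close> and \<open>T x\<close>.\<close>

lemma symmetric_idempotent_contraction:
  assumes "T \<in> carrier H \<rightarrow> carrier H" "\<And>x. x \<in> carrier H \<Longrightarrow> T (T x) = T x"
    "\<And>x y. \<lbrakk>x \<in> carrier H; y \<in> carrier H\<rbrakk> \<Longrightarrow> cinner H (T x) y = cinner H x (T y)"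
    "x \<in> carrier H"
  shows "hnorm H (T x) \<le> hnorm H x"
proof -
  have c: "T x \<in> carrier H" using assms by auto
  have "Re (cinner H (x \<ominus> T x) (x \<ominus> T x)) = Re (cinner H x x) - Re (cinner H (T x) (T x))"
    using assms(2-4) c assms(3)[of x "T x"] assms(3)[of x x] by (simp add: cinner_simps)
  then have "(hnorm H (T x))\<^sup>2 \<le> (hnorm H x)\<^sup>2"
    using cinner_nonneg[of "x \<ominus> T x"] c assms(4) by (simp add: Re_cinner_self)
  then show ?thesis using hnorm_nonneg[OF assms(4)] by (rule power2_le_imp_le)
qed

text \<open>The candidate \<open>S\<close> settles existence in the definite description and
  nondegeneracy settles uniqueness, so adjoints can be computed without an appeal to
  completeness.\<close>

lemma adjoint_eqI:
  assumes "S \<in> carrier (bounded_operators H)" "T \<in> linear_maps H H"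
    "\<And>x y. \<lbrakk>x \<in> carrier H; y \<in> carrier H\<rbrakk> \<Longrightarrow> cinner H (T x) y = cinner H x (S y)"
  shows "adjoint H T = S"
  unfolding adjoint_def
proof (rule the_equality)
  fix R assume R: "R \<in> carrier (bounded_operators H) \<and>
     (\<forall>x\<in>carrier H. \<forall>y\<in>carrier H. cinner H (T x) y = cinner H x (R y))"
  note lin = bounded_operators_linear[OF assms(1)] bounded_operators_linear[OF conjunct1[OF R]]
  show "R = S"
  proof (rule linear_maps_ext[OF lin(2,1)])
    fix y assume y: "y \<in> carrier H"
    then have c: "R y \<in> carrier H" "S y \<in> carrier H"
      using lin linear_maps_closed by metis+
    show "R y = S y"
    proof (rule cinner_ext[OF c])
      fix z assume z: "z \<in> carrier H"
      have "cinner H z (R y) = cinner H z (S y)" using R assms(3) y z by metis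
      then show "cinner H (R y) z = cinner H (S y) z"
        using cinner_commute c z by metis
    qed
  qed
qed (use assms in auto)

lemma projectionI:
  assumes "T \<in> linear_maps H H" "\<And>x. x \<in> carrier H \<Longrightarrow> T (T x) = T x"
    "\<And>x y. \<lbrakk>x \<in> carrier H; y \<in> carrier H\<rbrakk> \<Longrightarrow> cinner H (T x) y = cinner H x (T y)"
  shows "projection H T"
  unfolding projection_def
proof (intro conjI)
  have "T \<in> carrier H \<rightarrow> carrier H" using assms(1) by (auto intro: linear_maps_closed)
  then show b: "T \<in> carrier (bounded_operators H)"
    using assms by (intro bounded_operatorsI[where B = 1]) (auto intro: symmetric_idempotent_contraction)
  show "T \<otimes>\<^bsub>bounded_operators H\<^esub> T = T"
    using linear_maps_ext[OF linear_maps_compose[OF assms(1,1)] assms(1)] assms(2) by (simp add: compose_def)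
  show "adjoint H T = T" using b assms by (intro adjoint_eqI) auto
qed

end

section \<open>Completeness\<close>

context complex_inner_space begin

text \<open>Restates completeness through norms of differences, so that the default value of
  \<open>hdist\<close> outside the carrier no longer appears.\<close>

lemma mcomplete_iff:
  "Metric_space.mcomplete (carrier H) (hdist H) \<longleftrightarrow>
    (\<forall>\<sigma>. (\<forall>n. \<sigma> n \<in> carrier H) \<and>
          (\<forall>e>0. \<exists>N. \<forall>m\<ge>N. \<forall>n\<ge>N. hnorm H (\<sigma> m \<ominus> \<sigma> n) < e) \<longrightarrow>
       (\<exists>x\<in>carrier H. (\<lambda>n. hnorm H (\<sigma> n \<ominus> x)) \<longlonglongrightarrow> 0))"
proof -
  interpret D: Metric_space "carrier H" "hdist H" by (rule Metric_space_hdist)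
  have cauchy: "D.MCauchy \<sigma> \<longleftrightarrow> (\<forall>n. \<sigma> n \<in> carrier H) \<and>
      (\<forall>e>0. \<exists>N. \<forall>m\<ge>N. \<forall>n\<ge>N. hnorm H (\<sigma> m \<ominus> \<sigma> n) < e)" for \<sigma>
  proof (cases "\<forall>n. \<sigma> n \<in> carrier H")
    case True
    then show ?thesis by (auto simp: D.MCauchy_def hdist_def image_subset_iff)
  qed (auto simp: D.MCauchy_def)
  have limit: "limitin D.mtopology \<sigma> x sequentially \<longleftrightarrow>
      x \<in> carrier H \<and> (\<lambda>n. hnorm H (\<sigma> n \<ominus> x)) \<longlonglongrightarrow> 0"
    if "\<forall>n. \<sigma> n \<in> carrier H" for \<sigma> x
    using that by (auto simp: D.limitin_metric_dist_null hdist_def)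
  show ?thesis
    unfolding D.mcomplete_def cauchy by (rule iff_allI) (auto simp: limit)
qed

lemma tendsto_cinner:
  assumes c: "\<And>n. \<sigma> n \<in> carrier H" "\<And>n. \<tau> n \<in> carrier H" "x \<in> carrier H" "y \<in> carrier H"
    and s: "(\<lambda>n. hnorm H (\<sigma> n \<ominus> x)) \<longlonglongrightarrow> 0" and t: "(\<lambda>n. hnorm H (\<tau> n \<ominus> y)) \<longlonglongrightarrow> 0"
  shows "(\<lambda>n. cinner H (\<sigma> n) (\<tau> n)) \<longlonglongrightarrow> cinner H x y"
proof -
  let ?b = "\<lambda>n. hnorm H (\<sigma> n \<ominus> x) * hnorm H (\<tau> n \<ominus> y)
      + hnorm H (\<sigma> n \<ominus> x) * hnorm H y + hnorm H x * hnorm H (\<tau> n \<ominus> y)"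
  have "cmod (cinner H (\<sigma> n) (\<tau> n) - cinner H x y) \<le> ?b n" for n
  proof -
    have "cinner H (\<sigma> n) (\<tau> n) - cinner H x y = cinner H (\<sigma> n \<ominus> x) (\<tau> n \<ominus> y)
        + cinner H (\<sigma> n \<ominus> x) y + cinner H x (\<tau> n \<ominus> y)"
      using c by (simp add: cinner_simps)
    also have "cmod \<dots> \<le> cmod (cinner H (\<sigma> n \<ominus> x) (\<tau> n \<ominus> y))
        + cmod (cinner H (\<sigma> n \<ominus> x) y) + cmod (cinner H x (\<tau> n \<ominus> y))"
      by (rule norm_triangle_le[OF add_right_mono[OF norm_triangle_ineq]])
    also have "\<dots> \<le> ?b n"
      using c by (intro add_mono cmod_cinner_le) auto
    finally show ?thesis .
  qed
  moreover have "?b \<longlonglongrightarrow> 0 * 0 + 0 * hnorm H y + hnorm H x * 0"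
    by (intro tendsto_intros s t)
  ultimately have "(\<lambda>n. cinner H (\<sigma> n) (\<tau> n) - cinner H x y) \<longlonglongrightarrow> 0"
    by (auto intro: Lim_null_comparison[of _ ?b])
  then show ?thesis by (rule LIM_zero_cancel)
qed

lemma tendsto_cinner_left:
  assumes "\<And>n. \<sigma> n \<in> carrier H" "x \<in> carrier H" "y \<in> carrier H"
    and "(\<lambda>n. hnorm H (\<sigma> n \<ominus> x)) \<longlonglongrightarrow> 0"
  shows "(\<lambda>n. cinner H (\<sigma> n) y) \<longlonglongrightarrow> cinner H x y"
  by (rule tendsto_cinner) (use assms in \<open>auto simp: minus_eq_zero[THEN iffD2]\<close>)

end

context complex_hilbert_space begin

lemma convergentI:
  assumes "\<And>n. \<sigma> n \<in> carrier H"
    and "\<And>e. e > 0 \<Longrightarrow> \<exists>N. \<forall>m\<ge>N. \<forall>n\<ge>N. hnorm H (\<sigma> m \<ominus> \<sigma> n) < e"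
  obtains x where "x \<in> carrier H" "(\<lambda>n. hnorm H (\<sigma> n \<ominus> x)) \<longlonglongrightarrow> 0"
  using complete assms unfolding mcomplete_iff by metis

text \<open>A sequence in \<open>M\<close> minimizing the distance to \<open>x\<close> is Cauchy by the parallelogram law,
  and the difference of \<open>x\<close> and its limit is orthogonal to \<open>M\<close>.\<close>

lemma dense_subspaceI:
  assumes M: "M \<subseteq> carrier H" "\<zero> \<in> M" "\<And>a b. \<lbrakk>a \<in> M; b \<in> M\<rbrakk> \<Longrightarrow> a \<oplus> b \<in> M"
      "\<And>c a. a \<in> M \<Longrightarrow> c \<odot> a \<in> M"
    and orth: "\<And>z. \<lbrakk>z \<in> carrier H; \<And>m. m \<in> M \<Longrightarrow> cinner H m z = 0\<rbrakk> \<Longrightarrow> z = \<zero>"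
    and x: "x \<in> carrier H" and e: "e > 0"
  shows "\<exists>m\<in>M. hnorm H (x \<ominus> m) < e"
proof -
  note Mc = subsetD[OF M(1)]
  define D where "D = (\<lambda>m. hnorm H (x \<ominus> m)) ` M"
  define d where "d = Inf D"
  have bdd: "bdd_below D" using x Mc by (auto simp: D_def intro!: bdd_belowI[of _ 0] hnorm_nonneg)
  have ne: "D \<noteq> {}" using M(2) by (auto simp: D_def)
  have d_le: "d \<le> hnorm H (x \<ominus> m)" if "m \<in> M" for m
    unfolding d_def using that by (intro cInf_lower bdd) (auto simp: D_def)
  have d0: "d \<ge> 0" unfolding d_def
    using x Mc by (intro cInf_greatest ne) (auto simp: D_def hnorm_nonneg)
  \<comment> \<open>The slack \<open>1/(n+1)\<close> of the minimizing sequence; being at most 1,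
    its square is absorbed by the linear term in \<open>sq\<close>.\<close>
  define r where "r n = inverse (real (Suc n))" for n
  have r: "0 < r n" "r n \<le> 1" for n by (auto simp: r_def inverse_le_1_iff)
  have "\<exists>m\<in>M. hnorm H (x \<ominus> m) < d + r n" for n
  proof -
    have "Inf D < d + r n" using r(1)[of n] by (simp add: d_def)
    then show ?thesis using cInf_less_iff[OF ne bdd] by (auto simp: D_def)
  qed
  then obtain m where m: "\<And>n. m n \<in> M" "\<And>n. hnorm H (x \<ominus> m n) < d + r n" by metis
  note mc = Mc[OF m(1)]
  have sq: "(hnorm H (x \<ominus> m n))\<^sup>2 \<le> d\<^sup>2 + r n * (2 * d + 1)" for n
  proof -
    have "(hnorm H (x \<ominus> m n))\<^sup>2 \<le> (d + r n)\<^sup>2"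
      using m(2)[of n] x mc by (intro power_mono hnorm_nonneg) (auto simp: less_imp_le)
    also have "\<dots> \<le> d\<^sup>2 + r n * (2 * d + 1)"
      using r[of n] mult_left_mono[of "r n" 1 "r n"] by (simp add: power2_eq_square algebra_simps)
    finally show ?thesis .
  qed
  have par: "(hnorm H (m i \<ominus> m j))\<^sup>2 \<le> 2 * (2 * d + 1) * (r i + r j)" for i j
  proof -
    \<comment> \<open>The midpoint lies in \<open>M\<close>, hence at distance at least
      \<open>d\<close> from \<open>x\<close>; this is the negative term of the parallelogram
      identity.\<close>
    let ?c = "(1/2) \<odot> (m i \<oplus> m j)"
    have "?c \<in> M" using M m(1) by auto
    then have dc: "d\<^sup>2 \<le> (hnorm H (x \<ominus> ?c))\<^sup>2" using d_le d0 by (intro power_mono) auto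
    have "cinner H (m i \<ominus> m j) (m i \<ominus> m j) = 2 * cinner H (x \<ominus> m i) (x \<ominus> m i)
        + 2 * cinner H (x \<ominus> m j) (x \<ominus> m j) - 4 * cinner H (x \<ominus> ?c) (x \<ominus> ?c)"
      using x mc by (simp add: cinner_simps algebra_simps)
    then have "(hnorm H (m i \<ominus> m j))\<^sup>2 = 2 * (hnorm H (x \<ominus> m i))\<^sup>2
        + 2 * (hnorm H (x \<ominus> m j))\<^sup>2 - 4 * (hnorm H (x \<ominus> ?c))\<^sup>2"
      using x mc by (simp flip: Re_cinner_self)
    then show ?thesis using sq[of i] sq[of j] dc by (simp add: algebra_simps)
  qed
  have r_lim: "r \<longlonglongrightarrow> 0" unfolding r_def by (rule LIMSEQ_inverse_real_of_nat)
  have cauchy: "\<exists>N. \<forall>i\<ge>N. \<forall>j\<ge>N. hnorm H (m i \<ominus> m j) < e" if "e > 0" for e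
  proof -
    have "(\<lambda>n. 2 * (2 * d + 1) * (r n + r n)) \<longlonglongrightarrow> 2 * (2 * d + 1) * (0 + 0)"
      by (intro tendsto_intros r_lim)
    then have "eventually (\<lambda>n. 2 * (2 * d + 1) * (r n + r n) < e\<^sup>2) sequentially"
      using that by (intro order_tendstoD) auto
    then obtain N where N: "2 * (2 * d + 1) * (r N + r N) < e\<^sup>2"
      by (auto simp: eventually_sequentially)
    have "hnorm H (m i \<ominus> m j) < e" if "i \<ge> N" "j \<ge> N" for i j
    proof -
      have "r i \<le> r N" "r j \<le> r N" using that by (auto simp: r_def)
      then have "2 * (2 * d + 1) * (r i + r j) \<le> 2 * (2 * d + 1) * (r N + r N)"
        using d0 by (intro mult_left_mono add_mono) auto
      then have "(hnorm H (m i \<ominus> m j))\<^sup>2 < e\<^sup>2" using par[of i j] N by linarith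
      then show ?thesis using \<open>e > 0\<close> by (rule power_less_imp_less_base[OF _ less_imp_le])
    qed
    then show ?thesis by blast
  qed
  obtain p where p: "p \<in> carrier H" and p_lim: "(\<lambda>n. hnorm H (m n \<ominus> p)) \<longlonglongrightarrow> 0"
    using convergentI[of m] mc cauchy by metis
  define z where "z = x \<ominus> p"
  have z: "z \<in> carrier H" using x p by (simp add: z_def)
  have z_le: "hnorm H z \<le> d"
  proof (rule LIMSEQ_le_const)
    have "(\<lambda>n. d + r n + hnorm H (m n \<ominus> p)) \<longlonglongrightarrow> d + 0 + 0"
      by (intro tendsto_intros r_lim p_lim)
    then show "(\<lambda>n. d + r n + hnorm H (m n \<ominus> p)) \<longlonglongrightarrow> d" by simp
    have "hnorm H z \<le> d + r n + hnorm H (m n \<ominus> p)" for n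
      using hnorm_diff_le[of x "m n" p] m(2)[of n] x mc p by (simp add: z_def)
    then show "\<exists>N. \<forall>n\<ge>N. hnorm H z \<le> d + r n + hnorm H (m n \<ominus> p)" by blast
  qed
  \<comment> \<open>\<open>M\<close> is not closed, so the limit \<open>p\<close> may lie outside
    it. The bound passes to the limit because the translates \<open>m n \<oplus> a\<close> stay in
    \<open>M\<close>.\<close>
  have le_z: "d \<le> hnorm H (z \<ominus> a)" if a: "a \<in> M" for a
  proof (rule LIMSEQ_le_const)
    have "(\<lambda>n. hnorm H (z \<ominus> a) + hnorm H (m n \<ominus> p)) \<longlonglongrightarrow> hnorm H (z \<ominus> a) + 0"
      by (intro tendsto_intros p_lim)
    then show "(\<lambda>n. hnorm H (z \<ominus> a) + hnorm H (m n \<ominus> p)) \<longlonglongrightarrow> hnorm H (z \<ominus> a)" by simp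
    have "d \<le> hnorm H (z \<ominus> a) + hnorm H (m n \<ominus> p)" for n
    proof -
      have "x \<ominus> (m n \<oplus> a) = (z \<ominus> a) \<oplus> (\<ominus> (m n \<ominus> p))"
        by (rule cinner_ext) (use x mc p Mc[OF a] in \<open>auto simp: z_def cinner_simps\<close>)
      then show ?thesis
        using d_le[OF M(3)[OF m(1) a], of n] hnorm_triangle[of "z \<ominus> a" "\<ominus> (m n \<ominus> p)"]
          x mc p Mc[OF a] z by (simp add: hnorm_uminus)
    qed
    then show "\<exists>N. \<forall>n\<ge>N. d \<le> hnorm H (z \<ominus> a) + hnorm H (m n \<ominus> p)" by blast
  qed
  have "cinner H a z = 0" if a: "a \<in> M" for a
  proof (cases "a = \<zero>")
    case False
    note ac = Mc[OF a]
    define w where "w = cinner H z a"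
    define q where "q = (hnorm H a)\<^sup>2"
    have q: "q > 0" using cinner_pos[OF ac False] by (simp add: q_def Re_cinner_self ac)
    \<comment> \<open>The coefficient of the orthogonal projection of \<open>z\<close> onto
      \<open>a\<close>: subtracting \<open>k \<odot> a\<close> shortens \<open>z\<close> unless the
      two are orthogonal.\<close>
    define k where "k = w / of_real q"
    have wk: "cinner H a z = cnj w" using cinner_commute[OF ac z] by (simp add: w_def)
    have "cinner H (z \<ominus> k \<odot> a) (z \<ominus> k \<odot> a)
        = cinner H z z - cnj k * w - k * cnj w + k * cnj k * of_real q"
      using z ac by (simp add: cinner_simps wk w_def[symmetric] q_def cinner_self[OF ac] algebra_simps)
    also have "\<dots> = cinner H z z - w * cnj w / of_real q"
      using q by (simp add: k_def field_simps)
    also have "\<dots> = cinner H z z - of_real ((cmod w)\<^sup>2 / q)"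
      by (simp only: of_real_divide complex_norm_square)
    finally have "(hnorm H (z \<ominus> k \<odot> a))\<^sup>2 = (hnorm H z)\<^sup>2 - (cmod w)\<^sup>2 / q"
      using z ac by (simp flip: Re_cinner_self)
    moreover have "(hnorm H z)\<^sup>2 \<le> (hnorm H (z \<ominus> k \<odot> a))\<^sup>2"
      using z_le le_z[OF M(4)[OF a]] hnorm_nonneg[OF z] by (intro power_mono) (auto intro: order_trans)
    ultimately have "(cmod w)\<^sup>2 / q \<le> 0" by simp
    then have "w = 0" using q by (simp add: divide_le_0_iff)
    then show ?thesis using wk by simp
  qed (use z cinner_zero_left in auto)
  \<comment> \<open>Orthogonality to all of \<open>M\<close> forces \<open>x = p\<close>, so the
    minimizing sequence itself approximates \<open>x\<close>.\<close>
  then have "z = \<zero>" using orth z by blast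
  then have "x = p" using minus_eq_zero x p by (simp add: z_def)
  then have "eventually (\<lambda>n. hnorm H (m n \<ominus> x) < e) sequentially"
    using p_lim e by (intro order_tendstoD) auto
  then obtain n where "hnorm H (m n \<ominus> x) < e" by (auto simp: eventually_sequentially)
  then show ?thesis using m(1) hnorm_minus_commute[OF mc x] by auto
qed


end

section \<open>Riesz representation and existence of adjoints\<close>

context complex_hilbert_space begin

text \<open>If \<open>f\<close> is not zero, its kernel \<open>M\<close> is not dense, so by
  \<open>dense_subspaceI\<close> some nonzero \<open>z\<close> is orthogonal to \<open>M\<close>; a
  multiple of \<open>z\<close> represents \<open>f\<close>.\<close>

lemma riesz:
  assumes add: "\<And>x y. \<lbrakk>x \<in> carrier H; y \<in> carrier H\<rbrakk> \<Longrightarrow> f (x \<oplus> y) = f x + f y"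
    and smult: "\<And>a x. x \<in> carrier H \<Longrightarrow> f (a \<odot> x) = a * f x"
    and bounded: "\<And>x. x \<in> carrier H \<Longrightarrow> cmod (f x) \<le> B * hnorm H x"
  shows "\<exists>y\<in>carrier H. \<forall>x\<in>carrier H. f x = cinner H x y"
proof (cases "\<forall>x\<in>carrier H. f x = 0")
  case True
  then show ?thesis by (intro bexI[of _ \<zero>]) (auto simp: cinner_zero_right)
next
  case False
  then obtain x where x: "x \<in> carrier H" "f x \<noteq> 0" by blast
  have minus: "f (a \<ominus> b) = f a - f b" if "a \<in> carrier H" "b \<in> carrier H" for a b
    using that by (simp add: M.minus_eq minus_eq_smult add smult)
  define B' where "B' = \<bar>B\<bar> + 1"
  have B': "B' > 0" "B \<le> B'" by (auto simp: B'_def)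
  have bounded': "cmod (f x) \<le> B' * hnorm H x" if "x \<in> carrier H" for x
    using bounded[OF that] mult_right_mono[OF B'(2) hnorm_nonneg[OF that]] by (rule order_trans)
  define M where "M = {a \<in> carrier H. f a = 0}"
  have "f \<zero> = 0" using smult[OF M.zero_closed, of 0] by simp
  have "\<exists>z\<in>carrier H. (\<forall>m\<in>M. cinner H m z = 0) \<and> z \<noteq> \<zero>"
  proof (rule ccontr)
    assume "\<not> ?thesis"
    \<comment> \<open>Were \<open>M\<close> dense, some \<open>m\<close> would satisfy
      \<open>hnorm H (x \<ominus> m) < cmod (f x) / B'\<close>, against
      \<open>f (x \<ominus> m) = f x\<close> and the bound \<open>B'\<close>.\<close>
    then have "\<exists>m\<in>M. hnorm H (x \<ominus> m) < cmod (f x) / B'"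
      using x B'(1) \<open>f \<zero> = 0\<close> by (intro dense_subspaceI) (auto simp: M_def add smult)
    then obtain m where m: "m \<in> carrier H" "f m = 0" "hnorm H (x \<ominus> m) < cmod (f x) / B'"
      by (auto simp: M_def)
    then show False using bounded'[of "x \<ominus> m"] x B'(1) by (simp add: minus field_simps)
  qed
  then obtain z where z: "z \<in> carrier H" "\<And>m. m \<in> M \<Longrightarrow> cinner H m z = 0" "z \<noteq> \<zero>" by blast
  have zz: "cinner H z z \<noteq> 0" using cinner_pos[OF z(1,3)] by auto
  have fz: "f z \<noteq> 0" using z zz by (auto simp: M_def)
  have "f y = cinner H y (cnj (f z / cinner H z z) \<odot> z)" if y: "y \<in> carrier H" for y
  proof -
    \<comment> \<open>Removing the right multiple of \<open>z\<close> puts \<open>y\<close> into the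
      kernel, so its inner product with \<open>z\<close> determines \<open>f y\<close>.\<close>
    have "y \<ominus> (f y / f z) \<odot> z \<in> M" using y z fz by (auto simp: M_def minus smult)
    then have "cinner H (y \<ominus> (f y / f z) \<odot> z) z = 0" by (rule z(2))
    then have "cinner H y z = f y / f z * cinner H z z" using y z by (simp add: cinner_simps)
    then show ?thesis using y z zz fz by (simp add: cinner_simps)
  qed
  then show ?thesis using smult_in[OF z(1)] by blast
qed

text \<open>Riesz gives the value at each \<open>y\<close>; linearity follows by testing against
  vectors, since the defining identity is linear in \<open>y\<close> up to conjugation.\<close>

lemma adjoint_exists:
  assumes T: "T \<in> carrier (bounded_operators H)"
  obtains S where "S \<in> carrier (bounded_operators H)"
    "\<And>x y. \<lbrakk>x \<in> carrier H; y \<in> carrier H\<rbrakk> \<Longrightarrow> cinner H (T x) y = cinner H x (S y)"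
proof -
  note lin = bounded_operators_linear[OF T]
  note cl = linear_maps_closed[OF lin]
  obtain B where B: "B > 0" "\<And>x. x \<in> carrier H \<Longrightarrow> hnorm H (T x) \<le> B * hnorm H x"
    using bounded_operators_bound[OF T] by metis
  have "\<exists>s\<in>carrier H. \<forall>x\<in>carrier H. cinner H (T x) y = cinner H x s" if y: "y \<in> carrier H" for y
  proof (rule riesz)
    fix x assume x: "x \<in> carrier H"
    show "cmod (cinner H (T x) y) \<le> (B * hnorm H y) * hnorm H x"
      using cmod_cinner_le[OF cl[OF x] y] mult_right_mono[OF B(2)[OF x] hnorm_nonneg[OF y]]
      by (simp add: mult_ac)
  qed (use y cl in \<open>auto simp: linear_maps_add[OF lin] linear_maps_smult[OF lin] cinner_simps\<close>)
  then obtain S0 where S0: "\<And>y. y \<in> carrier H \<Longrightarrow> S0 y \<in> carrier H"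
    "\<And>x y. \<lbrakk>x \<in> carrier H; y \<in> carrier H\<rbrakk> \<Longrightarrow> cinner H (T x) y = cinner H x (S0 y)" by metis
  define S where "S = restrict S0 (carrier H)"
  have S: "\<And>y. y \<in> carrier H \<Longrightarrow> S y \<in> carrier H"
    "\<And>x y. \<lbrakk>x \<in> carrier H; y \<in> carrier H\<rbrakk> \<Longrightarrow> cinner H (T x) y = cinner H x (S y)"
    using S0 by (auto simp: S_def)
  have S': "cinner H (S y) x = cinner H y (T x)" if "x \<in> carrier H" "y \<in> carrier H" for x y
    using cinner_commute[OF S(1)[OF that(2)] that(1)] S(2)[OF that] cinner_commute[OF that(2) cl[OF that(1)]]
    by simp
  have "S \<in> carrier (bounded_operators H)"
  proof (rule bounded_operatorsI)
    show "S \<in> linear_maps H H"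
    proof (rule linear_mapsI)
      show "S \<in> extensional (carrier H)" by (simp add: S_def)
      show "S (x \<oplus> y) = S x \<oplus> S y" if "x \<in> carrier H" "y \<in> carrier H" for x y
        by (rule cinner_ext) (use that S(1) S' cl in \<open>auto simp: cinner_add_left\<close>)
      show "S (a \<odot> x) = a \<odot> S x" if "x \<in> carrier H" for a x
        by (rule cinner_ext) (use that S(1) S' cl in \<open>auto simp: cinner_smult_left\<close>)
    qed (rule S)
    fix y assume y: "y \<in> carrier H"
    note Sy = S(1)[OF y]
    \<comment> \<open>Taking \<open>x = S y\<close> in the adjoint identity bounds the square of the
      norm; one factor is then cancelled.\<close>
    have "hnorm H (S y) * hnorm H (S y) = Re (cinner H (T (S y)) y)"
      using S(2)[OF Sy y] Re_cinner_self[OF Sy] by (simp add: power2_eq_square)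
    also have "\<dots> \<le> hnorm H (T (S y)) * hnorm H y" by (intro cauchy_schwarz cl Sy y)
    also have "\<dots> \<le> B * hnorm H (S y) * hnorm H y"
      using B(2)[OF Sy] hnorm_nonneg[OF y] by (rule mult_right_mono)
    finally have "hnorm H (S y) * hnorm H (S y) \<le> hnorm H (S y) * (B * hnorm H y)"
      by (simp add: mult_ac)
    then show "hnorm H (S y) \<le> B * hnorm H y"
      using hnorm_nonneg[OF Sy] hnorm_nonneg[OF y] B(1) by (auto simp: mult_le_cancel_left)
  qed
  with S(2) show ?thesis by (intro that)
qed

lemma adjoint_bounded: "T \<in> carrier (bounded_operators H) \<Longrightarrow> adjoint H T \<in> carrier (bounded_operators H)"
  using adjoint_exists adjoint_eqI bounded_operators_linear by metis

lemma cinner_adjoint: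
  "\<lbrakk>T \<in> carrier (bounded_operators H); x \<in> carrier H; y \<in> carrier H\<rbrakk> \<Longrightarrow>
    cinner H (T x) y = cinner H x (adjoint H T y)"
  using adjoint_exists[of T] adjoint_eqI[of _ T] bounded_operators_linear[of T] by metis

lemma projection_linear: "projection H P \<Longrightarrow> P \<in> linear_maps H H"
  by (simp add: projection_def bounded_operators_linear)

lemma projection_idem: "\<lbrakk>projection H P; x \<in> carrier H\<rbrakk> \<Longrightarrow> P (P x) = P x"
  unfolding projection_def bounded_operators_mult by (metis compose_eq)

lemma projection_symmetric:
  "\<lbrakk>projection H P; x \<in> carrier H; y \<in> carrier H\<rbrakk> \<Longrightarrow> cinner H (P x) y = cinner H x (P y)"
  using cinner_adjoint[of P x y] by (auto simp: projection_def)

end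



section \<open>Finite powers of a Hilbert space\<close>

lemma power_space_simps [simp]:
  "carrier (power_space V K) = V \<rightarrow>\<^sub>E carrier K"
  "\<zero>\<^bsub>power_space V K\<^esub> = (\<lambda>v\<in>V. \<zero>\<^bsub>K\<^esub>)"
  "f \<oplus>\<^bsub>power_space V K\<^esub> g = (\<lambda>v\<in>V. f v \<oplus>\<^bsub>K\<^esub> g v)"
  "a \<odot>\<^bsub>power_space V K\<^esub> f = (\<lambda>v\<in>V. a \<odot>\<^bsub>K\<^esub> f v)"
  "cinner (power_space V K) f g = (\<Sum>v\<in>V. cinner K (f v) (g v))"
  by (auto simp: power_space_def)

lemma power_space_component:
  "f \<in> V \<rightarrow>\<^sub>E carrier K \<Longrightarrow> v \<in> V \<Longrightarrow> f v \<in> carrier K"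
  by (rule PiE_mem)

lemma complex_inner_space_power_space:
  assumes "finite V" "complex_inner_space K"
  shows "complex_inner_space (power_space V K)"
proof -
  interpret K: complex_inner_space K by fact
  have ext: "f = g" if "f \<in> V \<rightarrow>\<^sub>E carrier K" "g \<in> V \<rightarrow>\<^sub>E carrier K" "\<And>v. v \<in> V \<Longrightarrow> f v = g v" for f g
    using that by (metis PiE_ext)
  have "Module.module complex_ring (power_space V K)"
  proof (rule moduleI[OF cring_complex_ring])
    show "abelian_group (power_space V K)"
    proof (rule abelian_groupI)
      fix f assume f: "f \<in> carrier (power_space V K)"
      show "\<exists>g\<in>carrier (power_space V K). g \<oplus>\<^bsub>power_space V K\<^esub> f = \<zero>\<^bsub>power_space V K\<^esub>"
        using f by (intro bexI[of _ "\<lambda>v\<in>V. \<ominus>\<^bsub>K\<^esub> f v"]) (auto intro!: restrict_ext K.M.l_neg)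
    qed (auto intro!: ext simp: power_space_component K.M.a_ac)
    show "(a \<oplus>\<^bsub>complex_ring\<^esub> b) \<odot>\<^bsub>power_space V K\<^esub> f =
        a \<odot>\<^bsub>power_space V K\<^esub> f \<oplus>\<^bsub>power_space V K\<^esub> b \<odot>\<^bsub>power_space V K\<^esub> f"
      "(a \<otimes>\<^bsub>complex_ring\<^esub> b) \<odot>\<^bsub>power_space V K\<^esub> f =
        a \<odot>\<^bsub>power_space V K\<^esub> (b \<odot>\<^bsub>power_space V K\<^esub> f)"
      if "f \<in> carrier (power_space V K)" for a b f
      using that K.smult_l_distr[of a b] K.smult_assoc1[of a b] by (auto simp: power_space_component intro!: restrict_ext)
    show "a \<odot>\<^bsub>power_space V K\<^esub> (f \<oplus>\<^bsub>power_space V K\<^esub> g) =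
        a \<odot>\<^bsub>power_space V K\<^esub> f \<oplus>\<^bsub>power_space V K\<^esub> a \<odot>\<^bsub>power_space V K\<^esub> g"
      if "f \<in> carrier (power_space V K)" "g \<in> carrier (power_space V K)" for a f g
      using that K.smult_r_distr[of a] by (auto simp: power_space_component intro!: restrict_ext)
    show "\<one>\<^bsub>complex_ring\<^esub> \<odot>\<^bsub>power_space V K\<^esub> f = f" if "f \<in> carrier (power_space V K)" for f
      by (rule ext) (use that in \<open>auto simp: power_space_component K.smult_one[unfolded K.complex_ring_simps]\<close>)
  qed (auto simp: power_space_component)
  then interpret Module.module complex_ring "power_space V K" .
  show ?thesis
  proof (unfold_locales, goal_cases)
    case (1 x y z)
    then show ?case by (auto simp: power_space_component K.cinner_add_left sum.distrib)
  next
    case (2 x y a)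
    then show ?case by (auto simp: power_space_component K.cinner_smult_left sum_distrib_left)
  next
    case (3 x y)
    then show ?case by (auto simp: cnj_sum power_space_component intro!: sum.cong K.cinner_commute)
  next
    case (4 x)
    then obtain v where v: "v \<in> V" "x v \<noteq> \<zero>\<^bsub>K\<^esub>" using ext[of x "\<lambda>v\<in>V. \<zero>\<^bsub>K\<^esub>"] by auto
    have "0 < (\<Sum>v\<in>V. Re (cinner K (x v) (x v)))"
      using 4 v assms(1) by (intro sum_pos2[of V v]) (auto intro!: K.cinner_pos K.cinner_nonneg simp: power_space_component)
    then show ?case by simp
  qed
qed

context
  fixes V :: "'v set" and K :: "'a cspace"
  assumes finV: "finite V" and K: "complex_inner_space K"
begin

interpretation K: complex_inner_space K by (rule K)
interpretation KV: complex_inner_space "power_space V K"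
  by (rule complex_inner_space_power_space[OF finV K])

lemma power_space_minus:
  assumes "f \<in> V \<rightarrow>\<^sub>E carrier K" "g \<in> V \<rightarrow>\<^sub>E carrier K" "v \<in> V"
  shows "(f \<ominus>\<^bsub>power_space V K\<^esub> g) v = f v \<ominus>\<^bsub>K\<^esub> g v"
  using assms by (simp add: KV.M.minus_eq K.M.minus_eq KV.minus_eq_smult K.minus_eq_smult power_space_component)

end

text \<open>Components of a Cauchy sequence are Cauchy. Their limits, restricted to \<open>V\<close>
  to stay extensional, form a limit in norm because the squared norm is a finite sum.\<close>

lemma complex_hilbert_space_power_space:
  assumes "finite V" "complex_hilbert_space K"
  shows "complex_hilbert_space (power_space V K)"
proof -
  interpret K: complex_hilbert_space K by fact
  let ?P = "power_space V K"
  interpret KV: complex_inner_space ?P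
    by (rule complex_inner_space_power_space[OF assms(1)]) unfold_locales
  note minus = power_space_minus[OF assms(1) K.complex_inner_space_axioms]
  have norm_sq: "(hnorm ?P (f \<ominus>\<^bsub>?P\<^esub> g))\<^sup>2 = (\<Sum>v\<in>V. (hnorm K (f v \<ominus>\<^bsub>K\<^esub> g v))\<^sup>2)"
    if "f \<in> carrier ?P" "g \<in> carrier ?P" for f g
  proof -
    have "(hnorm ?P (f \<ominus>\<^bsub>?P\<^esub> g))\<^sup>2 = Re (cinner ?P (f \<ominus>\<^bsub>?P\<^esub> g) (f \<ominus>\<^bsub>?P\<^esub> g))"
      by (rule KV.Re_cinner_self[OF KV.M.minus_closed[OF that], symmetric])
    also have "\<dots> = (\<Sum>v\<in>V. (hnorm K (f v \<ominus>\<^bsub>K\<^esub> g v))\<^sup>2)"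
      using that by (auto simp: minus power_space_component intro!: sum.cong K.Re_cinner_self)
    finally show ?thesis .
  qed
  have "Metric_space.mcomplete (carrier ?P) (hdist ?P)"
    unfolding KV.mcomplete_iff
  proof (intro allI impI, elim conjE)
    fix \<sigma> :: "nat \<Rightarrow> 'a \<Rightarrow> 'b"
    assume \<sigma>: "\<forall>n. \<sigma> n \<in> carrier ?P"
      and cauchy: "\<forall>e>0. \<exists>N. \<forall>m\<ge>N. \<forall>n\<ge>N. hnorm ?P (\<sigma> m \<ominus>\<^bsub>?P\<^esub> \<sigma> n) < e"
    have \<sigma>v: "\<sigma> n v \<in> carrier K" if "v \<in> V" for n v using \<sigma> that by (auto simp: power_space_component)
    have "\<exists>x\<in>carrier K. (\<lambda>n. hnorm K (\<sigma> n v \<ominus>\<^bsub>K\<^esub> x)) \<longlonglongrightarrow> 0" if v: "v \<in> V" for v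
    proof -
      have le: "hnorm K (\<sigma> m v \<ominus>\<^bsub>K\<^esub> \<sigma> n v) \<le> hnorm ?P (\<sigma> m \<ominus>\<^bsub>?P\<^esub> \<sigma> n)" for m n
      proof (rule power2_le_imp_le)
        show "(hnorm K (\<sigma> m v \<ominus>\<^bsub>K\<^esub> \<sigma> n v))\<^sup>2 \<le> (hnorm ?P (\<sigma> m \<ominus>\<^bsub>?P\<^esub> \<sigma> n))\<^sup>2"
          unfolding norm_sq[OF \<sigma>[rule_format] \<sigma>[rule_format]]
          using assms(1) v by (intro member_le_sum) auto
      qed (use \<sigma> in \<open>auto intro!: KV.hnorm_nonneg simp del: power_space_simps\<close>)
      show ?thesis
      proof (rule K.convergentI[of "\<lambda>n. \<sigma> n v"])
        fix e :: real assume "e > 0"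
        then show "\<exists>N. \<forall>m\<ge>N. \<forall>n\<ge>N. hnorm K (\<sigma> m v \<ominus>\<^bsub>K\<^esub> \<sigma> n v) < e"
          using cauchy le by (meson le_less_trans)
      qed (use \<sigma>v[OF v] in auto)
    qed
    then obtain l0 where l0: "\<And>v. v \<in> V \<Longrightarrow> l0 v \<in> carrier K"
      "\<And>v. v \<in> V \<Longrightarrow> (\<lambda>n. hnorm K (\<sigma> n v \<ominus>\<^bsub>K\<^esub> l0 v)) \<longlonglongrightarrow> 0" by metis
    define l where "l = restrict l0 V"
    have l: "l \<in> carrier ?P" using l0 by (simp add: l_def)
    have lim: "(\<lambda>n. sqrt (\<Sum>v\<in>V. (hnorm K (\<sigma> n v \<ominus>\<^bsub>K\<^esub> l v))\<^sup>2)) \<longlonglongrightarrow> sqrt (\<Sum>v\<in>V. 0\<^sup>2)"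
      using l0(2) by (intro tendsto_intros) (simp add: l_def)
    have "sqrt (\<Sum>v\<in>V. (hnorm K (\<sigma> n v \<ominus>\<^bsub>K\<^esub> l v))\<^sup>2) = hnorm ?P (\<sigma> n \<ominus>\<^bsub>?P\<^esub> l)" for n
      by (rule real_sqrt_unique[OF norm_sq[OF \<sigma>[rule_format] l]
            KV.hnorm_nonneg[OF KV.M.minus_closed[OF \<sigma>[rule_format] l]]])
    with lim have "(\<lambda>n. hnorm ?P (\<sigma> n \<ominus>\<^bsub>?P\<^esub> l)) \<longlonglongrightarrow> 0"
      by (simp only: power_zero_numeral sum.neutral_const real_sqrt_zero)
    with l show "\<exists>x\<in>carrier ?P. (\<lambda>n. hnorm ?P (\<sigma> n \<ominus>\<^bsub>?P\<^esub> x)) \<longlonglongrightarrow> 0"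
      by blast
  qed
  then show ?thesis
    by (intro complex_hilbert_space.intro complex_hilbert_space_axioms.intro KV.complex_inner_space_axioms)
qed

section \<open>The projection family of a matrix of operators\<close>

text \<open>Trades an identity between operator sums for one between sums of complex numbers, where
  summations over \<open>U\<close> and \<open>V\<close> can be interchanged.\<close>

lemma (in complex_inner_space) finsum_bounded_operators_eq_iff:
  assumes "finite I" "\<And>i. i \<in> I \<Longrightarrow> T i \<in> carrier (bounded_operators H)" "S \<in> linear_maps H H"
  shows "(\<Oplus>\<^bsub>bounded_operators H\<^esub>i\<in>I. T i) = S \<longleftrightarrow>
    (\<forall>x\<in>carrier H. \<forall>z\<in>carrier H. (\<Sum>i\<in>I. cinner H (T i x) z) = cinner H (S x) z)"
proof -
  let ?F = "\<lambda>x\<in>carrier H. \<Oplus>i\<in>I. T i x"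
  have T: "T i x \<in> carrier H" if "i \<in> I" "x \<in> carrier H" for i x
    using that assms(2) bounded_operators_linear linear_maps_closed by metis
  have F: "(\<Oplus>i\<in>I. T i x) \<in> carrier H" if "x \<in> carrier H" for x
    using T that by (intro M.finsum_closed) auto
  have "?F = S \<longleftrightarrow> (\<forall>x\<in>carrier H. (\<Oplus>i\<in>I. T i x) = S x)"
  proof
    assume *: "\<forall>x\<in>carrier H. (\<Oplus>i\<in>I. T i x) = S x"
    show "?F = S"
    proof (rule extensionalityI[where A = "carrier H"])
      show "S \<in> extensional (carrier H)" using assms(3) by (auto simp: linear_maps_def PiE_def)
    qed (use * in auto)
  qed auto
  also have "\<dots> \<longleftrightarrow> (\<forall>x\<in>carrier H. \<forall>z\<in>carrier H. cinner H (\<Oplus>i\<in>I. T i x) z = cinner H (S x) z)"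
    using F linear_maps_closed[OF assms(3)] cinner_ext by (intro ball_cong refl) metis
  also have "\<dots> \<longleftrightarrow> (\<forall>x\<in>carrier H. \<forall>z\<in>carrier H. (\<Sum>i\<in>I. cinner H (T i x) z) = cinner H (S x) z)"
    using T by (intro ball_cong refl) (simp add: cinner_finsum_left)
  finally show ?thesis
    using finsum_bounded_operators[OF assms(1,2)] by simp
qed

context complex_inner_space begin

lemma kronecker_linear: "kronecker H x y \<in> linear_maps H H"
  using bounded_operators_linear[OF one_bounded_operators] bounded_operators_linear[OF zero_bounded_operators]
  by (simp add: kronecker_def)

lemma kronecker_apply: "z \<in> carrier H \<Longrightarrow> kronecker H x y z = (if x = y then z else \<zero>)"
  by (simp add: kronecker_def)

end

lemma matrix_operator_apply:
  "\<lbrakk>\<xi> \<in> V \<rightarrow>\<^sub>E carrier K; v \<in> V\<rbrakk> \<Longrightarrow> matrix_operator V K A \<xi> v = (\<Oplus>\<^bsub>K\<^esub>w\<in>V. A v w (\<xi> w))"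
  by (simp add: matrix_operator_def)

lemma matrix_operator_linear:
  assumes "complex_inner_space K" "\<And>v w. \<lbrakk>v \<in> V; w \<in> V\<rbrakk> \<Longrightarrow> A v w \<in> linear_maps K K"
  shows "matrix_operator V K A \<in> linear_maps (power_space V K) (power_space V K)"
proof -
  interpret K: complex_inner_space K by fact
  have cl: "A v w (\<xi> w) \<in> carrier K" if "v \<in> V" "w \<in> V" "\<xi> \<in> V \<rightarrow>\<^sub>E carrier K" for v w \<xi>
    using linear_maps_closed[OF assms(2)] that by (simp add: power_space_component)
  have fcl: "(\<Oplus>\<^bsub>K\<^esub>w\<in>V. A v w (\<xi> w)) \<in> carrier K" if "v \<in> V" "\<xi> \<in> V \<rightarrow>\<^sub>E carrier K" for v \<xi>
    using cl that by (intro K.M.finsum_closed) auto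
  show ?thesis
  proof (rule linear_mapsI)
    show "matrix_operator V K A \<in> extensional (carrier (power_space V K))"
      by (simp add: matrix_operator_def)
    show "matrix_operator V K A \<xi> \<in> carrier (power_space V K)" if "\<xi> \<in> carrier (power_space V K)" for \<xi>
      using that fcl by (auto simp: matrix_operator_def)
  next
    fix \<xi> \<eta> assume x: "\<xi> \<in> carrier (power_space V K)" "\<eta> \<in> carrier (power_space V K)"
    have "(\<Oplus>\<^bsub>K\<^esub>w\<in>V. A v w (\<xi> w \<oplus>\<^bsub>K\<^esub> \<eta> w)) = (\<Oplus>\<^bsub>K\<^esub>w\<in>V. A v w (\<xi> w)) \<oplus>\<^bsub>K\<^esub> (\<Oplus>\<^bsub>K\<^esub>w\<in>V. A v w (\<eta> w))"
      if v: "v \<in> V" for v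
      using x v cl fcl
      by (intro K.cinner_ext)
        (auto simp: K.cinner_finsum_left K.cinner_add_left linear_maps_add[OF assms(2)]
            power_space_component sum.distrib intro!: K.M.finsum_closed)
    moreover have "(\<lambda>v\<in>V. \<xi> v \<oplus>\<^bsub>K\<^esub> \<eta> v) \<in> V \<rightarrow>\<^sub>E carrier K"
      using x by (auto simp: power_space_component)
    moreover have "(\<Oplus>\<^bsub>K\<^esub>w\<in>V. A v w ((\<lambda>v\<in>V. \<xi> v \<oplus>\<^bsub>K\<^esub> \<eta> v) w)) = (\<Oplus>\<^bsub>K\<^esub>w\<in>V. A v w (\<xi> w \<oplus>\<^bsub>K\<^esub> \<eta> w))" if "v \<in> V" for v
      using x that by (intro K.M.finsum_cong') (auto simp: linear_maps_closed[OF assms(2)] power_space_component)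
    ultimately show "matrix_operator V K A (\<xi> \<oplus>\<^bsub>power_space V K\<^esub> \<eta>) =
        matrix_operator V K A \<xi> \<oplus>\<^bsub>power_space V K\<^esub> matrix_operator V K A \<eta>"
      using x by (simp add: matrix_operator_def cong: restrict_cong)
  next
    fix a \<xi> assume x: "\<xi> \<in> carrier (power_space V K)"
    have "(\<Oplus>\<^bsub>K\<^esub>w\<in>V. A v w (a \<odot>\<^bsub>K\<^esub> \<xi> w)) = a \<odot>\<^bsub>K\<^esub> (\<Oplus>\<^bsub>K\<^esub>w\<in>V. A v w (\<xi> w))"
      if v: "v \<in> V" for v
      using x v cl fcl
      by (intro K.cinner_ext)
        (auto simp: K.cinner_finsum_left K.cinner_smult_left linear_maps_smult[OF assms(2)]
            power_space_component sum_distrib_left intro!: K.M.finsum_closed)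
    moreover have "(\<lambda>v\<in>V. a \<odot>\<^bsub>K\<^esub> \<xi> v) \<in> V \<rightarrow>\<^sub>E carrier K"
      using x by (auto simp: power_space_component)
    moreover have "(\<Oplus>\<^bsub>K\<^esub>w\<in>V. A v w ((\<lambda>v\<in>V. a \<odot>\<^bsub>K\<^esub> \<xi> v) w)) = (\<Oplus>\<^bsub>K\<^esub>w\<in>V. A v w (a \<odot>\<^bsub>K\<^esub> \<xi> w))" if "v \<in> V" for v
      using x that by (intro K.M.finsum_cong') (auto simp: linear_maps_closed[OF assms(2)] power_space_component)
    ultimately show "matrix_operator V K A (a \<odot>\<^bsub>power_space V K\<^esub> \<xi>) =
        a \<odot>\<^bsub>power_space V K\<^esub> matrix_operator V K A \<xi>"
      using x by (simp add: matrix_operator_def cong: restrict_cong)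
  qed
qed

text \<open>Serves both directions: it proves the converse, and it is instantiated with the
  constructed \<open>C\<close> to make its formulas for the matrix projections available
  there.\<close>

locale operator_matrix = bipartite_graph U V E + K: complex_hilbert_space K
  for U V :: "'v set" and E and K :: "'k cspace" +
  fixes C :: "'v \<Rightarrow> 'v \<Rightarrow> 'k \<Rightarrow> 'k"
  assumes family: "operator_family U V E K C"
begin

abbreviation KV where "KV \<equiv> power_space V K"

sublocale KV: complex_hilbert_space "power_space V K"
  by (rule complex_hilbert_space_power_space[OF finite_V K.complex_hilbert_space_axioms])

lemma C_bounded: "\<lbrakk>u \<in> U; v \<in> V\<rbrakk> \<Longrightarrow> C u v \<in> carrier (bounded_operators K)"
  using family by (auto simp: operator_family_def)

definition D :: "'v \<Rightarrow> 'v \<Rightarrow> 'k \<Rightarrow> 'k" where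
  "D u v = adjoint K (C u v)"

lemma D_bounded: "\<lbrakk>u \<in> U; v \<in> V\<rbrakk> \<Longrightarrow> D u v \<in> carrier (bounded_operators K)"
  unfolding D_def by (intro K.adjoint_bounded C_bounded)

lemmas C_linear = K.bounded_operators_linear[OF C_bounded]
lemmas D_linear = K.bounded_operators_linear[OF D_bounded]
lemmas C_closed = linear_maps_closed[OF C_linear]
lemmas D_closed = linear_maps_closed[OF D_linear]

lemma cinner_C: "\<lbrakk>u \<in> U; v \<in> V; x \<in> carrier K; y \<in> carrier K\<rbrakk> \<Longrightarrow>
    cinner K (C u v x) y = cinner K x (D u v y)"
  unfolding D_def by (intro K.cinner_adjoint C_bounded)

lemma cinner_D: "\<lbrakk>u \<in> U; v \<in> V; x \<in> carrier K; y \<in> carrier K\<rbrakk> \<Longrightarrow>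
    cinner K (D u v x) y = cinner K x (C u v y)"
  using cinner_C[of u v y x] K.cinner_commute C_closed D_closed by metis

lemma sum_DC:
  assumes "v\<^sub>1 \<in> V" "v\<^sub>2 \<in> V" "x \<in> carrier K" "z \<in> carrier K"
  shows "(\<Sum>u\<in>U. cinner K (D u v\<^sub>1 (C u v\<^sub>2 x)) z) = (if v\<^sub>1 = v\<^sub>2 then cinner K x z else 0)"
proof -
  have "(\<Oplus>\<^bsub>bounded_operators K\<^esub>u\<in>U. compose (carrier K) (D u v\<^sub>1) (C u v\<^sub>2)) = kronecker K v\<^sub>1 v\<^sub>2"
    using family assms(1,2) by (simp add: operator_family_def D_def)
  then have "(\<Sum>u\<in>U. cinner K (compose (carrier K) (D u v\<^sub>1) (C u v\<^sub>2) x) z) = cinner K (kronecker K v\<^sub>1 v\<^sub>2 x) z"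
    using assms finite_U
    by (subst (asm) K.finsum_bounded_operators_eq_iff)
      (auto intro: K.compose_bounded_operators C_bounded D_bounded K.kronecker_linear)
  then show ?thesis using assms
    by (simp add: compose_eq K.kronecker_apply K.cinner_zero_left split: if_splits)
qed

lemma sum_CD:
  assumes "u\<^sub>1 \<in> U" "u\<^sub>2 \<in> U" "x \<in> carrier K" "z \<in> carrier K"
  shows "(\<Sum>v\<in>V. cinner K (C u\<^sub>1 v (D u\<^sub>2 v x)) z) = (if u\<^sub>1 = u\<^sub>2 then cinner K x z else 0)"
proof -
  have "(\<Oplus>\<^bsub>bounded_operators K\<^esub>v\<in>V. compose (carrier K) (C u\<^sub>1 v) (D u\<^sub>2 v)) = kronecker K u\<^sub>1 u\<^sub>2"
    using family assms(1,2) by (simp add: operator_family_def D_def)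
  then have "(\<Sum>v\<in>V. cinner K (compose (carrier K) (C u\<^sub>1 v) (D u\<^sub>2 v) x) z) = cinner K (kronecker K u\<^sub>1 u\<^sub>2 x) z"
    using assms finite_V
    by (subst (asm) K.finsum_bounded_operators_eq_iff)
      (auto intro: K.compose_bounded_operators C_bounded D_bounded K.kronecker_linear)
  then show ?thesis using assms
    by (simp add: compose_eq K.kronecker_apply K.cinner_zero_left split: if_splits)
qed

text \<open>The row operator \<open>\<Gamma>\<^sub>u\<close> of the overview, from
  \<open>K\<^sup>V\<close> to \<open>K\<close>; its adjoint sends \<open>k\<close> to the family of
  all \<open>D u v k\<close>.\<close>

definition row :: "'v \<Rightarrow> ('v \<Rightarrow> 'k) \<Rightarrow> 'k" where
  "row u \<xi> = (\<Oplus>\<^bsub>K\<^esub>v\<in>V. C u v (\<xi> v))"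

lemma row_closed: "\<lbrakk>u \<in> U; \<xi> \<in> V \<rightarrow>\<^sub>E carrier K\<rbrakk> \<Longrightarrow> row u \<xi> \<in> carrier K"
  unfolding row_def by (intro K.M.finsum_closed) (auto intro: C_closed simp: power_space_component)

lemma cinner_row: "\<lbrakk>u \<in> U; \<xi> \<in> V \<rightarrow>\<^sub>E carrier K; z \<in> carrier K\<rbrakk> \<Longrightarrow>
    cinner K (row u \<xi>) z = (\<Sum>v\<in>V. cinner K (C u v (\<xi> v)) z)"
  unfolding row_def by (intro K.cinner_finsum_left) (auto intro: C_closed simp: power_space_component)

abbreviation P where "P \<equiv> matrix_family U V K C"

lemma P_linear: assumes "x \<in> U \<union> V" shows "P x \<in> linear_maps KV KV"
  unfolding matrix_family_def
proof (rule matrix_operator_linear[OF K.complex_inner_space_axioms])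
  fix v w assume vw: "v \<in> V" "w \<in> V"
  show "(if x \<in> U then adjoint K (C x v) \<otimes>\<^bsub>bounded_operators K\<^esub> C x w
      else kronecker K v x \<otimes>\<^bsub>bounded_operators K\<^esub> kronecker K w x) \<in> linear_maps K K"
    using vw C_linear D_linear[unfolded D_def]
    by (auto intro!: K.linear_maps_compose K.kronecker_linear)
qed

lemmas P_closed = linear_maps_closed[OF P_linear, simplified]

text \<open>The factorization \<open>\<Gamma>\<^sub>u\<^sup>* \<Gamma>\<^sub>u\<close>: the left
  factor of each matrix entry is independent of the column and comes out of the sum.\<close>

lemma P_U: assumes "u \<in> U" "\<xi> \<in> V \<rightarrow>\<^sub>E carrier K" "v \<in> V"
  shows "P u \<xi> v = D u v (row u \<xi>)"
proof -
  have "P u \<xi> v = (\<Oplus>\<^bsub>K\<^esub>w\<in>V. D u v (C u w (\<xi> w)))"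
    unfolding matrix_family_def matrix_operator_apply[OF assms(2,3)]
    using assms by (intro K.M.finsum_cong')
      (auto simp: compose_eq D_def[symmetric] power_space_component intro!: C_closed D_closed)
  also have "\<dots> = D u v (row u \<xi>)"
    unfolding row_def using assms
    by (intro linear_maps_finsum[symmetric] K.complex_inner_space_axioms D_linear)
      (auto simp: power_space_component intro!: C_closed)
  finally show ?thesis .
qed

lemma P_V: assumes "w \<in> V" "\<xi> \<in> V \<rightarrow>\<^sub>E carrier K" "v \<in> V"
  shows "P w \<xi> v = (if v = w then \<xi> v else \<zero>\<^bsub>K\<^esub>)"
proof -
  \<comment> \<open>\<open>matrix_family\<close> branches on membership in \<open>U\<close>;
    disjointness selects the Kronecker branch.\<close>
  have "w \<notin> U" using assms(1) disjoint by auto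
  then have "P w \<xi> v = (\<Oplus>\<^bsub>K\<^esub>v'\<in>V. if v' = w then (if v = w then \<xi> v' else \<zero>\<^bsub>K\<^esub>) else \<zero>\<^bsub>K\<^esub>)"
    unfolding matrix_family_def matrix_operator_apply[OF assms(2,3)]
    using assms by (intro K.M.finsum_cong')
      (auto simp: compose_eq power_space_component K.kronecker_apply)
  also have "\<dots> = (if v = w then \<xi> v else \<zero>\<^bsub>K\<^esub>)"
  proof (rule K.cinner_ext)
    fix z assume z: "z \<in> carrier K"
    have "cinner K (\<Oplus>\<^bsub>K\<^esub>v'\<in>V. if v' = w then (if v = w then \<xi> v' else \<zero>\<^bsub>K\<^esub>) else \<zero>\<^bsub>K\<^esub>) z
        = (\<Sum>v'\<in>V. if v' = w then cinner K (if v = w then \<xi> v' else \<zero>\<^bsub>K\<^esub>) z else 0)"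
      using assms z by (subst K.cinner_finsum_left)
        (auto simp: power_space_component K.cinner_zero_left intro!: sum.cong)
    then show "cinner K (\<Oplus>\<^bsub>K\<^esub>v'\<in>V. if v' = w then (if v = w then \<xi> v' else \<zero>\<^bsub>K\<^esub>) else \<zero>\<^bsub>K\<^esub>) z
        = cinner K (if v = w then \<xi> v else \<zero>\<^bsub>K\<^esub>) z"
      using finite_V assms by simp
  qed (use assms in \<open>auto simp: power_space_component intro!: K.M.finsum_closed\<close>)
  finally show ?thesis .
qed

lemma KV_ext:
  "\<lbrakk>\<xi> \<in> V \<rightarrow>\<^sub>E carrier K; \<eta> \<in> V \<rightarrow>\<^sub>E carrier K; \<And>v. v \<in> V \<Longrightarrow> \<xi> v = \<eta> v\<rbrakk> \<Longrightarrow> \<xi> = \<eta>"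
  by (metis PiE_ext)

text \<open>This is \<open>\<Gamma>\<^sub>u \<Gamma>\<^sub>u\<^sup>* = 1\<close>, the second sum
  relation with equal indices.\<close>

lemma row_P: assumes "u \<in> U" "\<xi> \<in> V \<rightarrow>\<^sub>E carrier K" shows "row u (P u \<xi>) = row u \<xi>"
proof (rule K.cinner_ext)
  fix z assume z: "z \<in> carrier K"
  have "P u \<xi> \<in> V \<rightarrow>\<^sub>E carrier K" using P_closed assms by blast
  then have "cinner K (row u (P u \<xi>)) z = (\<Sum>v\<in>V. cinner K (C u v (D u v (row u \<xi>))) z)"
    using assms z by (simp add: cinner_row P_U)
  then show "cinner K (row u (P u \<xi>)) z = cinner K (row u \<xi>) z"
    using assms z by (simp add: sum_CD row_closed)
qed (simp_all add: row_closed P_closed assms)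

text \<open>Symmetry is visible once the sesquilinear form is written as the inner product of the
  two rows; idempotence is \<open>row_P\<close>.\<close>

lemma projection_P_U: assumes u: "u \<in> U" shows "projection KV (P u)"
proof (rule KV.projectionI)
  have sum: "cinner KV (P u \<xi>) \<eta> = cinner K (row u \<xi>) (row u \<eta>)"
    if "\<xi> \<in> V \<rightarrow>\<^sub>E carrier K" "\<eta> \<in> V \<rightarrow>\<^sub>E carrier K" for \<xi> \<eta>
  proof -
    have "cinner KV (P u \<xi>) \<eta> = (\<Sum>v\<in>V. cinner K (row u \<xi>) (C u v (\<eta> v)))"
      using that u by (auto simp: P_U cinner_D row_closed power_space_component intro!: sum.cong)
    also have "\<dots> = cinner K (row u \<xi>) (row u \<eta>)"
      unfolding row_def[of u \<eta>] using that u
      by (intro K.cinner_finsum_right[symmetric] row_closed) (auto simp: power_space_component intro!: C_closed)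
    finally show ?thesis .
  qed
  fix \<xi> \<eta> assume x: "\<xi> \<in> carrier KV" "\<eta> \<in> carrier KV"
  have "cinner KV \<xi> (P u \<eta>) = cnj (cinner KV (P u \<eta>) \<xi>)"
    using x u P_closed by (intro KV.cinner_commute) auto
  also have "\<dots> = cnj (cinner K (row u \<eta>) (row u \<xi>))"
    using x sum by simp
  also have "\<dots> = cinner KV (P u \<xi>) \<eta>"
    using x u sum by (simp add: row_closed K.cinner_commute[of "row u \<xi>" "row u \<eta>"])
  finally show "cinner KV (P u \<xi>) \<eta> = cinner KV \<xi> (P u \<eta>)" by simp
next
  fix \<xi> assume x: "\<xi> \<in> carrier KV"
  then have "P u \<xi> \<in> V \<rightarrow>\<^sub>E carrier K" using u P_closed by simp
  then show "P u (P u \<xi>) = P u \<xi>"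
    using x u P_closed by (intro KV_ext) (auto simp: P_U row_P)
qed (use u P_linear in auto)

lemma projection_P_V: assumes w: "w \<in> V" shows "projection KV (P w)"
proof (rule KV.projectionI)
  fix \<xi> \<eta> assume x: "\<xi> \<in> carrier KV" "\<eta> \<in> carrier KV"
  then show "cinner KV (P w \<xi>) \<eta> = cinner KV \<xi> (P w \<eta>)"
    using w by (auto simp: P_V K.cinner_zero_left K.cinner_zero_right power_space_component intro!: sum.cong)
next
  fix \<xi> assume x: "\<xi> \<in> carrier KV"
  then have "P w \<xi> \<in> V \<rightarrow>\<^sub>E carrier K" using w P_closed by simp
  then show "P w (P w \<xi>) = P w \<xi>"
    using x w P_closed by (intro KV_ext) (auto simp: P_V)
qed (use w P_linear in auto)

text \<open>Expanding both matrix products and summing over \<open>U\<close> first leaves the first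
  sum relation, whose Kronecker symbol collapses the sum over columns.\<close>

lemma sum_P_U: "(\<Oplus>\<^bsub>bounded_operators KV\<^esub>u\<in>U. P u) = \<one>\<^bsub>bounded_operators KV\<^esub>"
proof (subst KV.finsum_bounded_operators_eq_iff)
  show "\<forall>\<xi>\<in>carrier KV. \<forall>\<eta>\<in>carrier KV.
      (\<Sum>u\<in>U. cinner KV (P u \<xi>) \<eta>) = cinner KV (\<one>\<^bsub>bounded_operators KV\<^esub> \<xi>) \<eta>"
  proof (intro ballI)
    fix \<xi> \<eta> assume "\<xi> \<in> carrier KV" "\<eta> \<in> carrier KV"
    then have x: "\<xi> \<in> V \<rightarrow>\<^sub>E carrier K" "\<eta> \<in> V \<rightarrow>\<^sub>E carrier K" by auto
    have "(\<Sum>u\<in>U. cinner KV (P u \<xi>) \<eta>) = (\<Sum>v\<in>V. \<Sum>u\<in>U. cinner K (P u \<xi> v) (\<eta> v))"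
      by (simp add: sum.swap[of _ U V])
    also have "\<dots> = (\<Sum>v\<in>V. cinner K (\<xi> v) (\<eta> v))"
    proof (rule sum.cong[OF refl])
      fix v assume v: "v \<in> V"
      note \<eta>v = power_space_component[OF x(2) v]
      have "(\<Sum>u\<in>U. cinner K (P u \<xi> v) (\<eta> v))
          = (\<Sum>u\<in>U. \<Sum>w\<in>V. cinner K (D u v (C u w (\<xi> w))) (\<eta> v))"
        using x v \<eta>v by (intro sum.cong refl)
          (auto simp: P_U cinner_D cinner_row row_closed C_closed power_space_component)
      also have "\<dots> = (\<Sum>w\<in>V. \<Sum>u\<in>U. cinner K (D u v (C u w (\<xi> w))) (\<eta> v))"
        by (rule sum.swap)
      also have "\<dots> = (\<Sum>w\<in>V. if v = w then cinner K (\<xi> w) (\<eta> v) else 0)"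
        using x v \<eta>v by (intro sum.cong refl sum_DC) (auto simp: power_space_component)
      also have "\<dots> = cinner K (\<xi> v) (\<eta> v)" using v finite_V by simp
      finally show "(\<Sum>u\<in>U. cinner K (P u \<xi> v) (\<eta> v)) = cinner K (\<xi> v) (\<eta> v)" .
    qed
    finally show "(\<Sum>u\<in>U. cinner KV (P u \<xi>) \<eta>) = cinner KV (\<one>\<^bsub>bounded_operators KV\<^esub> \<xi>) \<eta>"
      using x by simp
  qed
qed (use finite_U projection_P_U KV.bounded_operators_linear[OF KV.one_bounded_operators]
    in \<open>auto simp: projection_def\<close>)

lemma sum_P_V: "(\<Oplus>\<^bsub>bounded_operators KV\<^esub>w\<in>V. P w) = \<one>\<^bsub>bounded_operators KV\<^esub>"
proof (subst KV.finsum_bounded_operators_eq_iff)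
  show "\<forall>\<xi>\<in>carrier KV. \<forall>\<eta>\<in>carrier KV.
      (\<Sum>w\<in>V. cinner KV (P w \<xi>) \<eta>) = cinner KV (\<one>\<^bsub>bounded_operators KV\<^esub> \<xi>) \<eta>"
  proof (intro ballI)
    fix \<xi> \<eta> assume "\<xi> \<in> carrier KV" "\<eta> \<in> carrier KV"
    then have x: "\<xi> \<in> V \<rightarrow>\<^sub>E carrier K" "\<eta> \<in> V \<rightarrow>\<^sub>E carrier K" by auto
    have "(\<Sum>w\<in>V. cinner KV (P w \<xi>) \<eta>)
        = (\<Sum>w\<in>V. \<Sum>v\<in>V. if v = w then cinner K (\<xi> v) (\<eta> v) else 0)"
      using x by (auto simp: P_V K.cinner_zero_left power_space_component intro!: sum.cong)
    also have "\<dots> = (\<Sum>w\<in>V. cinner K (\<xi> w) (\<eta> w))" using finite_V by simp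
    finally show "(\<Sum>w\<in>V. cinner KV (P w \<xi>) \<eta>) = cinner KV (\<one>\<^bsub>bounded_operators KV\<^esub> \<xi>) \<eta>"
      using x by simp
  qed
qed (use finite_V projection_P_V KV.bounded_operators_linear[OF KV.one_bounded_operators]
    in \<open>auto simp: projection_def\<close>)

text \<open>\<open>P v \<xi>\<close> is supported at the component \<open>v\<close>, where row
  \<open>u\<close> has the entry zero.\<close>

lemma P_nonadjacent:
  assumes uv: "u \<in> U" "v \<in> V" "{u, v} \<notin> E"
  shows "P u \<otimes>\<^bsub>bounded_operators KV\<^esub> P v = \<zero>\<^bsub>bounded_operators KV\<^esub>"
  unfolding KV.bounded_operators_mult KV.bounded_operators_zero compose_def
proof (rule restrict_ext)
  fix \<xi> assume "\<xi> \<in> carrier KV"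
  then have x: "\<xi> \<in> V \<rightarrow>\<^sub>E carrier K" by simp
  have Pv: "P v \<xi> \<in> V \<rightarrow>\<^sub>E carrier K" using P_closed uv x by blast
  have zero: "C u v y = \<zero>\<^bsub>K\<^esub>" if "y \<in> carrier K" for y
    using family uv that by (simp add: operator_family_def)
  have C0: "C u w \<zero>\<^bsub>K\<^esub> = \<zero>\<^bsub>K\<^esub>" if "w \<in> V" for w
    using linear_maps_zero[OF K.complex_inner_space_axioms K.complex_inner_space_axioms C_linear] uv(1) that by blast
  have D0: "D u w \<zero>\<^bsub>K\<^esub> = \<zero>\<^bsub>K\<^esub>" if "w \<in> V" for w
    using linear_maps_zero[OF K.complex_inner_space_axioms K.complex_inner_space_axioms D_linear] uv(1) that by blast
  have "row u (P v \<xi>) = \<zero>\<^bsub>K\<^esub>"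
  proof (rule K.cinner_ext)
    fix z assume z: "z \<in> carrier K"
    have "cinner K (C u w (P v \<xi> w)) z = 0" if w: "w \<in> V" for w
      using uv w x z zero C0 by (simp add: P_V power_space_component K.cinner_zero_left)
    then show "cinner K (row u (P v \<xi>)) z = cinner K \<zero>\<^bsub>K\<^esub> z"
      using uv Pv z by (simp add: cinner_row K.cinner_zero_left)
  qed (use uv Pv row_closed in auto)
  then show "P u (P v \<xi>) = \<zero>\<^bsub>KV\<^esub>"
    using P_closed[of u "P v \<xi>"] uv Pv D0 by (intro KV_ext) (auto simp: P_U)
qed

lemma projection_family_P: "projection_family U V E KV P"
  using projection_P_U projection_P_V sum_P_U sum_P_V P_nonadjacent
  unfolding projection_family_def by blast

end

section \<open>The sign of an injective symmetric contraction\<close>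

text \<open>A cone closed under sums and products whose members send positive operators to positive
  operators.\<close>

definition nonneg_coeffs :: "real poly \<Rightarrow> bool" where
  "nonneg_coeffs p \<longleftrightarrow> (\<forall>i. coeff p i \<ge> 0)"

lemma nonneg_coeffs_add: "\<lbrakk>nonneg_coeffs p; nonneg_coeffs q\<rbrakk> \<Longrightarrow> nonneg_coeffs (p + q)"
  by (simp add: nonneg_coeffs_def)

lemma nonneg_coeffs_mult: "\<lbrakk>nonneg_coeffs p; nonneg_coeffs q\<rbrakk> \<Longrightarrow> nonneg_coeffs (p * q)"
  by (simp add: nonneg_coeffs_def coeff_mult sum_nonneg)

lemma nonneg_coeffs_smult: "\<lbrakk>c \<ge> 0; nonneg_coeffs p\<rbrakk> \<Longrightarrow> nonneg_coeffs (Polynomial.smult c p)"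
  by (simp add: nonneg_coeffs_def)

lemma nonneg_coeffs_pCons: "nonneg_coeffs (pCons a p) \<longleftrightarrow> a \<ge> 0 \<and> nonneg_coeffs p"
  by (auto simp: nonneg_coeffs_def coeff_pCons split: nat.splits)

lemma nonneg_coeffs_0: "nonneg_coeffs 0"
  by (simp add: nonneg_coeffs_def)

lemma nonneg_coeffs_1: "nonneg_coeffs 1"
  by (simp add: one_pCons nonneg_coeffs_pCons nonneg_coeffs_0)

text \<open>With \<open>s = 1 - x\<^sup>2\<close>, the Newton--Schulz iteration \<open>x\<^sub>n\<^sub>+\<^sub>1 = x\<^sub>n (3 - x\<^sub>n\<^sup>2) / 2\<close> for the sign
  of \<open>x\<close> takes the form \<open>x\<^sub>n = x g\<^sub>n(s)\<close> and \<open>1 - x\<^sub>n\<^sup>2 = e\<^sub>n(s)\<close>, where the polynomials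
  \<open>g\<^sub>n\<close> and \<open>e\<^sub>n\<close> have nonnegative coefficients.\<close>

primrec sign_error :: "nat \<Rightarrow> real poly" where
  "sign_error 0 = [:0, 1:]"
| "sign_error (Suc n) = Polynomial.smult (1/4) (sign_error n * sign_error n * ([:3:] + sign_error n))"

primrec sign_factor :: "nat \<Rightarrow> real poly" where
  "sign_factor 0 = 1"
| "sign_factor (Suc n) = sign_factor n + Polynomial.smult (1/2) (sign_factor n * sign_error n)"

lemma nonneg_coeffs_sign_error: "nonneg_coeffs (sign_error n)"
  by (induction n) (auto intro!: nonneg_coeffs_smult nonneg_coeffs_mult nonneg_coeffs_add
      simp: nonneg_coeffs_pCons nonneg_coeffs_0)

lemma nonneg_coeffs_sign_factor: "nonneg_coeffs (sign_factor n)"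
  by (induction n) (auto intro!: nonneg_coeffs_smult nonneg_coeffs_mult nonneg_coeffs_add
      nonneg_coeffs_sign_error nonneg_coeffs_1)

text \<open>Each step of the recursion adds a product of polynomials with nonnegative coefficients.
  This makes the iteration monotone.\<close>

lemma nonneg_coeffs_sign_factor_diff:
  assumes "n \<le> m" shows "nonneg_coeffs (sign_factor m - sign_factor n)"
  using assms
proof (induction m rule: dec_induct)
  case base
  then show ?case by (simp add: nonneg_coeffs_0)
next
  case (step m)
  have eq: "sign_factor (Suc m) - sign_factor n
      = (sign_factor m - sign_factor n) + Polynomial.smult (1/2) (sign_factor m * sign_error m)"
    by simp
  show ?case unfolding eq
    by (intro nonneg_coeffs_add nonneg_coeffs_smult nonneg_coeffs_mult step.IH
        nonneg_coeffs_sign_error nonneg_coeffs_sign_factor) simp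
qed

text \<open>The relation between iterate and error: \<open>1 - s\<close> stands for the square of
  \<open>x\<close>, so the left side is the square of the n-th iterate. It is proved for values and
  lifted to polynomials.\<close>

lemma sign_factor_square:
  "[:1, -1:] * (sign_factor n * sign_factor n) = 1 - sign_error n"
proof -
  have "(1 - s) * (poly (sign_factor n) s * poly (sign_factor n) s) = 1 - poly (sign_error n) s" for s
  proof (induction n)
    case (Suc n)
    let ?g = "poly (sign_factor n) s" and ?e = "poly (sign_error n) s"
    have "(1 - s) * (poly (sign_factor (Suc n)) s * poly (sign_factor (Suc n)) s)
        = ((1 - s) * (?g * ?g)) * ((1 + ?e / 2) * (1 + ?e / 2))"
      by (simp add: field_simps)
    \<comment> \<open>With \<open>e\<close> for the error,
      \<open>(1 - e) (1 + e/2)^2 = 1 - e^2 (3 + e) / 4\<close>; this is the origin of the recursion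
      for \<open>sign_error\<close>.\<close>
    also have "\<dots> = 1 - poly (sign_error (Suc n)) s"
      unfolding Suc.IH by (simp add: field_simps)
    finally show ?case .
  qed simp
  then have "poly ([:1, -1:] * (sign_factor n * sign_factor n)) = poly (1 - sign_error n)"
    by (intro ext) (simp add: algebra_simps)
  then show ?thesis by (simp only: poly_eq_poly_eq_iff)
qed

text \<open>Contractivity makes \<open>1 - A\<^sup>2\<close> positive, which drives the convergence;
  injectivity excludes a kernel, on which the sign would vanish.\<close>

locale injective_symmetric_contraction = complex_hilbert_space +
  fixes A
  assumes A_linear: "A \<in> linear_maps H H"
    and A_symmetric: "\<lbrakk>x \<in> carrier H; y \<in> carrier H\<rbrakk> \<Longrightarrow> cinner H (A x) y = cinner H x (A y)"
    and A_contraction: "x \<in> carrier H \<Longrightarrow> hnorm H (A x) \<le> hnorm H x"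
    and A_injective: "\<lbrakk>x \<in> carrier H; A x = \<zero>\<rbrakk> \<Longrightarrow> x = \<zero>"
begin

lemmas A_closed = linear_maps_closed[OF A_linear]
lemmas A_add = linear_maps_add[OF A_linear]
lemmas A_smult = linear_maps_smult[OF A_linear]
lemmas A_minus = linear_maps_minus[OF complex_inner_space_axioms complex_inner_space_axioms A_linear]

text \<open>The operator \<open>1 - A\<^sup>2\<close>, substituted for the variable \<open>s\<close>
  of the polynomials.\<close>

definition S where
  "S = (\<lambda>x\<in>carrier H. x \<ominus> A (A x))"

lemma cinner_S: "\<lbrakk>x \<in> carrier H; y \<in> carrier H\<rbrakk> \<Longrightarrow> cinner H (S x) y = cinner H x y - cinner H (A x) (A y)"
  by (simp add: S_def A_closed cinner_minus_left A_symmetric)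

lemma S_closed: "x \<in> carrier H \<Longrightarrow> S x \<in> carrier H"
  by (simp add: S_def A_closed)

lemma S_linear: "S \<in> linear_maps H H"
proof (rule linear_mapsI)
  fix x y a assume xy: "x \<in> carrier H" "y \<in> carrier H"
  show "S (x \<oplus> y) = S x \<oplus> S y"
    by (rule cinner_ext) (use xy in \<open>auto simp: S_closed cinner_S A_closed A_add cinner_simps\<close>)
  show "S (a \<odot> x) = a \<odot> S x"
    by (rule cinner_ext) (use xy in \<open>auto simp: S_closed cinner_S A_closed A_smult cinner_simps algebra_simps\<close>)
qed (auto simp: S_closed, simp add: S_def)

lemmas S_add = linear_maps_add[OF S_linear]
lemmas S_smult = linear_maps_smult[OF S_linear]

lemma S_symmetric: "\<lbrakk>x \<in> carrier H; y \<in> carrier H\<rbrakk> \<Longrightarrow> cinner H (S x) y = cinner H x (S y)"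
  by (simp add: S_def A_closed cinner_minus_left cinner_minus_right A_symmetric)

lemma S_zero: "S \<zero> = \<zero>"
  by (rule linear_maps_zero[OF complex_inner_space_axioms complex_inner_space_axioms S_linear])

text \<open>\<open>pev p x\<close> is \<open>p(S) x\<close>, evaluated by the Horner scheme.\<close>

definition pev :: "real poly \<Rightarrow> 'a \<Rightarrow> 'a" where
  "pev p x = fold_coeffs (\<lambda>a y. of_real a \<odot> x \<oplus> S y) p \<zero>"

lemma pev_0 [simp]: "pev 0 x = \<zero>"
  by (simp add: pev_def)

lemma pev_pCons: "x \<in> carrier H \<Longrightarrow> pev (pCons a p) x = of_real a \<odot> x \<oplus> S (pev p x)"
  \<comment> \<open>\<open>pCons 0 0\<close> collapses to the zero polynomial, where no Horner step
    is executed; \<open>S_zero\<close> makes the value agree.\<close>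
  by (cases "a = 0 \<and> p = 0") (auto simp: pev_def S_zero)

lemma pev_closed: "x \<in> carrier H \<Longrightarrow> pev p x \<in> carrier H"
  by (induction p) (auto simp: pev_pCons S_closed)

lemma pev_add: "x \<in> carrier H \<Longrightarrow> pev (p + q) x = pev p x \<oplus> pev q x"
proof (induction p q rule: poly_induct2)
  case (pCons a p b q)
  then show ?case
    by (intro cinner_ext) (auto simp: pev_pCons pev_closed S_closed S_add cinner_simps algebra_simps)
qed auto

lemma pev_smult: "x \<in> carrier H \<Longrightarrow> pev (Polynomial.smult c p) x = of_real c \<odot> pev p x"
proof (induction p)
  case (pCons a p)
  then show ?case
    by (intro cinner_ext) (auto simp: pev_pCons pev_closed S_closed S_smult cinner_simps algebra_simps)
qed auto

lemma pev_diff: "x \<in> carrier H \<Longrightarrow> pev (p - q) x = pev p x \<ominus> pev q x"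
  using pev_add[of x p "- q"] pev_smult[of x "- 1" q] by (simp add: M.minus_eq minus_eq_smult pev_closed)

lemma pev_1: "x \<in> carrier H \<Longrightarrow> pev 1 x = x"
  using smult_one[of x] by (simp add: one_pCons pev_pCons S_zero)

lemma pev_mult: "x \<in> carrier H \<Longrightarrow> pev (p * q) x = pev p (pev q x)"
proof (induction p)
  case (pCons a p)
  then show ?case by (simp add: pev_add pev_smult pev_pCons pev_closed S_closed mult_pCons_left)
qed auto

lemma pev_commute:
  assumes "T \<in> linear_maps H H" "\<And>x. x \<in> carrier H \<Longrightarrow> T (S x) = S (T x)" "x \<in> carrier H"
  shows "T (pev p x) = pev p (T x)"
proof (induction p)
  case 0
  then show ?case
    using linear_maps_zero[OF complex_inner_space_axioms complex_inner_space_axioms assms(1)] by simp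
next
  case (pCons a p)
  then show ?case using assms linear_maps_closed[OF assms(1)]
    by (simp add: pev_pCons pev_closed S_closed linear_maps_add[OF assms(1)] linear_maps_smult[OF assms(1)])
qed

lemma pev_A: "x \<in> carrier H \<Longrightarrow> A (pev p x) = pev p (A x)"
  by (rule pev_commute[OF A_linear]) (auto simp: S_def A_closed A_minus)

lemma pev_symmetric: "\<lbrakk>x \<in> carrier H; y \<in> carrier H\<rbrakk> \<Longrightarrow> cinner H (pev p x) y = cinner H x (pev p y)"
proof (induction p arbitrary: x y)
  case (pCons a p)
  then show ?case
    by (simp add: pev_pCons pev_closed S_closed cinner_simps S_symmetric pev_commute[OF S_linear refl])
qed (simp add: cinner_zero_left cinner_zero_right)

text \<open>Even powers of \<open>S\<close> are squares, and odd ones have the form \<open>B S B\<close>.\<close>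

lemma S_power_nonneg: "x \<in> carrier H \<Longrightarrow> (S ^^ k) x \<in> carrier H \<and> Re (cinner H x ((S ^^ k) x)) \<ge> 0"
proof (induction k arbitrary: x rule: nat_induct2)
  case 0
  then show ?case by (simp add: cinner_nonneg)
next
  case 1
  have "(hnorm H (A x))\<^sup>2 \<le> (hnorm H x)\<^sup>2"
    using A_contraction[OF 1] hnorm_nonneg[OF A_closed[OF 1]] by (rule power_mono)
  then show ?case
    using 1 by (simp add: S_closed cinner_S A_closed Re_cinner_self flip: S_symmetric)
next
  case (step k)
  have "(S ^^ (k + 2)) x = S ((S ^^ k) (S x))"
    by (simp add: funpow_swap1)
  then show ?case
    using step.IH[OF S_closed[OF step.prems]] step.prems by (simp add: S_closed flip: S_symmetric)
qed

lemma pev_nonneg: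
  assumes "nonneg_coeffs p" "x \<in> carrier H"
  shows "Re (cinner H (pev p x) x) \<ge> 0"
proof -
  \<comment> \<open>Generalized over \<open>k\<close>, because each Horner step leaves an extra
    \<open>S\<close> that symmetry moves to the second argument.\<close>
  have "Re (cinner H (pev p x) ((S ^^ k) x)) \<ge> 0" for k
    using assms(1)
  proof (induction p arbitrary: k)
    case (pCons a p)
    note k = S_power_nonneg[OF assms(2), of k]
    have "Re (cinner H (pev p x) ((S ^^ Suc k) x)) \<ge> 0"
      using pCons by (intro pCons.IH) (simp add: nonneg_coeffs_pCons)
    then show ?case
      using assms(2) pCons.prems k
      by (simp add: pev_pCons pev_closed S_closed cinner_simps S_symmetric nonneg_coeffs_pCons)
  qed (use assms(2) S_power_nonneg in \<open>auto simp: cinner_zero_left\<close>)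
  from this[of 0] show ?thesis by simp
qed

lemma pev_A_A: "x \<in> carrier H \<Longrightarrow> pev [:1, -1:] x = A (A x)"
  by (rule cinner_ext)
    (auto simp: pev_pCons pev_closed S_closed S_zero A_closed cinner_simps cinner_S A_symmetric S_smult)

text \<open>Since \<open>[:1, -1:]\<close> evaluates to the square of \<open>A\<close>, inner
  products of iterates reduce to one polynomial in \<open>S\<close>, and polynomial identities
  become identities between norms.\<close>

lemma cinner_A_pev:
  "\<lbrakk>x \<in> carrier H; y \<in> carrier H\<rbrakk> \<Longrightarrow>
    cinner H (A (pev p x)) (A (pev q y)) = cinner H (pev ([:1, -1:] * (q * p)) x) y"
  unfolding pev_mult[of x "[:1, -1:]"]
  by (simp add: pev_A_A pev_mult pev_closed A_closed A_symmetric pev_symmetric pev_A)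

text \<open>\<open>[:1, -1:]\<close> lies outside the cone \<open>nonneg_coeffs\<close>; positivity
  comes from moving one \<open>A\<close> to each side of \<open>p(S)\<close>.\<close>

lemma A_A_pev_nonneg:
  assumes "nonneg_coeffs p" "x \<in> carrier H"
  shows "Re (cinner H (pev ([:1, -1:] * p) x) x) \<ge> 0"
proof -
  have "cinner H (pev ([:1, -1:] * p) x) x = cinner H (pev p (A x)) (A x)"
    using assms(2) cinner_A_pev[of x x p 1] by (simp add: pev_1 pev_A)
  then show ?thesis using pev_nonneg[OF assms(1) A_closed[OF assms(2)]] by simp
qed

section \<open>Strong convergence of the Newton--Schulz iterates\<close>

definition X :: "nat \<Rightarrow> 'a \<Rightarrow> 'a" where
  "X n x = A (pev (sign_factor n) x)"

lemma X_closed: "x \<in> carrier H \<Longrightarrow> X n x \<in> carrier H"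
  by (simp add: X_def A_closed pev_closed)

lemma X_symmetric: "\<lbrakk>x \<in> carrier H; y \<in> carrier H\<rbrakk> \<Longrightarrow> cinner H (X n x) y = cinner H x (X n y)"
  by (simp add: X_def A_symmetric pev_closed pev_symmetric A_closed pev_A)

lemma cinner_X_X:
  "\<lbrakk>x \<in> carrier H; y \<in> carrier H\<rbrakk> \<Longrightarrow>
    cinner H (X n x) (X n y) = cinner H x y - cinner H (pev (sign_error n) x) y"
  by (simp only: X_def cinner_A_pev sign_factor_square pev_diff pev_1 pev_closed cinner_minus_left)

text \<open>With \<open>g\<close> and \<open>h\<close> for the factors of the iterates
  \<open>m\<close> and \<open>n\<close>, write
  \<open>g\<^sup>2 = h\<^sup>2 + (g - h)\<^sup>2 + 2 h (g - h)\<close>. The cross term is positive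
  after multiplication by the square of \<open>A\<close>, as \<open>h\<close> and
  \<open>g - h\<close> have nonnegative coefficients.\<close>

lemma X_diff_le:
  assumes "n \<le> m" "x \<in> carrier H"
  shows "(hnorm H (X m x \<ominus> X n x))\<^sup>2 \<le> Re (cinner H (X m x) (X m x)) - Re (cinner H (X n x) (X n x))"
proof -
  let ?g = "sign_factor m" and ?h = "sign_factor n"
  let ?q = "?g - ?h"
  let ?w = "[:1, -1:] :: real poly"
  have "X m x \<ominus> X n x = A (pev ?q x)"
    using assms(2) by (simp add: X_def pev_diff A_minus pev_closed)
  then have "(hnorm H (X m x \<ominus> X n x))\<^sup>2 = Re (cinner H (A (pev ?q x)) (A (pev ?q x)))"
    using assms(2) by (simp add: Re_cinner_self A_closed pev_closed)
  also have "\<dots> = Re (cinner H (pev (?w * (?q * ?q)) x) x)"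
    using assms(2) by (simp only: cinner_A_pev)
  finally have 1: "(hnorm H (X m x \<ominus> X n x))\<^sup>2 = Re (cinner H (pev (?w * (?q * ?q)) x) x)" .
  have "nonneg_coeffs (?h * ?q + ?h * ?q)"
    by (intro nonneg_coeffs_add nonneg_coeffs_mult nonneg_coeffs_sign_factor
        nonneg_coeffs_sign_factor_diff assms(1))
  then have 2: "0 \<le> Re (cinner H (pev (?w * (?h * ?q + ?h * ?q)) x) x)"
    using assms(2) by (rule A_A_pev_nonneg)
  have "w * (g * g) = w * (h * h) + (w * ((g - h) * (g - h)) + w * (h * (g - h) + h * (g - h)))"
    for w g h :: "real poly" by (simp add: algebra_simps)
  then have "?w * (?g * ?g) = ?w * (?h * ?h) + (?w * (?q * ?q) + ?w * (?h * ?q + ?h * ?q))" .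
  then have "cinner H (pev (?w * (?g * ?g)) x) x = cinner H (pev (?w * (?h * ?h)) x) x
      + (cinner H (pev (?w * (?q * ?q)) x) x + cinner H (pev (?w * (?h * ?q + ?h * ?q)) x) x)"
    using assms(2) by (simp only: pev_add pev_closed cinner_add_left M.a_closed)
  then have "Re (cinner H (X m x) (X m x)) = Re (cinner H (X n x) (X n x))
      + (Re (cinner H (pev (?w * (?q * ?q)) x) x) + Re (cinner H (pev (?w * (?h * ?q + ?h * ?q)) x) x))"
    using assms(2) by (simp only: X_def cinner_A_pev plus_complex.sel)
  with 1 2 show ?thesis by simp
qed

lemma X_mono:
  assumes "n \<le> m" "x \<in> carrier H"
  shows "Re (cinner H (X n x) (X n x)) \<le> Re (cinner H (X m x) (X m x))"
proof -
  have "0 \<le> (hnorm H (X m x \<ominus> X n x))\<^sup>2" by simp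
  with X_diff_le[OF assms] show ?thesis by linarith
qed

text \<open>The squared norms increase and are bounded by that of \<open>x\<close>, because the
  error polynomial is positive. Their convergence makes the vectors Cauchy through
  \<open>X_diff_le\<close>.\<close>

lemma X_converges:
  assumes x: "x \<in> carrier H"
  shows "\<exists>y\<in>carrier H. (\<lambda>n. hnorm H (X n x \<ominus> y)) \<longlonglongrightarrow> 0"
proof -
  let ?a = "\<lambda>n. Re (cinner H (X n x) (X n x))"
  have "?a n \<le> Re (cinner H x x)" for n
    using pev_nonneg[OF nonneg_coeffs_sign_error x, of n] by (simp add: cinner_X_X x)
  moreover have "incseq ?a" using X_mono[OF _ x] by (auto simp: incseq_def)
  ultimately obtain L where "?a \<longlonglongrightarrow> L"
    using incseq_convergent[of ?a "Re (cinner H x x)"] by metis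
  then have "convergent ?a" by (auto simp: convergent_def)
  then have "Cauchy ?a" by (rule convergent_Cauchy)
  have cauchy: "\<exists>N. \<forall>m\<ge>N. \<forall>n\<ge>N. hnorm H (X m x \<ominus> X n x) < e" if e: "e > 0" for e
  proof -
    obtain N where N: "\<And>m n. m \<ge> N \<Longrightarrow> n \<ge> N \<Longrightarrow> \<bar>?a m - ?a n\<bar> < e\<^sup>2"
      using \<open>Cauchy ?a\<close> e unfolding Cauchy_def dist_real_def by (metis zero_less_power)
    have le: "hnorm H (X m x \<ominus> X n x) < e" if "n \<le> m" "n \<ge> N" for m n
    proof (rule power_less_imp_less_base[OF _ less_imp_le[OF e]])
      show "(hnorm H (X m x \<ominus> X n x))\<^sup>2 < e\<^sup>2"
        using X_diff_le[OF that(1) x] N[of m n] that by linarith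
    qed
    have "hnorm H (X m x \<ominus> X n x) < e" if "m \<ge> N" "n \<ge> N" for m n
      using le[of n m] le[of m n] that hnorm_minus_commute[OF X_closed[OF x] X_closed[OF x], of m n]
      by (cases "n \<le> m") auto
    then show ?thesis by blast
  qed
  show ?thesis
    by (rule convergentI[of "\<lambda>n. X n x"]) (use X_closed[OF x] cauchy in auto)
qed

section \<open>The sign operator as the pointwise limit of the iterates\<close>

definition J :: "'a \<Rightarrow> 'a" where
  "J = (\<lambda>x\<in>carrier H. SOME y. y \<in> carrier H \<and> (\<lambda>n. hnorm H (X n x \<ominus> y)) \<longlonglongrightarrow> 0)"

lemma J: assumes "x \<in> carrier H"
  shows J_closed: "J x \<in> carrier H" and J_limit: "(\<lambda>n. hnorm H (X n x \<ominus> J x)) \<longlonglongrightarrow> 0"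
  using someI_ex[of "\<lambda>y. y \<in> carrier H \<and> (\<lambda>n. hnorm H (X n x \<ominus> y)) \<longlonglongrightarrow> 0"] X_converges[OF assms] assms
  by (auto simp: J_def)

lemma cinner_J_limit:
  "\<lbrakk>x \<in> carrier H; y \<in> carrier H\<rbrakk> \<Longrightarrow> (\<lambda>n. cinner H (X n x) y) \<longlonglongrightarrow> cinner H (J x) y"
  by (intro tendsto_cinner_left X_closed J)

lemma J_symmetric:
  assumes "x \<in> carrier H" "y \<in> carrier H" shows "cinner H (J x) y = cinner H x (J y)"
proof (rule LIMSEQ_unique)
  show "(\<lambda>n. cinner H (X n x) y) \<longlonglongrightarrow> cinner H (J x) y" using assms by (rule cinner_J_limit)
  have "(\<lambda>n. cnj (cinner H (X n y) x)) \<longlonglongrightarrow> cnj (cinner H (J y) x)"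
    by (intro tendsto_cnj cinner_J_limit assms)
  then show "(\<lambda>n. cinner H (X n x) y) \<longlonglongrightarrow> cinner H x (J y)"
    using assms by (simp add: X_symmetric X_closed J_closed flip: cinner_commute)
qed

text \<open>A symmetric map defined everywhere is linear: move it to the other side of the inner
  product and test.\<close>

lemma J_linear: "J \<in> linear_maps H H"
proof (rule linear_mapsI)
  fix x y a assume xy: "x \<in> carrier H" "y \<in> carrier H"
  show "J (x \<oplus> y) = J x \<oplus> J y"
    by (rule cinner_ext) (use xy in \<open>auto simp: J_closed J_symmetric cinner_add_left\<close>)
  show "J (a \<odot> x) = a \<odot> J x"
    by (rule cinner_ext) (use xy in \<open>auto simp: J_closed J_symmetric cinner_smult_left\<close>)
qed (auto simp: J_closed, simp add: J_def)

text \<open>The two exchange relations make \<open>B\<close> commute with the square of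
  \<open>A\<close>, hence with every polynomial in \<open>S\<close>. The single remaining factor
  \<open>A\<close> of an iterate turns \<open>B\<close> into \<open>B'\<close>.\<close>

lemma J_intertwines:
  assumes lin: "B \<in> linear_maps H H" "B' \<in> linear_maps H H"
    and sym: "\<And>x y. \<lbrakk>x \<in> carrier H; y \<in> carrier H\<rbrakk> \<Longrightarrow> cinner H (B' x) y = cinner H x (B' y)"
    and AB: "\<And>x. x \<in> carrier H \<Longrightarrow> A (B x) = B' (A x)"
    and AB': "\<And>x. x \<in> carrier H \<Longrightarrow> A (B' x) = B (A x)"
    and x: "x \<in> carrier H"
  shows "J (B x) = B' (J x)"
proof (rule cinner_ext)
  note cl = linear_maps_closed[OF lin(1)] linear_maps_closed[OF lin(2)]
  note minus = linear_maps_minus[OF complex_inner_space_axioms complex_inner_space_axioms lin(1)]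
  have "B (S y) = S (B y)" if "y \<in> carrier H" for y
    using that by (simp add: S_def AB AB' cl A_closed minus)
  then have "B (pev p x) = pev p (B x)" for p
    by (rule pev_commute[OF lin(1) _ x])
  then have XB: "X n (B x) = B' (X n x)" for n
    using AB[of "pev (sign_factor n) x"] x by (simp add: X_def pev_closed)
  show "cinner H (J (B x)) z = cinner H (B' (J x)) z" if z: "z \<in> carrier H" for z
  proof (rule LIMSEQ_unique)
    show "(\<lambda>n. cinner H (X n (B x)) z) \<longlonglongrightarrow> cinner H (J (B x)) z"
      by (intro cinner_J_limit cl x z)
    have "(\<lambda>n. cinner H (X n x) (B' z)) \<longlonglongrightarrow> cinner H (J x) (B' z)"
      by (intro cinner_J_limit cl x z)
    then show "(\<lambda>n. cinner H (X n (B x)) z) \<longlonglongrightarrow> cinner H (B' (J x)) z"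
      using x z by (simp add: XB sym X_closed J_closed)
  qed
qed (use x lin linear_maps_closed J_closed in metis)+

text \<open>Monotonicity bounds the norm of \<open>A\<close> at the error vector by that of the n-th
  iterate there, which is twice an increment of the convergent sequence of iterates at
  \<open>x\<close>.\<close>

lemma A_error_tendsto_0:
  assumes x: "x \<in> carrier H"
  shows "(\<lambda>n. hnorm H (A (pev (sign_error n) x))) \<longlonglongrightarrow> 0"
proof -
  let ?b = "\<lambda>n. 2 * (hnorm H (X (Suc n) x \<ominus> J x) + hnorm H (X n x \<ominus> J x))"
  have "hnorm H (A (pev (sign_error n) x)) \<le> ?b n" for n
  proof -
    let ?y = "pev (sign_error n) x"
    have y: "?y \<in> carrier H" by (simp add: pev_closed x)
    have "X 0 ?y = A ?y" by (simp add: X_def pev_1 y)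
    then have "(hnorm H (A ?y))\<^sup>2 \<le> (hnorm H (X n ?y))\<^sup>2"
      using X_mono[OF le0 y, of n] by (simp add: Re_cinner_self X_closed A_closed y)
    then have "hnorm H (A ?y) \<le> hnorm H (X n ?y)"
      by (rule power2_le_imp_le) (simp add: hnorm_nonneg X_closed y)
    \<comment> \<open>The recursion for \<open>sign_factor\<close> adds half of factor times error;
      the factor 2 undoes this.\<close>
    also have "X n ?y = 2 \<odot> (X (Suc n) x \<ominus> X n x)"
      by (rule cinner_ext)
        (use x in \<open>auto simp: X_def pev_add pev_smult pev_mult pev_closed A_closed A_add A_smult cinner_simps\<close>)
    also have "hnorm H \<dots> = 2 * hnorm H (X (Suc n) x \<ominus> X n x)"
      using x by (simp add: hnorm_smult X_closed)
    also have "\<dots> \<le> ?b n"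
      using hnorm_diff_le[of "X (Suc n) x" "J x" "X n x"] hnorm_minus_commute[of "J x" "X n x"] x
      by (simp add: X_closed J_closed)
    finally show ?thesis .
  qed
  moreover have "?b \<longlonglongrightarrow> 2 * (0 + 0)"
    by (intro tendsto_intros J_limit x LIMSEQ_Suc[OF J_limit])
  ultimately show ?thesis
    using hnorm_nonneg[OF A_closed[OF pev_closed[OF x]]]
    by (auto intro: Lim_null_comparison[of _ ?b])
qed

text \<open>The defect \<open>y\<close> of the involution satisfies \<open>A y = \<zero>\<close>, so
  injectivity finishes.\<close>

lemma J_involution: assumes x: "x \<in> carrier H" shows "J (J x) = x"
proof -
  define y where "y = x \<ominus> J (J x)"
  have y: "y \<in> carrier H" by (simp add: y_def x J_closed)
  have "cinner H (A y) z = cinner H \<zero> z" if z: "z \<in> carrier H" for z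
  proof -
    \<comment> \<open>The test vector has the form \<open>A z\<close> because the error is known to
      vanish in the limit only after \<open>A\<close> is applied; symmetry moves that
      \<open>A\<close> onto the error vector.\<close>
    let ?w = "A z"
    have w: "?w \<in> carrier H" using z by (rule A_closed)
    have "(\<lambda>n. cinner H (X n x) (X n ?w)) \<longlonglongrightarrow> cinner H (J x) (J ?w)"
      by (intro tendsto_cinner X_closed J x w)
    then have "(\<lambda>n. cinner H x ?w - cinner H (X n x) (X n ?w)) \<longlonglongrightarrow> cinner H x ?w - cinner H (J x) (J ?w)"
      by (intro tendsto_intros)
    moreover have "cinner H x ?w - cinner H (X n x) (X n ?w) = cinner H (A (pev (sign_error n) x)) z" for n
      using x z by (simp add: cinner_X_X w A_symmetric pev_closed)
    moreover have "cinner H x ?w - cinner H (J x) (J ?w) = cinner H (A y) z"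
      using x z y w by (simp add: A_symmetric y_def cinner_minus_left J_closed J_symmetric)
    ultimately have "(\<lambda>n. cinner H (A (pev (sign_error n) x)) z) \<longlonglongrightarrow> cinner H (A y) z"
      by simp
    moreover have "(\<lambda>n. cinner H (A (pev (sign_error n) x)) z) \<longlonglongrightarrow> 0"
    proof (rule Lim_null_comparison)
      show "\<forall>\<^sub>F n in sequentially. cmod (cinner H (A (pev (sign_error n) x)) z)
          \<le> hnorm H (A (pev (sign_error n) x)) * hnorm H z"
        by (intro always_eventually allI cmod_cinner_le A_closed pev_closed x z)
      show "(\<lambda>n. hnorm H (A (pev (sign_error n) x)) * hnorm H z) \<longlonglongrightarrow> 0"
        using tendsto_mult_right[OF A_error_tendsto_0[OF x], of "hnorm H z"] by simp
    qed
    ultimately show ?thesis using LIMSEQ_unique z by (simp add: cinner_zero_left) blast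
  qed
  then have "A y = \<zero>" by (intro cinner_ext A_closed y) auto
  then have "y = \<zero>" by (rule A_injective[OF y])
  then show ?thesis using x by (simp add: y_def minus_eq_zero J_closed)
qed

end

section \<open>Unitary equivalence of projections in generic position\<close>

text \<open>The second component is inverse and adjoint at once; carrying it along makes composition
  and inversion immediate.\<close>

definition unitary_pair :: "'a cspace \<Rightarrow> ('a \<Rightarrow> 'a) \<Rightarrow> ('a \<Rightarrow> 'a) \<Rightarrow> bool" where
  "unitary_pair H J J' \<longleftrightarrow> J \<in> linear_maps H H \<and> J' \<in> linear_maps H H \<and>
     (\<forall>x\<in>carrier H. J' (J x) = x \<and> J (J' x) = x) \<and>
     (\<forall>x\<in>carrier H. \<forall>y\<in>carrier H. cinner H (J x) y = cinner H x (J' y))"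

definition unitarily_equivalent :: "'a cspace \<Rightarrow> ('a \<Rightarrow> 'a) \<Rightarrow> ('a \<Rightarrow> 'a) \<Rightarrow> bool" where
  "unitarily_equivalent H P Q \<longleftrightarrow>
     (\<exists>J J'. unitary_pair H J J' \<and> (\<forall>x\<in>carrier H. J (P x) = Q (J x)))"

context complex_hilbert_space begin

lemma unitarily_equivalent_refl: "unitarily_equivalent H P P" if "projection H P"
proof -
  let ?I = "\<lambda>x\<in>carrier H. x"
  have "unitary_pair H ?I ?I"
    using bounded_operators_linear[OF one_bounded_operators] by (simp add: unitary_pair_def)
  moreover have "?I (P x) = P (?I x)" if "x \<in> carrier H" for x
    using that linear_maps_closed[OF projection_linear[OF \<open>projection H P\<close>]] by simp
  ultimately show ?thesis
    unfolding unitarily_equivalent_def by blast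
qed

lemma unitarily_equivalent_trans:
  assumes "unitarily_equivalent H P Q" "unitarily_equivalent H Q R" "projection H P"
  shows "unitarily_equivalent H P R"
proof -
  obtain J J' where J: "unitary_pair H J J'" "\<And>x. x \<in> carrier H \<Longrightarrow> J (P x) = Q (J x)"
    using assms(1) by (auto simp: unitarily_equivalent_def)
  obtain I I' where I: "unitary_pair H I I'" "\<And>x. x \<in> carrier H \<Longrightarrow> I (Q x) = R (I x)"
    using assms(2) by (auto simp: unitarily_equivalent_def)
  have lin: "J \<in> linear_maps H H" "J' \<in> linear_maps H H" "I \<in> linear_maps H H" "I' \<in> linear_maps H H"
    using J(1) I(1) by (auto simp: unitary_pair_def)
  note cl = lin[THEN linear_maps_closed]
  have "unitary_pair H (compose (carrier H) I J) (compose (carrier H) J' I')"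
    unfolding unitary_pair_def
    using J(1) I(1) cl by (auto simp: lin compose_eq unitary_pair_def intro!: linear_maps_compose)
  moreover have "compose (carrier H) I J (P x) = R (compose (carrier H) I J x)" if "x \<in> carrier H" for x
    using that J(2) I(2) cl linear_maps_closed[OF projection_linear[OF assms(3)]] by (simp add: compose_eq)
  ultimately show ?thesis unfolding unitarily_equivalent_def by blast
qed

text \<open>The difference \<open>A = P + Q - 1\<close> satisfies \<open>A P = Q P = Q A\<close> and \<open>1 - A\<^sup>2 = (P - Q)\<^sup>2\<close>, and it is
  injective by genericity. Hence its sign intertwines \<open>P\<close> and \<open>Q\<close>.\<close>

lemma generic_projections_unitarily_equivalent:
  assumes P: "projection H P" and Q: "projection H Q"
    and PQ: "\<And>x. \<lbrakk>x \<in> carrier H; P x = x; Q x = \<zero>\<rbrakk> \<Longrightarrow> x = \<zero>"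
    and QP: "\<And>x. \<lbrakk>x \<in> carrier H; Q x = x; P x = \<zero>\<rbrakk> \<Longrightarrow> x = \<zero>"
  shows "unitarily_equivalent H P Q"
proof -
  define A where "A = (\<lambda>x\<in>carrier H. (P x \<oplus> Q x) \<ominus> x)"
  note lin = projection_linear[OF P] projection_linear[OF Q]
  note cl = lin[THEN linear_maps_closed]
  note idem = projection_idem[OF P] projection_idem[OF Q]
  note sym = projection_symmetric[OF P] projection_symmetric[OF Q]
  note add = lin[THEN linear_maps_add] and smult = lin[THEN linear_maps_smult]
  note minus = lin[THEN linear_maps_minus[OF complex_inner_space_axioms complex_inner_space_axioms]]
  have A: "A x \<in> carrier H" if "x \<in> carrier H" for x
    using that by (simp add: A_def cl)
  have A_lin: "A \<in> linear_maps H H"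
  proof (rule linear_mapsI)
    fix x y a assume xy: "x \<in> carrier H" "y \<in> carrier H"
    show "A (x \<oplus> y) = A x \<oplus> A y"
      by (rule cinner_ext) (use xy in \<open>auto simp: A_def cl add cinner_simps\<close>)
    show "A (a \<odot> x) = a \<odot> A x"
      by (rule cinner_ext) (use xy in \<open>auto simp: A_def cl smult cinner_simps algebra_simps\<close>)
  qed (auto simp: A, simp add: A_def)
  interpret A: injective_symmetric_contraction H A
  proof
    show "A \<in> linear_maps H H" by (rule A_lin)
    fix x assume x: "x \<in> carrier H"
    show "cinner H (A x) y = cinner H x (A y)" if "y \<in> carrier H" for y
      using x that by (simp add: A_def cl cinner_simps sym)
    have pp: "cinner H (P x) (P x) = cinner H (P x) x" "cinner H x (P x) = cinner H (P x) x"
      "cinner H (Q x) (Q x) = cinner H (Q x) x" "cinner H x (Q x) = cinner H (Q x) x"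
      using x by (simp_all add: sym cl idem)
    have "cinner H x x - cinner H (A x) (A x) = cinner H (P x \<ominus> Q x) (P x \<ominus> Q x)"
      using x by (simp add: A_def cl cinner_simps pp)
    then have "Re (cinner H x x) - Re (cinner H (A x) (A x)) = Re (cinner H (P x \<ominus> Q x) (P x \<ominus> Q x))"
      by (simp only: flip: minus_complex.sel)
    then have "Re (cinner H x x) - Re (cinner H (A x) (A x)) \<ge> 0"
      using cinner_nonneg[OF M.minus_closed[OF cl(1)[OF x] cl(2)[OF x]]] by simp
    then show "hnorm H (A x) \<le> hnorm H x" by (simp add: hnorm_def)
    show "x = \<zero>" if Ax: "A x = \<zero>"
    proof -
      have "P x \<oplus> Q x = x" using Ax x minus_eq_zero[of "P x \<oplus> Q x" x] by (simp add: A_def cl)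
      then have eq: "cinner H (P x) z + cinner H (Q x) z = cinner H x z" if "z \<in> carrier H" for z
        using \<open>P x \<oplus> Q x = x\<close> cinner_add_left[OF cl(1)[OF x] cl(2)[OF x] that] by simp
      \<comment> \<open>Applying \<open>Q\<close> to \<open>P x \<oplus> Q x = x\<close> cancels
        \<open>Q x\<close>. Thus \<open>P x\<close> is fixed by \<open>P\<close> and killed by
        \<open>Q\<close>, and the first genericity hypothesis applies to it.\<close>
      have "Q (P x) = \<zero>"
      proof (rule cinner_ext)
        fix z assume z: "z \<in> carrier H"
        have "cinner H (P x) (Q z) + cinner H (Q x) (Q z) = cinner H x (Q z)"
          using z cl by (intro eq)
        then show "cinner H (Q (P x)) z = cinner H \<zero> z"
          using x z by (simp add: sym cl idem cinner_zero_left)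
      qed (simp_all add: x cl)
      then have Px: "P x = \<zero>"
        using x by - (rule PQ, simp_all add: cl idem)
      have "Q x = x"
        using \<open>P x \<oplus> Q x = x\<close> x by (simp add: cl Px)
      then show ?thesis using Px x by (auto intro: QP)
    qed
  qed
  have "unitary_pair H A.J A.J"
    unfolding unitary_pair_def using A.J_linear A.J_involution A.J_symmetric by blast
  moreover have "A.J (P x) = Q (A.J x)" if x: "x \<in> carrier H" for x
  proof (rule A.J_intertwines[OF lin _ _ _ x])
    fix x assume x: "x \<in> carrier H"
    show "A (P x) = Q (A x)"
      by (rule cinner_ext) (use x in \<open>auto simp: A_def cl idem add minus cinner_simps\<close>)
    show "A (Q x) = P (A x)"
      by (rule cinner_ext) (use x in \<open>auto simp: A_def cl idem add minus cinner_simps\<close>)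
  qed (rule sym)
  ultimately show ?thesis unfolding unitarily_equivalent_def by blast
qed

section \<open>The range of a projection as a Hilbert space\<close>

lemma range_projection: "projection H R \<Longrightarrow> R ` carrier H = {x \<in> carrier H. R x = x}"
  using projection_idem linear_maps_closed[OF projection_linear] by force

text \<open>Changing only the carrier keeps the operations and the element type of \<open>H\<close>.
  The range is complete because it is the set of fixed points of a symmetric map, and such a set is
  closed.\<close>

lemma complex_hilbert_space_range_projection:
  assumes R: "projection H R"
  shows "complex_hilbert_space (H\<lparr>carrier := R ` carrier H\<rparr>)"
proof -
  let ?L = "R ` carrier H"
  let ?K = "H\<lparr>carrier := ?L\<rparr>"
  note lin = projection_linear[OF R]
  have L: "x \<in> carrier H" "R x = x" if "x \<in> ?L" for x
    using that by (auto simp: range_projection[OF R])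
  have LI: "x \<in> ?L" if "x \<in> carrier H" "R x = x" for x
    using that by (auto simp: range_projection[OF R])
  have R0: "R \<zero> = \<zero>"
    by (rule linear_maps_zero[OF complex_inner_space_axioms complex_inner_space_axioms lin])
  have L_add: "x \<oplus> y \<in> ?L" if "x \<in> ?L" "y \<in> ?L" for x y
    using L[OF that(1)] L[OF that(2)] by (intro LI) (auto simp: linear_maps_add[OF lin])
  have L_smult: "a \<odot> x \<in> ?L" if "x \<in> ?L" for a x
    using L[OF that] by (intro LI) (auto simp: linear_maps_smult[OF lin])
  have L_zero: "\<zero> \<in> ?L" using R0 by (intro LI) auto
  have "Module.module complex_ring ?K"
  proof (rule moduleI[OF cring_complex_ring])
    show "abelian_group ?K"
    proof (rule abelian_groupI)
      fix x assume "x \<in> carrier ?K"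
      then have x: "x \<in> ?L" by simp
      have "(-1) \<odot> x \<oplus> x = \<zero>"
        using L(1)[OF x] M.l_neg[of x] by (simp add: minus_eq_smult)
      then show "\<exists>y\<in>carrier ?K. y \<oplus>\<^bsub>?K\<^esub> x = \<zero>\<^bsub>?K\<^esub>"
        using L_smult[OF x, of "-1"] by (intro bexI[of _ "(-1) \<odot> x"]) auto
    next
      fix x y z assume "x \<in> carrier ?K" "y \<in> carrier ?K" "z \<in> carrier ?K"
      then show "x \<oplus>\<^bsub>?K\<^esub> y \<oplus>\<^bsub>?K\<^esub> z = x \<oplus>\<^bsub>?K\<^esub> (y \<oplus>\<^bsub>?K\<^esub> z)"
        using M.a_assoc[OF L(1) L(1) L(1)] by simp
    next
      fix x y assume "x \<in> carrier ?K" "y \<in> carrier ?K"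
      then show "x \<oplus>\<^bsub>?K\<^esub> y = y \<oplus>\<^bsub>?K\<^esub> x"
        using M.a_comm[OF L(1) L(1)] by simp
    next
      fix x assume "x \<in> carrier ?K"
      then show "\<zero>\<^bsub>?K\<^esub> \<oplus>\<^bsub>?K\<^esub> x = x"
        using M.l_zero[OF L(1)] by simp
    qed (use L_add L_zero in simp_all)
    show "(a \<oplus>\<^bsub>complex_ring\<^esub> b) \<odot>\<^bsub>?K\<^esub> x = a \<odot>\<^bsub>?K\<^esub> x \<oplus>\<^bsub>?K\<^esub> b \<odot>\<^bsub>?K\<^esub> x"
      "(a \<otimes>\<^bsub>complex_ring\<^esub> b) \<odot>\<^bsub>?K\<^esub> x = a \<odot>\<^bsub>?K\<^esub> (b \<odot>\<^bsub>?K\<^esub> x)" if "x \<in> carrier ?K" for a b x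
      using L(1)[of x] that smult_l_distr[of a b x] smult_assoc1[of a b x] by simp_all
    show "a \<odot>\<^bsub>?K\<^esub> (x \<oplus>\<^bsub>?K\<^esub> y) = a \<odot>\<^bsub>?K\<^esub> x \<oplus>\<^bsub>?K\<^esub> a \<odot>\<^bsub>?K\<^esub> y"
      if "x \<in> carrier ?K" "y \<in> carrier ?K" for a x y
      using L(1)[of x] L(1)[of y] that smult_r_distr[of a x y] by simp
    show "\<one>\<^bsub>complex_ring\<^esub> \<odot>\<^bsub>?K\<^esub> x = x" if "x \<in> carrier ?K" for x
      using L(1)[of x] that by simp
  qed (use L_smult in auto)
  then interpret KM: Module.module complex_ring ?K .
  interpret K: complex_inner_space ?K
  proof
    show "cinner ?K x y = cnj (cinner ?K y x)" if "x \<in> carrier ?K" "y \<in> carrier ?K" for x y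
      using cinner_commute[of x y] L(1)[of x] L(1)[of y] that by simp
  qed (use L(1) in \<open>simp_all add: cinner_add_left cinner_smult_left cinner_pos\<close>)
  \<comment> \<open>The additive inverse is defined by a description over the carrier, so it must be
    compared for the smaller carrier.\<close>
  have K_minus: "x \<ominus>\<^bsub>?K\<^esub> y = x \<ominus> y" if "x \<in> ?L" "y \<in> ?L" for x y
    using that L(1)[of y] K.minus_eq_smult[of y] by (simp add: KM.M.minus_eq M.minus_eq minus_eq_smult)
  have K_norm: "hnorm ?K x = hnorm H x" for x by (simp add: hnorm_def)
  have "Metric_space.mcomplete (carrier ?K) (hdist ?K)"
    unfolding K.mcomplete_iff
  proof (intro allI impI, elim conjE)
    fix \<sigma> :: "nat \<Rightarrow> 'a"
    assume "\<forall>n. \<sigma> n \<in> carrier ?K"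
      and cauchy: "\<forall>e>0. \<exists>N. \<forall>m\<ge>N. \<forall>n\<ge>N. hnorm ?K (\<sigma> m \<ominus>\<^bsub>?K\<^esub> \<sigma> n) < e"
    then have \<sigma>: "\<sigma> n \<in> ?L" for n by simp
    obtain x where x: "x \<in> carrier H" "(\<lambda>n. hnorm H (\<sigma> n \<ominus> x)) \<longlonglongrightarrow> 0"
      using convergentI[of \<sigma>] L(1)[OF \<sigma>] cauchy by (auto simp: K_minus \<sigma> K_norm)
    have Rx: "R x \<in> carrier H" using x linear_maps_closed[OF lin] by blast
    \<comment> \<open>The fixed-point equation is tested weakly: against \<open>z\<close> and
      against \<open>R z\<close> the sequence has the same inner products, hence so does its
      limit.\<close>
    have "R x = x"
    proof (rule cinner_ext[OF Rx x(1)])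
      fix z assume z: "z \<in> carrier H"
      have Rz: "R z \<in> carrier H" using z linear_maps_closed[OF lin] by blast
      have "cinner H (\<sigma> n) (R z) = cinner H (\<sigma> n) z" for n
        using projection_symmetric[OF R L(1)[OF \<sigma>] z, of n] L(2)[OF \<sigma>, of n] by simp
      then have "(\<lambda>n. cinner H (\<sigma> n) z) \<longlonglongrightarrow> cinner H x (R z)"
        using tendsto_cinner_left[OF L(1)[OF \<sigma>] x(1) Rz x(2)] by simp
      then have "cinner H x (R z) = cinner H x z"
        using tendsto_cinner_left[OF L(1)[OF \<sigma>] x(1) z x(2)] LIMSEQ_unique by blast
      then show "cinner H (R x) z = cinner H x z"
        using projection_symmetric[OF R x(1) z] by simp
    qed
    then have xL: "x \<in> ?L" using x(1) by (intro LI)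
    then show "\<exists>x\<in>carrier ?K. (\<lambda>n. hnorm ?K (\<sigma> n \<ominus>\<^bsub>?K\<^esub> x)) \<longlonglongrightarrow> 0"
      using x(2) by (intro bexI[of _ x]) (auto simp: K_minus \<sigma> K_norm)
  qed
  then show ?thesis
    by (intro complex_hilbert_space.intro complex_hilbert_space_axioms.intro K.complex_inner_space_axioms)
qed

end

section \<open>The matrix representation of a projection family\<close>

locale generic_projection_family = connected_bipartite_graph U V E + complex_hilbert_space H
  for U V :: "'v set" and E and H :: "'h cspace" (structure) +
  fixes P :: "'v \<Rightarrow> 'h \<Rightarrow> 'h"
  assumes family: "projection_family U V E H P" and generic: "generic_position U V E H P"
begin

section \<open>Partitions of unity and equivalence along paths\<close>

lemma projection_P: "x \<in> U \<union> V \<Longrightarrow> projection H (P x)"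
  using family by (simp add: projection_family_def)

lemmas P_linear = projection_linear[OF projection_P]
lemmas P_closed = linear_maps_closed[OF P_linear]
lemmas P_idem = projection_idem[OF projection_P]
lemmas P_symmetric = projection_symmetric[OF projection_P]
lemma finite_part: "I = U \<or> I = V \<Longrightarrow> finite I"
  using finite_U finite_V by auto

lemma part_subset: "I = U \<or> I = V \<Longrightarrow> w \<in> I \<Longrightarrow> w \<in> U \<union> V"
  by auto

text \<open>\<open>I\<close> stands for either side of the bipartition, so that consequences of a
  partition of unity are proved once for both.\<close>

lemma sum_P:
  assumes I: "I = U \<or> I = V" and xz: "x \<in> carrier H" "z \<in> carrier H"
  shows "(\<Sum>w\<in>I. cinner H (P w x) z) = cinner H x z"
proof -
  have "(\<Oplus>\<^bsub>bounded_operators H\<^esub>w\<in>I. P w) = \<one>\<^bsub>bounded_operators H\<^esub>"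
    using family I by (auto simp: projection_family_def)
  moreover have "P w \<in> carrier (bounded_operators H)" if "w \<in> I" for w
    using projection_P[OF part_subset[OF I that]] by (simp add: projection_def)
  ultimately have "(\<Sum>w\<in>I. cinner H (P w x) z) = cinner H (\<one>\<^bsub>bounded_operators H\<^esub> x) z"
    using finsum_bounded_operators_eq_iff[OF finite_part[OF I], of P "\<one>\<^bsub>bounded_operators H\<^esub>"]
      bounded_operators_linear[OF one_bounded_operators] xz by auto
  then show ?thesis using xz by simp
qed

text \<open>For \<open>a\<close> in the range of \<open>P w\<close>, the squared norms of all
  \<open>P u a\<close> add up to that of \<open>a\<close>, which the term for \<open>w\<close>
  already exhausts.\<close>

lemma P_orthogonal:
  assumes I: "I = U \<or> I = V" and vw: "v \<in> I" "w \<in> I" "v \<noteq> w" and x: "x \<in> carrier H"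
  shows "P v (P w x) = \<zero>"
proof -
  note sub = part_subset[OF I]
  define a where "a = P w x"
  have a: "a \<in> carrier H" "P w a = a"
    using x P_closed[OF sub[OF vw(2)]] P_idem[OF sub[OF vw(2)]] by (auto simp: a_def)
  have sq: "Re (cinner H (P u a) a) = (hnorm H (P u a))\<^sup>2" if "u \<in> I" for u
    using P_symmetric[OF sub[OF that] P_closed[OF sub[OF that] a(1)] a(1)] a(1)
      P_idem[OF sub[OF that] a(1)] P_closed[OF sub[OF that] a(1)]
    by (simp flip: Re_cinner_self)
  have "Re (\<Sum>u\<in>I. cinner H (P u a) a) = Re (cinner H (P w a) a)"
    using sum_P[OF I a(1) a(1)] by (simp add: a(2))
  then have "(\<Sum>u\<in>I. Re (cinner H (P u a) a)) = Re (cinner H (P w a) a)" by simp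
  then have "(\<Sum>u\<in>I - {w}. Re (cinner H (P u a) a)) = 0"
    using vw(2) finite_part[OF I] by (simp add: sum_diff1)
  then have "(\<Sum>u\<in>I - {w}. (hnorm H (P u a))\<^sup>2) = 0"
    using sq by simp
  then have "hnorm H (P v a) = 0"
    using vw finite_part[OF I] by (subst (asm) sum_nonneg_eq_0_iff) auto
  then show ?thesis
    using hnorm_eq_0[OF P_closed[OF sub[OF vw(1)] a(1)]] by (simp add: a_def)
qed

text \<open>Genericity in terms of fixed points and kernels: a vector killed by a projection is
  orthogonal to its range.\<close>

lemma generic_zero:
  assumes uv: "u \<in> U" "v \<in> V" "{u, v} \<in> E" and x: "x \<in> carrier H"
  shows "\<lbrakk>P u x = x; P v x = \<zero>\<rbrakk> \<Longrightarrow> x = \<zero>" "\<lbrakk>P v x = x; P u x = \<zero>\<rbrakk> \<Longrightarrow> x = \<zero>"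
proof -
  have oc: "x \<in> orth_complement H (P w ` carrier H)" if "w \<in> U \<union> V" "P w x = \<zero>" for w
    using that x by (auto simp: orth_complement_def P_symmetric cinner_zero_right)
  have "P u ` carrier H \<inter> orth_complement H (P v ` carrier H) = {\<zero>}"
    "orth_complement H (P u ` carrier H) \<inter> P v ` carrier H = {\<zero>}"
    using generic uv by (auto simp: generic_position_def)
  moreover have "x \<in> P w ` carrier H" if "P w x = x" for w
    using imageI[OF x, of "P w"] that by (simp only:)
  ultimately show "\<lbrakk>P u x = x; P v x = \<zero>\<rbrakk> \<Longrightarrow> x = \<zero>" "\<lbrakk>P v x = x; P u x = \<zero>\<rbrakk> \<Longrightarrow> x = \<zero>"
    using oc[of u] oc[of v] uv(1,2) by auto
qed

text \<open>Edges are unordered, so \<open>a\<close> may lie on either side; the two halves of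
  genericity swap roles accordingly.\<close>

lemma equivalent_edge:
  assumes "{a, b} \<in> E" shows "unitarily_equivalent H (P a) (P b)"
proof -
  obtain u v where uv: "{a, b} = {u, v}" "u \<in> U" "v \<in> V"
    using edges assms by blast
  then have "a = u \<and> b = v \<or> a = v \<and> b = u" by (auto simp: doubleton_eq_iff)
  moreover have "projection H (P u)" "projection H (P v)" using uv projection_P by auto
  ultimately show ?thesis
    using generic_zero[of u v] uv assms
    by (auto intro!: generic_projections_unitarily_equivalent simp: insert_commute)
qed

lemma equivalent_path:
  assumes "(x, y) \<in> {(a, b). {a, b} \<in> E}\<^sup>*" "x \<in> U \<union> V"
  shows "unitarily_equivalent H (P x) (P y)"
  using assms(1)
proof (induction rule: rtrancl_induct)
  case base
  then show ?case using unitarily_equivalent_refl projection_P assms(2) by blast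
next
  case (step y z)
  then show ?case
    using unitarily_equivalent_trans equivalent_edge projection_P assms(2) by blast
qed

lemma common_projection:
  obtains R where "projection H R" "\<And>x. x \<in> U \<union> V \<Longrightarrow> unitarily_equivalent H (P x) R"
proof (cases "U \<union> V = {}")
  case True
  \<comment> \<open>Without vertices the equivalences are vacuous and the identity will do;
    otherwise any fixed vertex supplies \<open>R\<close>.\<close>
  have "projection H (\<lambda>x\<in>carrier H. x)"
    by (rule projectionI) (use bounded_operators_linear[OF one_bounded_operators] in auto)
  with True that show ?thesis by blast
next
  case False
  then obtain r where r: "r \<in> U \<union> V" by blast
  then show ?thesis
    using that[of "P r"] projection_P equivalent_path connected by blast
qed

end

section \<open>Alignment with one projection and the operators \<open>C\<close>\<close>

locale aligned_projection_family = generic_projection_family +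
  fixes R :: "'b \<Rightarrow> 'b" and J J' :: "'a \<Rightarrow> 'b \<Rightarrow> 'b"
  assumes R: "projection H R"
    and J: "x \<in> U \<union> V \<Longrightarrow> unitary_pair H (J x) (J' x)"
    and J_intertwines: "\<lbrakk>x \<in> U \<union> V; y \<in> carrier H\<rbrakk> \<Longrightarrow> J x (P x y) = R (J x y)"
begin

abbreviation K where "K \<equiv> H\<lparr>carrier := R ` carrier H\<rparr>"

sublocale K: complex_hilbert_space K
  by (rule complex_hilbert_space_range_projection[OF R])

lemma K_carrier: "k \<in> R ` carrier H \<longleftrightarrow> k \<in> carrier H \<and> R k = k"
  by (simp add: range_projection[OF R])

lemma K_closed: "k \<in> R ` carrier H \<Longrightarrow> k \<in> carrier H"
  by (simp add: K_carrier)

lemma hnorm_K: "hnorm K x = hnorm H x"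
  by (simp add: hnorm_def)

lemma
  assumes "x \<in> U \<union> V"
  shows J_linear: "J x \<in> linear_maps H H" and J'_linear: "J' x \<in> linear_maps H H"
    and J'_J: "y \<in> carrier H \<Longrightarrow> J' x (J x y) = y"
    and J_J': "y \<in> carrier H \<Longrightarrow> J x (J' x y) = y"
    and cinner_J: "\<lbrakk>y \<in> carrier H; z \<in> carrier H\<rbrakk> \<Longrightarrow> cinner H (J x y) z = cinner H y (J' x z)"
  using J[OF assms] by (auto simp: unitary_pair_def)

lemmas J_closed = linear_maps_closed[OF J_linear]
lemmas J'_closed = linear_maps_closed[OF J'_linear]

lemma cinner_J': "\<lbrakk>x \<in> U \<union> V; y \<in> carrier H; z \<in> carrier H\<rbrakk> \<Longrightarrow> cinner H (J' x y) z = cinner H y (J x z)"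
  using cinner_J[of x z y] cinner_commute[of "J' x y" z] cinner_commute[of y "J x z"] J_closed J'_closed
  by simp

lemma J_zero: "x \<in> U \<union> V \<Longrightarrow> J x \<zero> = \<zero>"
  by (rule linear_maps_zero[OF complex_inner_space_axioms complex_inner_space_axioms J_linear])

lemma J_eq_zero: "\<lbrakk>x \<in> U \<union> V; y \<in> carrier H; J x y = \<zero>\<rbrakk> \<Longrightarrow> y = \<zero>"
  using J'_J[of x y] linear_maps_zero[OF complex_inner_space_axioms complex_inner_space_axioms J'_linear, of x]
  by simp

lemma J'_eq_zero: "\<lbrakk>x \<in> U \<union> V; y \<in> carrier H; J' x y = \<zero>\<rbrakk> \<Longrightarrow> y = \<zero>"
  using J_J'[of x y] J_zero[of x] by simp

text \<open>The adjoint intertwining relation on the range of \<open>R\<close>: \<open>J' x\<close>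
  maps this range into that of \<open>P x\<close>.\<close>

lemma P_J': assumes "x \<in> U \<union> V" "k \<in> R ` carrier H" shows "P x (J' x k) = J' x k"
proof -
  note k = K_closed[OF assms(2)]
  have "J x (P x (J' x k)) = k"
    using assms k by (simp add: J_intertwines J'_closed J_J' K_carrier)
  then show ?thesis
    using J'_J[OF assms(1) P_closed[OF assms(1) J'_closed[OF assms(1) k]]] by simp
qed

lemma J_P_in_K: "\<lbrakk>x \<in> U \<union> V; y \<in> carrier H\<rbrakk> \<Longrightarrow> J x (P x y) \<in> R ` carrier H"
  by (simp add: J_intertwines J_closed)

text \<open>Defined for every pair of vertices, not just for \<open>U\<close> against
  \<open>V\<close>: \<open>C v u\<close> then is the adjoint of \<open>C u v\<close>, and products
  of entries need only one formula.\<close>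

definition C :: "'a \<Rightarrow> 'a \<Rightarrow> 'b \<Rightarrow> 'b" where
  "C x y = (\<lambda>k\<in>R ` carrier H. J x (P x (J' y k)))"

lemma C_closed: "\<lbrakk>x \<in> U \<union> V; y \<in> U \<union> V; k \<in> R ` carrier H\<rbrakk> \<Longrightarrow> C x y k \<in> R ` carrier H"
  by (simp add: C_def J_P_in_K J'_closed K_closed)

lemma cinner_C:
  assumes "x \<in> U \<union> V" "y \<in> U \<union> V" "k \<in> R ` carrier H" "l \<in> carrier H"
  shows "cinner H (C x y k) l = cinner H (P x (J' y k)) (J' x l)"
  using assms by (simp add: C_def cinner_J J'_closed P_closed K_closed)

lemma C_symmetric:
  assumes "x \<in> U \<union> V" "y \<in> U \<union> V" "k \<in> R ` carrier H" "l \<in> R ` carrier H"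
  shows "cinner H (C x y k) l = cinner H k (C y x l)"
proof -
  note kl = K_closed[OF assms(3)] K_closed[OF assms(4)]
  have "cinner H (C x y k) l = cinner H (J' y k) (P x (J' x l))"
    using assms kl by (simp add: cinner_C P_symmetric J'_closed)
  also have "\<dots> = cinner H (P y (J' y k)) (J' x l)"
    using assms by (simp add: P_J')
  also have "\<dots> = cinner H k (J y (P y (J' x l)))"
    using assms kl by (simp add: P_symmetric J'_closed P_closed cinner_J')
  finally show ?thesis using assms by (simp add: C_def)
qed

text \<open>The bound 1 arises because a projection is placed between two isometries.\<close>

lemma C_bounded:
  assumes xy: "x \<in> U \<union> V" "y \<in> U \<union> V"
  shows "C x y \<in> carrier (bounded_operators K)"
proof (rule K.bounded_operatorsI[where B = 1])
  show "C x y \<in> linear_maps K K"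
  proof (rule linear_mapsI)
    show "C x y \<in> extensional (carrier K)" by (simp add: C_def)
    show "C x y k \<in> carrier K" if "k \<in> carrier K" for k
      using C_closed xy that by simp
  next
    fix k l assume kl: "k \<in> carrier K" "l \<in> carrier K"
    then have kl_add: "k \<oplus> l \<in> R ` carrier H"
      using K.M.a_closed[of k l] by simp
    show "C x y (k \<oplus>\<^bsub>K\<^esub> l) = C x y k \<oplus>\<^bsub>K\<^esub> C x y l"
      using kl xy kl_add K_closed
      by (simp add: C_def linear_maps_add[OF J'_linear] linear_maps_add[OF P_linear]
          linear_maps_add[OF J_linear] J'_closed P_closed)
  next
    fix a k assume k: "k \<in> carrier K"
    then have "a \<odot> k \<in> R ` carrier H"
      using K.smult_in[of k a] by simp
    then show "C x y (a \<odot>\<^bsub>K\<^esub> k) = a \<odot>\<^bsub>K\<^esub> C x y k"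
      using k xy K_closed
      by (simp add: C_def linear_maps_smult[OF J'_linear] linear_maps_smult[OF P_linear]
          linear_maps_smult[OF J_linear] J'_closed P_closed)
  qed
  fix k assume "k \<in> carrier K"
  then have k: "k \<in> R ` carrier H" "k \<in> carrier H" using K_closed by auto
  note J'k = J'_closed[OF xy(2) k(2)]
  have "cinner H (C x y k) (C x y k) = cinner H (P x (J' y k)) (P x (J' y k))"
    using xy k J'k by (simp add: C_def cinner_J J_closed P_closed J'_J)
  then have "hnorm H (C x y k) = hnorm H (P x (J' y k))" by (simp add: hnorm_def)
  also have "\<dots> \<le> hnorm H (J' y k)"
    using xy J'k by (intro symmetric_idempotent_contraction) (auto simp: P_closed P_idem P_symmetric)
  also have "\<dots> = hnorm H k"
    using xy k J'k by (simp add: hnorm_def cinner_J' J_J')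
  finally show "hnorm K (C x y k) \<le> 1 * hnorm K k" by (simp add: hnorm_K)
qed

lemma adjoint_C: "\<lbrakk>x \<in> U \<union> V; y \<in> U \<union> V\<rbrakk> \<Longrightarrow> adjoint K (C x y) = C y x"
  using K.bounded_operators_linear[OF C_bounded]
  by (intro K.adjoint_eqI C_bounded) (auto simp: C_symmetric simp del: image_iff)

text \<open>Both sum relations at once, with \<open>I\<close> and \<open>I'\<close> the two sides in
  either order. Summing the \<open>P w\<close> over \<open>I\<close> leaves the inner product of
  \<open>J' y k\<close> and \<open>J' x l\<close>; these are orthogonal for distinct
  \<open>x\<close> and \<open>y\<close> in \<open>I'\<close>, and \<open>J'\<close> is isometric
  when they agree.\<close>

lemma sum_C_C:
  assumes I: "I = U \<or> I = V" and I': "I' = U \<or> I' = V" and xy: "x \<in> I'" "y \<in> I'"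
  shows "(\<Oplus>\<^bsub>bounded_operators K\<^esub>w\<in>I. compose (carrier K) (C x w) (C w y)) = kronecker K x y"
proof (subst K.finsum_bounded_operators_eq_iff)
  note sub = part_subset[OF I] part_subset[OF I' xy(1)] part_subset[OF I' xy(2)]
  show "finite I" by (rule finite_part[OF I])
  show "compose (carrier K) (C x w) (C w y) \<in> carrier (bounded_operators K)" if "w \<in> I" for w
    using that sub by (intro K.compose_bounded_operators C_bounded)
  show "kronecker K x y \<in> linear_maps K K" by (rule K.kronecker_linear)
  have "(\<Sum>w\<in>I. cinner H (C x w (C w y k)) l) = cinner H (if x = y then k else \<zero>) l"
    if kl: "k \<in> R ` carrier H" "l \<in> R ` carrier H" for k l
  proof -
    note klH = K_closed[OF kl(1)] K_closed[OF kl(2)]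
    note J'kl = J'_closed[OF sub(3) klH(1)] J'_closed[OF sub(2) klH(2)]
    have "cinner H (C x w (C w y k)) l = cinner H (P w (J' y k)) (J' x l)" if w: "w \<in> I" for w
    proof -
      note w' = sub(1)[OF w]
      have "cinner H (C x w (C w y k)) l = cinner H (C w y k) (C w x l)"
        using w' sub kl by (simp add: C_symmetric C_closed)
      also have "\<dots> = cinner H (P w (J' y k)) (P w (J' x l))"
        using w' sub kl J'kl by (simp add: C_def cinner_J J_closed P_closed J'_J)
      also have "\<dots> = cinner H (P w (J' y k)) (J' x l)"
        using w' J'kl P_symmetric[OF w' P_closed[OF w' J'kl(1)] J'kl(2)] by (simp add: P_idem)
      finally show ?thesis .
    qed
    then have "(\<Sum>w\<in>I. cinner H (C x w (C w y k)) l) = cinner H (J' y k) (J' x l)"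
      using sum_P[OF I J'kl] by simp
    also have "\<dots> = cinner H (if x = y then k else \<zero>) l"
    proof (cases "x = y")
      case True
      then show ?thesis using sub klH J'kl by (simp add: cinner_J' J_J')
    next
      case False
      have "cinner H (J' y k) (J' x l) = cinner H (P y (J' y k)) (P x (J' x l))"
        using sub kl by (simp add: P_J')
      also have "\<dots> = cinner H (P x (P y (J' y k))) (J' x l)"
        using sub J'kl by (simp add: P_symmetric P_closed)
      also have "\<dots> = 0"
        using P_orthogonal[OF I' xy False J'kl(1)] J'kl by (simp add: cinner_zero_left)
      finally show ?thesis using False klH by (simp add: cinner_zero_left)
    qed
    finally show ?thesis .
  qed
  then show "\<forall>k\<in>carrier K. \<forall>l\<in>carrier K.
      (\<Sum>w\<in>I. cinner K (compose (carrier K) (C x w) (C w y) k) l) = cinner K (kronecker K x y k) l"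
    by (auto simp: compose_eq K.kronecker_apply simp del: image_iff)
qed

text \<open>A kernel vector is carried by \<open>J'\<close> into the range of one projection and the
  kernel of the other. The first claim yields injectivity; the second concerns the adjoint and
  yields dense range.\<close>

lemma C_eq_zero:
  assumes "u \<in> U" "v \<in> V" "{u, v} \<in> E" "k \<in> R ` carrier H"
  shows "C u v k = \<zero> \<Longrightarrow> k = \<zero>" "C v u k = \<zero> \<Longrightarrow> k = \<zero>"
proof -
  note uv = UnI1[OF assms(1), of V] UnI2[OF assms(2), of U]
  note k = K_closed[OF assms(4)]
  note J'k = J'_closed[OF uv(1) k] J'_closed[OF uv(2) k]
  show "k = \<zero>" if "C u v k = \<zero>"
  proof -
    have "P u (J' v k) = \<zero>"
      using that J_eq_zero[OF uv(1) P_closed[OF uv(1) J'k(2)]] assms(4) by (simp add: C_def)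
    then have "J' v k = \<zero>"
      using generic_zero(2)[OF assms(1-3) J'k(2)] P_J'[OF uv(2) assms(4)] by simp
    then show ?thesis by (rule J'_eq_zero[OF uv(2) k])
  qed
  show "k = \<zero>" if "C v u k = \<zero>"
  proof -
    have "P v (J' u k) = \<zero>"
      using that J_eq_zero[OF uv(2) P_closed[OF uv(2) J'k(1)]] assms(4) by (simp add: C_def)
    then have "J' u k = \<zero>"
      using generic_zero(1)[OF assms(1-3) J'k(1)] P_J'[OF uv(1) assms(4)] by simp
    then show ?thesis by (rule J'_eq_zero[OF uv(1) k])
  qed
qed

lemma C_injective:
  assumes "u \<in> U" "v \<in> V" "{u, v} \<in> E"
  shows "inj_on (C u v) (carrier K)"
proof (rule inj_onI)
  note lin = K.bounded_operators_linear[OF C_bounded, of u v]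
  fix k l assume kl: "k \<in> carrier K" "l \<in> carrier K" and eq: "C u v k = C u v l"
  have "C u v (k \<ominus>\<^bsub>K\<^esub> l) = C u v k \<ominus>\<^bsub>K\<^esub> C u v l"
    using assms kl by (intro linear_maps_minus K.complex_inner_space_axioms lin) auto
  also have "\<dots> = \<zero>\<^bsub>K\<^esub>"
    using assms kl C_closed[of u v l] unfolding eq by (intro K.minus_eq_zero[THEN iffD2]) auto
  finally have "k \<ominus>\<^bsub>K\<^esub> l = \<zero>"
    using C_eq_zero(1)[OF assms, of "k \<ominus>\<^bsub>K\<^esub> l"] K.M.minus_closed[OF kl] by simp
  then show "k = l" using K.minus_eq_zero[OF kl] by simp
qed

text \<open>A vector orthogonal to the range lies in the kernel of the adjoint \<open>C v u\<close>,
  which is trivial; \<open>dense_subspaceI\<close> turns this into approximation.\<close>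

lemma C_dense_range:
  assumes "u \<in> U" "v \<in> V" "{u, v} \<in> E"
  shows "dense_range K (C u v)"
proof -
  interpret D: Metric_space "carrier K" "hdist K" by (rule K.Metric_space_hdist)
  have uv: "u \<in> U \<union> V" "v \<in> U \<union> V" using assms by auto
  note lin = K.bounded_operators_linear[OF C_bounded[OF uv]]
  note cl = linear_maps_closed[OF lin]
  have orth: "z = \<zero>\<^bsub>K\<^esub>"
    if z: "z \<in> carrier K" and "\<And>m. m \<in> C u v ` carrier K \<Longrightarrow> cinner K m z = 0" for z
  proof -
    have "C v u z \<in> R ` carrier H" using C_closed[OF uv(2,1)] z by simp
    \<comment> \<open>The range element tested here is \<open>C u v (C v u z)\<close>.\<close>
    then have "cinner H (C v u z) (C v u z) = 0"
      using that C_symmetric[OF uv, of "C v u z" z] by simp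
    then have "C v u z = \<zero>"
      using cinner_self_eq_0[of "C v u z"] K_closed[OF \<open>C v u z \<in> R ` carrier H\<close>] by simp
    then show ?thesis using C_eq_zero(2)[OF assms] z by simp
  qed
  have approx: "\<exists>m\<in>C u v ` carrier K. hnorm K (x \<ominus>\<^bsub>K\<^esub> m) < e" if "x \<in> carrier K" "e > 0" for x e
  proof (rule K.dense_subspaceI[OF _ _ _ _ orth that])
    show "C u v ` carrier K \<subseteq> carrier K" using cl by blast
    show "\<zero>\<^bsub>K\<^esub> \<in> C u v ` carrier K"
      using linear_maps_zero[OF K.complex_inner_space_axioms K.complex_inner_space_axioms lin]
        imageI[OF K.M.zero_closed, of "C u v"] by (simp only:)
  next
    fix a b assume "a \<in> C u v ` carrier K" "b \<in> C u v ` carrier K"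
    then obtain k l where kl: "k \<in> carrier K" "l \<in> carrier K" "a = C u v k" "b = C u v l" by blast
    then have "a \<oplus>\<^bsub>K\<^esub> b = C u v (k \<oplus>\<^bsub>K\<^esub> l)"
      by (simp only: linear_maps_add[OF lin])
    then show "a \<oplus>\<^bsub>K\<^esub> b \<in> C u v ` carrier K"
      using K.M.a_closed[OF kl(1,2)] by blast
  next
    fix c a assume "a \<in> C u v ` carrier K"
    then obtain k where k: "k \<in> carrier K" "a = C u v k" by blast
    then have "c \<odot>\<^bsub>K\<^esub> a = C u v (c \<odot>\<^bsub>K\<^esub> k)"
      by (simp only: linear_maps_smult[OF lin])
    then show "c \<odot>\<^bsub>K\<^esub> a \<in> C u v ` carrier K"
      using K.smult_in[OF k(1)] by blast
  qed
  have ball: "\<exists>m\<in>C u v ` carrier K. m \<in> D.mball x e" if x: "x \<in> carrier K" "e > 0" for x e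
  proof -
    obtain m where m: "m \<in> C u v ` carrier K" "hnorm K (x \<ominus>\<^bsub>K\<^esub> m) < e"
      using approx[OF x] by blast
    have "m \<in> carrier K" using m(1) cl by blast
    then have "m \<in> D.mball x e"
      unfolding D.in_mball hdist_def using m(2) x(1) by (simp only: if_True simp_thms)
    then show ?thesis using m(1) by blast
  qed
  show ?thesis
    unfolding dense_range_def D.metric_closure_of
  proof (rule subset_antisym)
    show "carrier K \<subseteq> {x \<in> carrier K. \<forall>r>0. \<exists>y\<in>C u v ` carrier K. y \<in> D.mball x r}"
      by (intro subsetI CollectI conjI allI impI ball)
  qed (rule Collect_restrict)
qed

text \<open>\<open>J' v k\<close> lies in the range of \<open>P v\<close>, which \<open>P u\<close>
  annihilates.\<close>

lemma C_nonadjacent: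
  assumes "u \<in> U" "v \<in> V" "{u, v} \<notin> E"
  shows "C u v = \<zero>\<^bsub>bounded_operators K\<^esub>"
proof -
  have uv: "u \<in> U \<union> V" "v \<in> U \<union> V" using assms by auto
  have PP: "compose (carrier H) (P u) (P v) = (\<lambda>x\<in>carrier H. \<zero>)"
    using family assms by (simp add: projection_family_def)
  have "J u (P u (J' v k)) = \<zero>" if k: "k \<in> R ` carrier H" for k
  proof -
    have J'k: "J' v k \<in> carrier H" using J'_closed uv K_closed k by blast
    have "P u (P v (J' v k)) = \<zero>"
      using fun_cong[OF PP, of "J' v k"] J'k by (simp add: compose_eq)
    then show ?thesis using P_J'[OF uv(2) k] J_zero[OF uv(1)] by simp
  qed
  then show ?thesis
    unfolding C_def K.bounded_operators_zero by (auto intro!: restrict_ext)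
qed

lemma operator_family_C: "operator_family U V E K C"
  unfolding operator_family_def
proof (intro conjI ballI impI)
  fix u v assume "u \<in> U" "v \<in> V"
  then show "C u v \<in> carrier (bounded_operators K)" by (intro C_bounded) auto
next
  fix v\<^sub>1 v\<^sub>2 assume v: "v\<^sub>1 \<in> V" "v\<^sub>2 \<in> V"
  interpret B: abelian_monoid "bounded_operators K" by (rule K.abelian_monoid_bounded_operators)
  have "(\<Oplus>\<^bsub>bounded_operators K\<^esub>u\<in>U. adjoint K (C u v\<^sub>1) \<otimes>\<^bsub>bounded_operators K\<^esub> C u v\<^sub>2)
      = (\<Oplus>\<^bsub>bounded_operators K\<^esub>u\<in>U. compose (carrier K) (C v\<^sub>1 u) (C u v\<^sub>2))"
  proof (intro B.finsum_cong' refl Pi_I)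
    fix u assume u: "u \<in> U"
    then have sub: "u \<in> U \<union> V" "v\<^sub>1 \<in> U \<union> V" "v\<^sub>2 \<in> U \<union> V" using v by auto
    show "compose (carrier K) (C v\<^sub>1 u) (C u v\<^sub>2) \<in> carrier (bounded_operators K)"
      by (intro K.compose_bounded_operators C_bounded sub)
    show "adjoint K (C u v\<^sub>1) \<otimes>\<^bsub>bounded_operators K\<^esub> C u v\<^sub>2 = compose (carrier K) (C v\<^sub>1 u) (C u v\<^sub>2)"
      by (simp only: K.bounded_operators_mult adjoint_C[OF sub(1) sub(2)])
  qed
  then show "(\<Oplus>\<^bsub>bounded_operators K\<^esub>u\<in>U. adjoint K (C u v\<^sub>1) \<otimes>\<^bsub>bounded_operators K\<^esub> C u v\<^sub>2)
      = kronecker K v\<^sub>1 v\<^sub>2"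
    using sum_C_C[of U V v\<^sub>1 v\<^sub>2] v by simp
next
  fix u\<^sub>1 u\<^sub>2 assume u: "u\<^sub>1 \<in> U" "u\<^sub>2 \<in> U"
  interpret B: abelian_monoid "bounded_operators K" by (rule K.abelian_monoid_bounded_operators)
  have "(\<Oplus>\<^bsub>bounded_operators K\<^esub>v\<in>V. C u\<^sub>1 v \<otimes>\<^bsub>bounded_operators K\<^esub> adjoint K (C u\<^sub>2 v))
      = (\<Oplus>\<^bsub>bounded_operators K\<^esub>v\<in>V. compose (carrier K) (C u\<^sub>1 v) (C v u\<^sub>2))"
  proof (intro B.finsum_cong' refl Pi_I)
    fix v assume v: "v \<in> V"
    then have sub: "v \<in> U \<union> V" "u\<^sub>1 \<in> U \<union> V" "u\<^sub>2 \<in> U \<union> V" using u by auto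
    show "compose (carrier K) (C u\<^sub>1 v) (C v u\<^sub>2) \<in> carrier (bounded_operators K)"
      by (intro K.compose_bounded_operators C_bounded sub)
    show "C u\<^sub>1 v \<otimes>\<^bsub>bounded_operators K\<^esub> adjoint K (C u\<^sub>2 v) = compose (carrier K) (C u\<^sub>1 v) (C v u\<^sub>2)"
      by (simp only: K.bounded_operators_mult adjoint_C[OF sub(3) sub(1)])
  qed
  then show "(\<Oplus>\<^bsub>bounded_operators K\<^esub>v\<in>V. C u\<^sub>1 v \<otimes>\<^bsub>bounded_operators K\<^esub> adjoint K (C u\<^sub>2 v))
      = kronecker K u\<^sub>1 u\<^sub>2"
    using sum_C_C[of V U u\<^sub>1 u\<^sub>2] u by simp
qed (use C_nonadjacent C_injective C_dense_range in auto)

text \<open>Makes \<open>row\<close> and the formulas for the matrix projections available for the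
  constructed \<open>C\<close>.\<close>

sublocale M: operator_matrix U V E K C
  by unfold_locales (rule operator_family_C)

section \<open>The unitary onto the power space\<close>

definition W :: "'b \<Rightarrow> 'a \<Rightarrow> 'b" where
  "W = (\<lambda>x\<in>carrier H. \<lambda>v\<in>V. J v (P v x))"

lemma W_closed: "x \<in> carrier H \<Longrightarrow> W x \<in> V \<rightarrow>\<^sub>E carrier K"
  by (auto simp: W_def J_P_in_K)

lemma cinner_W:
  assumes "x \<in> carrier H" "y \<in> carrier H"
  shows "cinner (power_space V K) (W x) (W y) = cinner H x y"
proof -
  have "cinner H (J v (P v x)) (J v (P v y)) = cinner H (P v x) y" if "v \<in> V" for v
  proof -
    have v: "v \<in> U \<union> V" using that by simp
    have "cinner H (J v (P v x)) (J v (P v y)) = cinner H (P v x) (P v y)"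
      using assms v by (simp add: cinner_J J_closed P_closed J'_J)
    also have "\<dots> = cinner H (P v x) y"
      using assms v P_symmetric[OF v P_closed[OF v assms(1)] assms(2)] by (simp add: P_idem)
    finally show ?thesis .
  qed
  then have "cinner (power_space V K) (W x) (W y) = (\<Sum>v\<in>V. cinner H (P v x) y)"
    using assms by (simp add: W_def)
  also have "\<dots> = cinner H x y" using assms by (intro sum_P) auto
  finally show ?thesis .
qed

text \<open>The preimage is the sum of all \<open>J' v (\<xi> v)\<close>: its terms lie in the
  mutually orthogonal ranges of the \<open>P v\<close>, so \<open>P w\<close> extracts the term for
  \<open>w\<close>.\<close>

lemma W_surjective:
  assumes \<xi>: "\<xi> \<in> V \<rightarrow>\<^sub>E carrier K"
  shows "\<xi> \<in> W ` carrier H"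
proof -
  have \<xi>v: "\<xi> v \<in> R ` carrier H" "\<xi> v \<in> carrier H" "v \<in> U \<union> V" if "v \<in> V" for v
    using power_space_component[OF \<xi> that] K_closed that by auto
  note J'\<xi> = J'_closed[OF \<xi>v(3,2)]
  define x where "x = (\<Oplus>v\<in>V. J' v (\<xi> v))"
  have x: "x \<in> carrier H" unfolding x_def using J'\<xi> by (intro M.finsum_closed) auto
  have Px: "P w x = J' w (\<xi> w)" if w: "w \<in> V" for w
  proof (rule cinner_ext)
    note w' = \<xi>v(3)[OF w]
    fix z assume z: "z \<in> carrier H"
    have "cinner H (P w x) z = (\<Sum>v\<in>V. cinner H (J' v (\<xi> v)) (P w z))"
      using P_symmetric[OF w' x z] P_closed[OF w' z] J'\<xi> by (simp add: x_def cinner_finsum_left)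
    also have "\<dots> = (\<Sum>v\<in>V. if v = w then cinner H (J' w (\<xi> w)) z else 0)"
    proof (rule sum.cong[OF refl])
      fix v assume v: "v \<in> V"
      have "cinner H (J' v (\<xi> v)) (P w z) = cinner H (P w (P v (J' v (\<xi> v)))) z"
        using P_symmetric[OF w' J'\<xi>[OF v v] z] P_J'[OF \<xi>v(3)[OF v] \<xi>v(1)[OF v]] by simp
      also have "\<dots> = (if v = w then cinner H (J' w (\<xi> w)) z else 0)"
      proof (cases "v = w")
        case True
        then show ?thesis using P_J'[OF \<xi>v(3)[OF v] \<xi>v(1)[OF v]] by simp
      next
        case False
        then show ?thesis
          using P_orthogonal[of V w v "J' v (\<xi> v)"] v w J'\<xi>[OF v v] z by (simp add: cinner_zero_left)
      qed
      finally show "cinner H (J' v (\<xi> v)) (P w z) = (if v = w then cinner H (J' w (\<xi> w)) z else 0)" .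
    qed
    also have "\<dots> = cinner H (J' w (\<xi> w)) z" using w finite_V by simp
    finally show "cinner H (P w x) z = cinner H (J' w (\<xi> w)) z" .
  qed (use w J'\<xi> P_closed[OF \<xi>v(3)[OF w] x] in auto)
  have "W x = \<xi>"
  proof (rule M.KV_ext[OF W_closed[OF x] \<xi>])
    fix v assume v: "v \<in> V"
    then show "W x v = \<xi> v" using x Px[OF v] J_J'[OF \<xi>v(3)[OF v] \<xi>v(2)[OF v]] by (simp add: W_def)
  qed
  then show ?thesis using x by blast
qed

lemma unitary_W: "unitary H (power_space V K) W"
  unfolding unitary_def
proof (intro conjI ballI cinner_W)
  show "W \<in> linear_maps H (power_space V K)"
  proof (rule linear_mapsI)
    show "W \<in> extensional (carrier H)" by (simp add: W_def)
    show "W x \<in> carrier (power_space V K)" if "x \<in> carrier H" for x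
      using W_closed[OF that] by simp
    show "W (x \<oplus> y) = W x \<oplus>\<^bsub>power_space V K\<^esub> W y" if "x \<in> carrier H" "y \<in> carrier H" for x y
      using that by (auto simp: W_def linear_maps_add[OF P_linear] linear_maps_add[OF J_linear] P_closed
          intro!: restrict_ext)
    show "W (a \<odot> x) = a \<odot>\<^bsub>power_space V K\<^esub> W x" if "x \<in> carrier H" for a x
      using that by (auto simp: W_def linear_maps_smult[OF P_linear] linear_maps_smult[OF J_linear] P_closed
          intro!: restrict_ext)
  qed
  show "bij_betw W (carrier H) (carrier (power_space V K))"
  proof (rule bij_betw_imageI)
    show "inj_on W (carrier H)"
    proof (rule inj_onI)
      fix x y assume xy: "x \<in> carrier H" "y \<in> carrier H" "W x = W y"
      show "x = y"
        by (rule cinner_ext[OF xy(1,2)]) (use xy in \<open>simp add: xy(3) flip: cinner_W\<close>)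
    qed
    show "W ` carrier H = carrier (power_space V K)"
    proof
      show "W ` carrier H \<subseteq> carrier (power_space V K)" using W_closed by auto
      show "carrier (power_space V K) \<subseteq> W ` carrier H" using W_surjective by auto
    qed
  qed
qed

text \<open>Each term of the row is \<open>J u (P u (P v y))\<close>, and the \<open>P v\<close> sum
  to the identity.\<close>

lemma row_W:
  assumes u: "u \<in> U" and y: "y \<in> carrier H"
  shows "M.row u (W y) = J u (P u y)"
proof -
  have u': "u \<in> U \<union> V" using u by simp
  note JPy = J_P_in_K[OF u' y]
  show ?thesis
  proof (rule K.cinner_ext)
    show "M.row u (W y) \<in> carrier K" by (rule M.row_closed[OF u W_closed[OF y]])
    show "J u (P u y) \<in> carrier K" using JPy by simp
    fix z assume "z \<in> carrier K"
    then have z: "z \<in> R ` carrier H" "z \<in> carrier H" using K_closed by auto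
    have J'z: "J' u z \<in> carrier H" using J'_closed u' z by blast
    have "cinner H (C u v (W y v)) z = cinner H (P v y) (P u (J' u z))" if v: "v \<in> V" for v
    proof -
      have v': "v \<in> U \<union> V" using v by simp
      note Pvy = P_closed[OF v' y]
      have "C u v (W y v) = J u (P u (P v y))"
        using v J_P_in_K[OF v' y] y J'_J[OF v' Pvy] by (simp add: C_def W_def)
      then show ?thesis
        using u' z Pvy J'z by (simp add: cinner_J P_closed P_symmetric)
    qed
    then have "cinner K (M.row u (W y)) z = (\<Sum>v\<in>V. cinner H (P v y) (P u (J' u z)))"
      using M.cinner_row[OF u W_closed[OF y], of z] z by simp
    also have "\<dots> = cinner H y (P u (J' u z))"
      using y P_closed[OF u' J'z] by (intro sum_P) auto
    also have "\<dots> = cinner H (J u (P u y)) z"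
      using u' y z J'z by (simp add: cinner_J P_closed P_symmetric)
    finally show "cinner K (M.row u (W y)) z = cinner K (J u (P u y)) z" by simp
  qed
qed

text \<open>For \<open>x\<close> in \<open>U\<close>, component \<open>v\<close> of the matrix side
  is \<open>C v x\<close> applied to \<open>row_W\<close>; \<open>J' x\<close> cancels
  \<open>J x\<close> and \<open>J v (P v (P x y))\<close> remains. For \<open>x\<close> in
  \<open>V\<close>, orthogonality of the \<open>P v\<close> leaves just the component
  \<open>x\<close>.\<close>

lemma W_intertwines:
  assumes x: "x \<in> U \<union> V"
  shows "compose (carrier H) W (P x) = compose (carrier H) (matrix_family U V K C x) W"
  unfolding compose_def
proof (rule restrict_ext)
  fix y assume y: "y \<in> carrier H"
  note Py = P_closed[OF x y] and Wy = W_closed[OF y]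
  have "matrix_family U V K C x (W y) \<in> V \<rightarrow>\<^sub>E carrier K"
    using M.P_closed[OF _ Wy] x by blast
  then show "W (P x y) = matrix_family U V K C x (W y)"
  proof (rule M.KV_ext[OF W_closed[OF Py]])
    fix v assume v: "v \<in> V"
    then have v': "v \<in> U \<union> V" by simp
    show "W (P x y) v = matrix_family U V K C x (W y) v"
    proof (cases "x \<in> U")
      case True
      have "matrix_family U V K C x (W y) v = C v x (J x (P x y))"
        using M.P_U[OF True Wy v] row_W[OF True y] by (simp add: M.D_def adjoint_C[OF x v'])
      also have "\<dots> = J v (P v (P x y))"
        using J_P_in_K[OF x y] J'_J[OF x Py] by (simp add: C_def)
      finally show ?thesis using v Py by (simp add: W_def)
    next
      case False
      then have xV: "x \<in> V" using x by simp
      have "W (P x y) v = J v (P v (P x y))" using v Py by (simp add: W_def)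
      also have "\<dots> = (if v = x then W y v else \<zero>)"
        using P_idem[OF x y] P_orthogonal[of V v x y] v xV y J_zero[OF v'] by (auto simp: W_def)
      finally show ?thesis using M.P_V[OF xV Wy v] by simp
    qed
  qed
qed

end

lemma (in generic_projection_family) matrix_representation:
  "\<exists>(K :: 'h cspace) C W. complex_hilbert_space K \<and> operator_family U V E K C \<and>
     unitary H (power_space V K) W \<and>
     (\<forall>x\<in>U \<union> V. compose (carrier H) W (P x) = compose (carrier H) (matrix_family U V K C x) W)"
proof -
  obtain R where R: "projection H R" "\<And>x. x \<in> U \<union> V \<Longrightarrow> unitarily_equivalent H (P x) R"
    using common_projection by blast
  then have "\<forall>x\<in>U \<union> V. \<exists>J J'. unitary_pair H J J' \<and> (\<forall>y\<in>carrier H. J (P x y) = R (J y))"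
    by (simp add: unitarily_equivalent_def)
  then obtain J J' where "\<And>x. x \<in> U \<union> V \<Longrightarrow> unitary_pair H (J x) (J' x)"
    "\<And>x y. \<lbrakk>x \<in> U \<union> V; y \<in> carrier H\<rbrakk> \<Longrightarrow> J x (P x y) = R (J x y)"
    by metis
  with R(1) interpret A: aligned_projection_family U V E H P R J J'
    by unfold_locales
  show ?thesis
    using A.K.complex_hilbert_space_axioms A.operator_family_C A.unitary_W A.W_intertwines by blast
qed

theorem theorem2:
  fixes U V :: "'v set" and E :: "'v set set"
  assumes "connected_bipartite_graph U V E"
  shows "(\<forall>(H :: 'h cspace) P.
            complex_hilbert_space H \<and> projection_family U V E H P \<and> generic_position U V E H P \<longrightarrow>
            (\<exists>(K :: 'h cspace) C W.
               complex_hilbert_space K \<and> operator_family U V E K C \<and>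
               unitary H (power_space V K) W \<and>
               (\<forall>x\<in>U \<union> V. compose (carrier H) W (P x)
                           = compose (carrier H) (matrix_family U V K C x) W)))
       \<and> (\<forall>(K :: 'k cspace) C.
            complex_hilbert_space K \<and> operator_family U V E K C \<longrightarrow>
            complex_hilbert_space (power_space V K) \<and>
            projection_family U V E (power_space V K) (matrix_family U V K C))"
proof (intro conjI allI impI; (elim conjE)?)
  fix H :: "'h cspace" and P
  assume "complex_hilbert_space H" "projection_family U V E H P" "generic_position U V E H P"
  then have "generic_projection_family U V E H P"
    using assms by (intro generic_projection_family.intro generic_projection_family_axioms.intro)
  then show "\<exists>(K :: 'h cspace) C W. complex_hilbert_space K \<and> operator_family U V E K C \<and>
      unitary H (power_space V K) W \<and>
      (\<forall>x\<in>U \<union> V. compose (carrier H) W (P x) = compose (carrier H) (matrix_family U V K C x) W)"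
    by (rule generic_projection_family.matrix_representation)
next
  fix K :: "'k cspace" and C
  assume "complex_hilbert_space K" "operator_family U V E K C"
  then interpret operator_matrix U V E K C
    using assms by (intro operator_matrix.intro operator_matrix_axioms.intro connected_bipartite_graph.axioms)
  show "complex_hilbert_space (power_space V K)" by (rule KV.complex_hilbert_space_axioms)
  show "projection_family U V E (power_space V K) (matrix_family U V K C)"
    by (rule projection_family_P)
qed

end
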